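(* Let $\Sigma$ be a fixed finite alphabet. Given a $\Sigma$-tree $T$, one can compute in polynomial time the pruned $\Sigma$-tree $\overline{T}$. More precisely, in the RAM model of computation this can be done in time quadratic in the size (number of edges) of $T$.
   Context: $\Sigma$-trees. A $\Sigma$-tree is a finite directed graph with edges labelled by letters of $\Sigma$, whose underlying undirected graph is a tree, together with two distinguished vertices (the start vertex and the end vertex, possibly equal) such that there is a (possibly empty) directed path from the start vertex to the end vertex. A morphism of $\Sigma$-trees maps vertices to vertices and edges to edges, commutes with the source, target and label maps, and maps the start vertex to the start vertex and the end vertex to the end vertex. An isomorphism is a morphism bijective on vertices and edges. A retraction is an idempotent morphism from a $\Sigma$-tree to itself; its image is called a retract. A $\Sigma$-tree is pruned if it admits no non-identity retraction. It is known that for every $\Sigma$-tree $T$ there is a unique (up to isomorphism) pruned $\Sigma$-tree isomorphic to a retract of $T$; it is denoted $\overline{T}$ and called the pruning of $T$. Representation and model of computation. A $\Sigma$-tree is stored as a natural number for the start vertex, a natural number for the end vertex, and a list (in no particular order) of edges, each being a triple consisting of a label from $\Sigma$ and two natural numbers encoding its source and target vertices. The size of a $\Sigma$-tree is its number of edges. In the RAM model, integer operations and indirection (finding a value stored at a known position in an array) take unit time. Complexity is for fixed finite $\Sigma$. *)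

theory Defs
  imports
    "Graph_Theory.Graph_Theory"
    "HOL-Computational_Algebra.Polynomial"
    "HOL-Library.Landau_Symbols"
    "HOL-Library.Log_Nat"
begin

section \<open>Trees over an alphabet\<close>

record ('v, 'e, 'l) labelled_digraph =
  graph_of :: "('v, 'e) pre_digraph"
  label :: "'e \<Rightarrow> 'l"
  start_vertex :: 'v
  end_vertex :: 'v

text \<open>
  The underlying undirected multigraph, with each edge present in both orientations. The predicate
  \<^const>\<open>tree\<close> of the library cannot be used for the underlying undirected graph of a digraph:
  it excludes directed cycles only.
\<close>

definition both_ways :: "('v, 'e) pre_digraph \<Rightarrow> ('v, 'e \<times> bool) pre_digraph" where
  "both_ways G = \<lparr> verts = verts G, arcs = arcs G \<times> UNIV,
     tail = (\<lambda>(e, b). if b then tail G e else head G e),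
     head = (\<lambda>(e, b). if b then head G e else tail G e) \<rparr>"

text \<open>
  No edge may be repeated in an undirected cycle, which rules out going back and forth along
  one edge. Loops and pairs of (anti)parallel edges do count as cycles.
\<close>

definition undirected_cycle :: "('v, 'e) pre_digraph \<Rightarrow> ('e \<times> bool) list \<Rightarrow> bool" where
  "undirected_cycle G p \<longleftrightarrow> pre_digraph.cycle (both_ways G) p \<and> distinct (map fst p)"

definition undirected_tree :: "('v, 'e) pre_digraph \<Rightarrow> bool" where
  "undirected_tree G \<longleftrightarrow> connected G \<and> (\<nexists>p. undirected_cycle G p)"

definition sigma_tree :: "'l set \<Rightarrow> ('v, 'e, 'l) labelled_digraph \<Rightarrow> bool" where
  "sigma_tree \<Sigma> T \<longleftrightarrow>
     fin_digraph (graph_of T) \<and> undirected_tree (graph_of T) \<and>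
     label T ` arcs (graph_of T) \<subseteq> \<Sigma> \<and>
     start_vertex T \<in> verts (graph_of T) \<and> end_vertex T \<in> verts (graph_of T) \<and>
     start_vertex T \<rightarrow>\<^sup>*\<^bsub>graph_of T\<^esub> end_vertex T"

text \<open>A morphism is a pair of maps, relevant only on the vertices and edges of the source.\<close>

definition morphism ::
  "('v, 'e, 'l) labelled_digraph \<Rightarrow> ('w, 'f, 'l) labelled_digraph \<Rightarrow>
   ('v \<Rightarrow> 'w) \<Rightarrow> ('e \<Rightarrow> 'f) \<Rightarrow> bool" where
  "morphism S T f g \<longleftrightarrow>
     f ` verts (graph_of S) \<subseteq> verts (graph_of T) \<and>
     g ` arcs (graph_of S) \<subseteq> arcs (graph_of T) \<and>
     (\<forall>e \<in> arcs (graph_of S).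
        tail (graph_of T) (g e) = f (tail (graph_of S) e) \<and>
        head (graph_of T) (g e) = f (head (graph_of S) e) \<and>
        label T (g e) = label S e) \<and>
     f (start_vertex S) = start_vertex T \<and> f (end_vertex S) = end_vertex T"

definition isomorphic ::
  "('v, 'e, 'l) labelled_digraph \<Rightarrow> ('w, 'f, 'l) labelled_digraph \<Rightarrow> bool" where
  "isomorphic S T \<longleftrightarrow> (\<exists>f g. morphism S T f g \<and>
     bij_betw f (verts (graph_of S)) (verts (graph_of T)) \<and>
     bij_betw g (arcs (graph_of S)) (arcs (graph_of T)))"

definition retraction ::
  "('v, 'e, 'l) labelled_digraph \<Rightarrow> ('v \<Rightarrow> 'v) \<Rightarrow> ('e \<Rightarrow> 'e) \<Rightarrow> bool" where
  "retraction T f g \<longleftrightarrow> morphism T T f g \<and>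
     (\<forall>v \<in> verts (graph_of T). f (f v) = f v) \<and>
     (\<forall>e \<in> arcs (graph_of T). g (g e) = g e)"

definition image_of ::
  "('v, 'e, 'l) labelled_digraph \<Rightarrow> ('v \<Rightarrow> 'v) \<Rightarrow> ('e \<Rightarrow> 'e) \<Rightarrow> ('v, 'e, 'l) labelled_digraph" where
  "image_of T f g = T \<lparr> graph_of := (graph_of T)
     \<lparr> verts := f ` verts (graph_of T), arcs := g ` arcs (graph_of T) \<rparr> \<rparr>"

definition pruned :: "('v, 'e, 'l) labelled_digraph \<Rightarrow> bool" where
  "pruned T \<longleftrightarrow> (\<forall>f g. retraction T f g \<longrightarrow>
     (\<forall>v \<in> verts (graph_of T). f v = v) \<and> (\<forall>e \<in> arcs (graph_of T). g e = e))"

text \<open>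
  The pruning of a tree is unique only up to isomorphism, so it is rendered as a relation:
  \<open>P\<close> is the pruning of \<open>T\<close>.
\<close>

definition is_pruning ::
  "'l set \<Rightarrow> ('w, 'f, 'l) labelled_digraph \<Rightarrow> ('v, 'e, 'l) labelled_digraph \<Rightarrow> bool" where
  "is_pruning \<Sigma> P T \<longleftrightarrow> sigma_tree \<Sigma> P \<and> pruned P \<and>
     (\<exists>f g. retraction T f g \<and> isomorphic P (image_of T f g))"


section \<open>Stored trees\<close>

text \<open>Start vertex, end vertex, and the edges as triples of label, source and target.\<close>

type_synonym 'l stored_tree = "nat \<times> nat \<times> ('l \<times> nat \<times> nat) list"

fun edge_list :: "'l stored_tree \<Rightarrow> ('l \<times> nat \<times> nat) list" where
  "edge_list (s, t, es) = es"

definition tree_size :: "'l stored_tree \<Rightarrow> nat" where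
  "tree_size R = length (edge_list R)"

text \<open>
  Edges are identified with positions in the list, so a repeated triple gives parallel edges
  and the size is the number of edges. In a tree every vertex other than an endpoint of an edge
  is the start vertex, so that no vertex is lost in this representation.
\<close>

fun tree_of :: "'l stored_tree \<Rightarrow> (nat, nat, 'l) labelled_digraph" where
  "tree_of (s, t, es) =
     \<lparr> graph_of =
         \<lparr> verts = {s, t} \<union> (\<Union>(a, u, v) \<in> set es. {u, v}),
           arcs = {..<length es},
           tail = (\<lambda>i. fst (snd (es ! i))),
           head = (\<lambda>i. snd (snd (es ! i))) \<rparr>,
       label = (\<lambda>i. fst (es ! i)),
       start_vertex = s,
       end_vertex = t \<rparr>"

text \<open>The memory contents; \<open>code\<close> is the numbering of the letters of the alphabet.\<close>

fun cells :: "('l \<Rightarrow> nat) \<Rightarrow> 'l stored_tree \<Rightarrow> int list" where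
  "cells code (s, t, es) = [int (length es), int s, int t] @
     concat (map (\<lambda>(a, u, v). [int (code a), int u, int v]) es)"


section \<open>Random access machines\<close>

text \<open>
  There is a register file and, separately, an array of memory cells, indexed by the
  natural numbers; all hold integers. \<open>Load d a\<close> copies the cell whose address is in register
  \<open>a\<close> into register \<open>d\<close>, and \<open>Store a r\<close> copies register \<open>r\<close> into the cell whose address is in
  register \<open>a\<close>.
\<close>

datatype instr =
    Const nat int
  | Add nat nat nat
  | Sub nat nat nat
  | Mul nat nat nat
  | Div nat nat nat
  | Load nat nat
  | Store nat nat
  | Jump nat
  | JumpZero nat nat
  | JumpNeg nat nat
  | Halt

record ram_state =
  pc :: nat
  reg :: "nat \<Rightarrow> int"
  mem :: "nat \<Rightarrow> int"

definition set_reg :: "nat \<Rightarrow> int \<Rightarrow> ram_state \<Rightarrow> ram_state" where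
  "set_reg d z s = s \<lparr> pc := Suc (pc s), reg := (reg s)(d := z) \<rparr>"

fun step_instr :: "instr \<Rightarrow> ram_state \<Rightarrow> ram_state option" where
  "step_instr (Const d k) s = Some (set_reg d k s)"
| "step_instr (Add d a b) s = Some (set_reg d (reg s a + reg s b) s)"
| "step_instr (Sub d a b) s = Some (set_reg d (reg s a - reg s b) s)"
| "step_instr (Mul d a b) s = Some (set_reg d (reg s a * reg s b) s)"
| "step_instr (Div d a b) s = Some (set_reg d (reg s a div reg s b) s)"
| "step_instr (Load d a) s =
     (if reg s a < 0 then None else Some (set_reg d (mem s (nat (reg s a))) s))"
| "step_instr (Store a r) s =
     (if reg s a < 0 then None
      else Some (s \<lparr> pc := Suc (pc s), mem := (mem s)(nat (reg s a) := reg s r) \<rparr>))"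
| "step_instr (Jump l) s = Some (s \<lparr> pc := l \<rparr>)"
| "step_instr (JumpZero r l) s = Some (s \<lparr> pc := if reg s r = 0 then l else Suc (pc s) \<rparr>)"
| "step_instr (JumpNeg r l) s = Some (s \<lparr> pc := if reg s r < 0 then l else Suc (pc s) \<rparr>)"
| "step_instr Halt s = None"

definition step :: "instr list \<Rightarrow> ram_state \<Rightarrow> ram_state option" where
  "step P s = (if pc s < length P then step_instr (P ! pc s) s else None)"

inductive exec ::
  "(instr \<Rightarrow> ram_state \<Rightarrow> nat) \<Rightarrow> instr list \<Rightarrow> ram_state \<Rightarrow> nat \<Rightarrow> ram_state \<Rightarrow> bool"
  for cost P where
  exec_refl: "exec cost P s 0 s"
| exec_step: "step P s = Some s' \<Longrightarrow> exec cost P s' n s'' \<Longrightarrow>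
    exec cost P s (cost (P ! pc s) s + n) s''"

definition halted :: "instr list \<Rightarrow> ram_state \<Rightarrow> bool" where
  "halted P s \<longleftrightarrow> pc s < length P \<and> P ! pc s = Halt"

definition unit_cost :: "instr \<Rightarrow> ram_state \<Rightarrow> nat" where
  "unit_cost c s = 1"

definition bit_size :: "int \<Rightarrow> nat" where
  "bit_size z = Suc (nat (bitlen \<bar>z\<bar>))"

text \<open>
  Each instruction is charged the lengths of its operands. Results need no charge: they are at
  most one bit longer than the operands together.
\<close>

fun log_cost :: "instr \<Rightarrow> ram_state \<Rightarrow> nat" where
  "log_cost (Const d k) s = bit_size k"
| "log_cost (Add d a b) s = bit_size (reg s a) + bit_size (reg s b)"
| "log_cost (Sub d a b) s = bit_size (reg s a) + bit_size (reg s b)"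
| "log_cost (Mul d a b) s = bit_size (reg s a) + bit_size (reg s b)"
| "log_cost (Div d a b) s = bit_size (reg s a) + bit_size (reg s b)"
| "log_cost (Load d a) s = bit_size (reg s a) + bit_size (mem s (nat (reg s a)))"
| "log_cost (Store a r) s = bit_size (reg s a) + bit_size (reg s r)"
| "log_cost (Jump l) s = 1"
| "log_cost (JumpZero r l) s = bit_size (reg s r)"
| "log_cost (JumpNeg r l) s = bit_size (reg s r)"
| "log_cost Halt s = 1"


section \<open>Computing the pruning\<close>

definition input_bits :: "('l \<Rightarrow> nat) \<Rightarrow> 'l stored_tree \<Rightarrow> nat" where
  "input_bits code R = sum_list (map bit_size (cells code R))"

definition initial_state :: "('l \<Rightarrow> nat) \<Rightarrow> 'l stored_tree \<Rightarrow> ram_state" where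
  "initial_state code R = \<lparr> pc = 0, reg = (\<lambda>_. 0),
     mem = (\<lambda>i. if i < length (cells code R) then cells code R ! i else 0) \<rparr>"

text \<open>The cells beyond the stored tree may contain anything.\<close>

definition holds_tree :: "('l \<Rightarrow> nat) \<Rightarrow> ram_state \<Rightarrow> 'l stored_tree \<Rightarrow> bool" where
  "holds_tree code s R \<longleftrightarrow> (\<forall>i < length (cells code R). mem s i = cells code R ! i)"

definition computes_pruning_within ::
  "(instr \<Rightarrow> ram_state \<Rightarrow> nat) \<Rightarrow> 'l set \<Rightarrow> ('l \<Rightarrow> nat) \<Rightarrow> instr list \<Rightarrow>
   'l stored_tree \<Rightarrow> nat \<Rightarrow> bool" where
  "computes_pruning_within cost \<Sigma> code P R n \<longleftrightarrow>
     (\<exists>m s R'. m \<le> n \<and> exec cost P (initial_state code R) m s \<and> halted P s \<and>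
        holds_tree code s R' \<and> is_pruning \<Sigma> (tree_of R') (tree_of R))"

end

theory Submission
  imports Defs
begin

text \<open>The tree is first renumbered: starting from the start vertex, an edge with exactly one numbered end
is searched repeatedly, and its other end gets the next number. In a tree with \<open>n\<close> edges this
assigns the numbers \<open>1, \<dots>, n + 1\<close>, every vertex except the root has a parent with a smaller
number, and an edge can be named by its child. That all edges are found uses that the tree is connected;
that none of them ends up with both ends numbered by other edges uses that it has no undirected cycle
(\<open>numbering_complete\<close>, \<open>inner_arc_numbered\<close>).

Say that the vertex \<open>i\<close> fits at \<open>z\<close> if the subtree below \<open>i\<close> has a morphism into the whole tree that
sends \<open>i\<close> to \<open>z\<close> and does not move the end vertex. Since a subtree is a tree, this can be decided
locally: every edge from \<open>i\<close> to a child \<open>j\<close> must have a partner edge at \<open>z\<close> with the same label and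
direction at whose other end \<open>j\<close> fits. Going through the children from the largest number down, one
pass over all edges for each child fills the whole table in quadratic time.

The subtree at \<open>w\<close> is folded away if it fits at another neighbour \<open>x\<close> of its parent, reached by
an edge with the same label and direction. The vertices are treated in increasing order, and \<open>x\<close> must
not have been folded away before. The key fact is that the table need not be recomputed: whenever a
vertex fits at a vertex that has been folded away, it also fits at a surviving one, because
fitting is preserved by morphisms of the whole tree and each folding is such a morphism
(\<open>alive_link\<close>). So a morphism onto the surviving vertices can be chosen from the root downwards
(\<open>alive_retract\<close>). Conversely, a morphism of the surviving tree that moves some vertex moves a smallest
one, whose subtree then fits at another surviving neighbour of its parent, so that it would have been
folded away (\<open>alive_rigid\<close>). Hence the surviving tree is pruned. The directed path from the start vertex to the
end vertex is not lost, since a morphism that fixes both of them maps it to another such path.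

The program is written in a small structured language with integer variables and several unbounded arrays,
which is compiled to the machine by interleaving the arrays in memory behind the input
(\<open>com_code_correct\<close>). Neither multiplication nor division is ever executed. One addition
or subtraction at most doubles the largest absolute value, so after \<open>k\<close> steps all numbers have at most \<open>k\<close> bits
more than the longest one in the input and in the program, and a polynomial bound for the logarithmic cost follows from the bound for the number of steps
(\<open>exec_log_cost\<close>).\<close>

section \<open>Folding subtrees of a numbered tree\<close>

text \<open>The vertices are \<open>1, \<dots>, m\<close> with root \<open>1\<close>, and every edge is named by its child. The source of edge \<open>i\<close> is
\<open>en False i\<close>, its target is \<open>en True i\<close>; the bit \<open>dir i\<close> says which of the two is the child.
Indexing the ends by a bit lets one argument, and later one piece of code, treat both directions.\<close>

locale numbered_tree =
  fixes m :: nat and lab :: "nat \<Rightarrow> 'l" and en :: "bool \<Rightarrow> nat \<Rightarrow> nat"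
    and dir :: "nat \<Rightarrow> bool" and t :: nat
  assumes child: "i \<in> {2..m} \<Longrightarrow> en (dir i) i = i"
    and parent: "i \<in> {2..m} \<Longrightarrow> en (\<not> dir i) i \<in> {1..<i}"
    and end_vertex: "t \<in> {1..m}"
begin

definition par :: "nat \<Rightarrow> nat" where
  "par i = en (\<not> dir i) i"

text \<open>Some edge with the label of edge \<open>i\<close> lies between \<open>x\<close> and \<open>y\<close> such that, with respect to its
direction, \<open>x\<close> is in the role of the parent of \<open>i\<close> and \<open>y\<close> in the role of \<open>i\<close>.\<close>

definition link :: "nat \<Rightarrow> nat \<Rightarrow> nat \<Rightarrow> bool" where
  "link i x y \<longleftrightarrow> (\<exists>f \<in> {2..m}. lab f = lab i \<and> en (\<not> dir i) f = x \<and> en (dir i) f = y)"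

text \<open>The subtree below \<open>i\<close> maps into the whole tree, with \<open>i\<close> sent to \<open>z\<close> and \<open>t\<close> to itself. No
global map is mentioned: the images of different children can be chosen independently.\<close>

inductive fits :: "nat \<Rightarrow> nat \<Rightarrow> bool" where
  "z \<in> {1..m} \<Longrightarrow> (i = t \<Longrightarrow> z = t) \<Longrightarrow>
   (\<And>j. j \<in> {2..m} \<Longrightarrow> par j = i \<Longrightarrow> \<exists>z'. link j z z' \<and> fits j z') \<Longrightarrow> fits i z"

text \<open>The vertex maps of endomorphisms. In a tree they determine the edge maps.\<close>

definition hom :: "(nat \<Rightarrow> nat) \<Rightarrow> bool" where
  "hom \<phi> \<longleftrightarrow> \<phi> ` {1..m} \<subseteq> {1..m} \<and> \<phi> 1 = 1 \<and> \<phi> t = t \<and>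
     (\<forall>i \<in> {2..m}. link i (\<phi> (par i)) (\<phi> i))"

lemma par_less: "i \<in> {2..m} \<Longrightarrow> par i \<in> {1..<i}"
  using parent by (simp add: par_def)

lemma root: "1 \<in> {1..m}"
  using end_vertex by simp

lemma link_vertices: "link i x y \<Longrightarrow> x \<in> {1..m} \<and> y \<in> {1..m}"
proof -
  have "en b f \<in> {1..m}" if "f \<in> {2..m}" for b f
    using child[OF that] parent[OF that] that by (cases "b = dir f") auto
  then show "link i x y \<Longrightarrow> x \<in> {1..m} \<and> y \<in> {1..m}" unfolding link_def by blast
qed

lemma link_self: "i \<in> {2..m} \<Longrightarrow> link i (par i) i"
  unfolding link_def par_def using child by blast

lemma link_cong: "link i x y \<Longrightarrow> lab i = lab j \<Longrightarrow> dir i = dir j \<Longrightarrow> link j x y"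
  by (simp only: link_def)

text \<open>A link is an edge, and this edge is named by one of its two ends.\<close>

lemma link_cases:
  assumes "link i x y"
  shows "y \<in> {2..m} \<and> par y = x \<and> lab y = lab i \<and> dir y = dir i \<or> x \<in> {2..m} \<and> y = par x"
proof -
  from assms obtain f where f: "f \<in> {2..m}" "lab f = lab i" "en (\<not> dir i) f = x" "en (dir i) f = y"
    unfolding link_def by blast
  show ?thesis
    using f child[OF f(1)] by (cases "dir f = dir i") (auto simp: par_def)
qed

lemma hom_link:
  assumes "hom \<phi>" "link i x y"
  shows "link i (\<phi> x) (\<phi> y)"
proof -
  from assms obtain f where f: "f \<in> {2..m}" "lab f = lab i" "en (\<not> dir i) f = x" "en (dir i) f = y"
    unfolding link_def by blast
  have "link f (\<phi> (par f)) (\<phi> f)" using assms(1) f(1) unfolding hom_def by blast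
  then obtain g where g: "g \<in> {2..m}" "lab g = lab f" "en (\<not> dir f) g = \<phi> (par f)" "en (dir f) g = \<phi> f"
    unfolding link_def by blast
  have "en b g = \<phi> (en b f)" for b
    using g child[OF f(1)] by (cases "b = dir f") (auto simp: par_def)
  then show ?thesis unfolding link_def using f g by auto
qed

lemma fits_child:
  "fits (par i) z \<Longrightarrow> i \<in> {2..m} \<Longrightarrow> \<exists>z'. link i z z' \<and> fits i z'"
  by (blast elim: fits.cases)

text \<open>Composing a map of a subtree with an endomorphism of the whole tree gives a map of the subtree again.\<close>

lemma fits_hom:
  assumes "fits i z" "hom \<phi>" shows "fits i (\<phi> z)"
  using assms(1)
proof induction
  case (1 z i)
  show ?case
  proof (rule fits.intros)
    show "\<phi> z \<in> {1..m}" using 1(1) assms(2) unfolding hom_def by blast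
    show "i = t \<Longrightarrow> \<phi> z = t" using 1(2) assms(2) unfolding hom_def by simp
    fix j assume "j \<in> {2..m}" "par j = i"
    then show "\<exists>z'. link j (\<phi> z) z' \<and> fits j z'" using 1(3) hom_link[OF assms(2)] by blast
  qed
qed

lemma fits_self: "i \<in> {1..m} \<Longrightarrow> fits i i"
proof (induction "m - i" arbitrary: i rule: less_induct)
  case less
  show ?case
  proof (rule fits.intros)
    fix j assume j: "j \<in> {2..m}" "par j = i"
    with par_less[OF j(1)] have "fits j j" by (intro less(1)) auto
    then show "\<exists>z'. link j i z' \<and> fits j z'" using link_self[OF j(1)] j(2) by blast
  qed (use less in auto)
qed

lemma hom_fits: "hom \<phi> \<Longrightarrow> i \<in> {1..m} \<Longrightarrow> fits i (\<phi> i)"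
  using fits_self fits_hom by blast

text \<open>A local rule for possible images, in which every choice at a parent extends to each of its
children, yields an endomorphism: the images are chosen in the order of the numbers.\<close>

lemma choose_hom:
  assumes good_root: "good 1 1"
    and one: "\<And>z. good 1 z \<Longrightarrow> z = 1" and t: "\<And>z. good t z \<Longrightarrow> z = t"
    and ver: "\<And>i z. good i z \<Longrightarrow> z \<in> {1..m}"
    and step: "\<And>i z. i \<in> {2..m} \<Longrightarrow> good (par i) z \<Longrightarrow> \<exists>z'. link i z z' \<and> good i z'"
  obtains \<phi> where "hom \<phi>" "\<And>i. i \<in> {1..m} \<Longrightarrow> good i (\<phi> i)"
proof -
  have "\<exists>\<phi>. \<phi> 1 = 1 \<and> (\<forall>i \<in> {1..k}. good i (\<phi> i)) \<and> (\<forall>i \<in> {2..k}. link i (\<phi> (par i)) (\<phi> i))"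
    if "1 \<le> k" "k \<le> m" for k
    using that
  proof (induction k rule: dec_induct)
    case base
    show ?case by (rule exI[of _ "\<lambda>_. 1"]) (use good_root in auto)
  next
    case (step n)
    then obtain \<phi> where \<phi>: "\<phi> 1 = 1" "\<forall>i \<in> {1..n}. good i (\<phi> i)"
      "\<forall>i \<in> {2..n}. link i (\<phi> (par i)) (\<phi> i)" by auto
    have S: "Suc n \<in> {2..m}" using step by auto
    have p: "par (Suc n) \<in> {1..n}" using par_less[OF S] by auto
    with \<phi> obtain z where z: "link (Suc n) (\<phi> (par (Suc n))) z" "good (Suc n) z"
      using assms(5)[OF S] by blast
    \<comment> \<open>The parent of \<open>Suc n\<close> has been mapped already, so the rule offers an image \<open>z\<close>.\<close>
    let ?\<psi> = "\<phi>(Suc n := z)"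
    have old: "?\<psi> i = \<phi> i" if "i \<le> n" for i using that by simp
    have "link i (?\<psi> (par i)) (?\<psi> i)" if i: "i \<in> {2..Suc n}" for i
    proof -
      have "par i \<le> n" using par_less[of i] i step by auto
      then show ?thesis using \<phi>(3) z(1) i by (cases "i = Suc n") auto
    qed
    moreover have "\<forall>i \<in> {1..Suc n}. good i (?\<psi> i)" using \<phi>(2) z(2) by (auto simp: le_Suc_eq)
    ultimately show ?case using \<phi>(1) step by (intro exI[of _ ?\<psi>]) auto
  qed
  moreover have "1 \<le> m" using root by simp
  ultimately obtain \<phi> where \<phi>: "\<phi> 1 = 1" "\<forall>i \<in> {1..m}. good i (\<phi> i)"
    "\<forall>i \<in> {2..m}. link i (\<phi> (par i)) (\<phi> i)" by blast
  then have "hom \<phi>" unfolding hom_def using t ver end_vertex by blast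
  with \<phi> that show thesis by blast
qed

inductive below :: "nat \<Rightarrow> nat \<Rightarrow> bool" for w where
  "below w w"
| "below w (par i) \<Longrightarrow> i \<in> {2..m} \<Longrightarrow> below w i"

lemma below_ge: "below w i \<Longrightarrow> w \<le> i"
proof (induction rule: below.induct)
  case (2 i)
  then show ?case using par_less[of i] by simp
qed simp

text \<open>If \<open>w\<close> fits at another end of an edge like its own, then folding the subtree below \<open>w\<close> there and
leaving everything else in place is an endomorphism.\<close>

lemma fold_hom:
  assumes w: "w \<in> {2..m}" and x: "link w (par w) x" "fits w x"
  obtains \<phi> where "hom \<phi>" "\<phi> w = x"
proof -
  \<comment> \<open>Below \<open>w\<close> any fitting vertex is allowed, elsewhere only the vertex itself.\<close>
  let ?good = "\<lambda>i z. z \<in> {1..m} \<and> (if below w i then fits i z \<and> (i = w \<longrightarrow> z = x) else z = i)"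
  have nb: "\<not> below w 1" "\<not> below w (par w)"
    using below_ge[of w 1] below_ge[of w "par w"] w par_less[OF w] by auto
  have step: "\<exists>z'. link i z z' \<and> ?good i z'" if i: "i \<in> {2..m}" and g: "?good (par i) z" for i z
  proof (cases "below w i")
    case False
    then have "\<not> below w (par i)" using below.intros(2) i by blast
    with g False link_self[OF i] i show ?thesis by (intro exI[of _ i]) auto
  next
    case True
    show ?thesis
    proof (cases "i = w")
      case True
      then show ?thesis using g nb x link_vertices[OF x(1)] below.intros(1)[of w]
        by (intro exI[of _ x]) auto
    next
      case False
      with True have b: "below w (par i)" by (auto elim: below.cases)
      with g have "fits (par i) z" by auto
      then obtain z' where "link i z z'" "fits i z'" using fits_child i by blast
      then show ?thesis using True False link_vertices by (intro exI[of _ z']) auto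
    qed
  qed
  have end_good: "z = t" if "?good t z" for z
    using that by (auto split: if_splits elim: fits.cases)
  have "?good 1 1" "\<And>z. ?good 1 z \<Longrightarrow> z = 1" using nb root by simp_all
  from choose_hom[of ?good, OF this end_good conjunct1 step]
  obtain \<phi> where \<phi>: "hom \<phi>" "\<And>i. i \<in> {1..m} \<Longrightarrow> ?good i (\<phi> i)" by blast
  from \<phi>(2)[of w] w have "\<phi> w = x" using below.intros(1)[of w] by simp
  with \<phi>(1) show thesis by (rule that)
qed

end

text \<open>The vertices are decided in increasing order. When \<open>w\<close> is decided, the vertices with a
larger number still count as alive; this is why \<open>alive x\<close> is asked only for \<open>x < w\<close>.\<close>

locale folded_tree = numbered_tree +
  fixes alive :: "nat \<Rightarrow> bool"
  assumes alive_root: "alive 1"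
    and alive_iff: "w \<in> {2..m} \<Longrightarrow> alive w \<longleftrightarrow> alive (par w) \<and>
      (\<nexists>x. link w (par w) x \<and> x \<noteq> w \<and> fits w x \<and> (x < w \<longrightarrow> alive x))"
begin

text \<open>A dead neighbour \<open>z'\<close> of a living vertex was folded to some \<open>x\<close>, and what fits at
\<open>z'\<close> also fits at \<open>x\<close> by the folding endomorphism. If \<open>x\<close> is dead as well, then it died
later and has a larger number, so that repeating this ends at a living vertex.\<close>

lemma alive_link:
  assumes "alive z" "link j z z'" "fits j z'"
  shows "\<exists>z'. alive z' \<and> link j z z' \<and> fits j z'"
  using assms(2,3)
proof (induction "m - z'" arbitrary: z' rule: less_induct)
  case less
  show ?case
  proof (cases "alive z'")
    case True
    then show ?thesis using less by blast
  next
    case False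
    then have z': "z' \<in> {2..m}" "par z' = z" "lab z' = lab j" "dir z' = dir j"
      using link_cases[OF less(2)] alive_iff assms(1) by auto
    with False alive_iff[OF z'(1)] assms(1) obtain x where
      x: "link z' z x" "x \<noteq> z'" "fits z' x" "x < z' \<longrightarrow> alive x" by auto
    then obtain \<phi> where "hom \<phi>" "\<phi> z' = x" using fold_hom[of z' x] z' by blast
    then have "fits j x" using fits_hom[OF less(3)] by blast
    moreover have "link j z x" using link_cong[OF x(1)] z' by blast
    moreover have "alive x \<or> m - x < m - z'" using x link_vertices[OF x(1)] by auto
    ultimately show ?thesis using less(1) by blast
  qed
qed

theorem alive_retract:
  obtains \<rho> where "hom \<rho>" "\<And>x. x \<in> {1..m} \<Longrightarrow> alive (\<rho> x)"
    "\<And>x. x \<in> {1..m} \<Longrightarrow> alive x \<Longrightarrow> \<rho> x = x"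
proof -
  \<comment> \<open>Dead vertices may go to any living vertex where they fit; \<open>alive_link\<close> says that there is always one.\<close>
  let ?good = "\<lambda>i z. z \<in> {1..m} \<and> alive z \<and> fits i z \<and> (alive i \<longrightarrow> z = i)"
  have step: "\<exists>z'. link i z z' \<and> ?good i z'" if i: "i \<in> {2..m}" and g: "?good (par i) z" for i z
  proof (cases "alive i")
    case True
    with g alive_iff[OF i] link_self[OF i] fits_self[of i] i show ?thesis
      by (intro exI[of _ i]) auto
  next
    case False
    from g have "fits (par i) z" by auto
    then obtain z' where "link i z z'" "fits i z'" using fits_child i by blast
    with alive_link g obtain z' where "alive z'" "link i z z'" "fits i z'" by blast
    then show ?thesis using False link_vertices by blast
  qed
  have end_good: "z = t" if "?good t z" for z
    using that by (auto elim: fits.cases)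
  have "?good 1 1" "\<And>z. ?good 1 z \<Longrightarrow> z = 1"
    using root alive_root fits_self[OF root] by simp_all
  from choose_hom[of ?good, OF this end_good conjunct1 step]
  obtain \<phi> where "hom \<phi>" "\<And>i. i \<in> {1..m} \<Longrightarrow> ?good i (\<phi> i)" by blast
  with that show thesis by blast
qed

lemma alive_t: "alive t"
proof -
  obtain \<rho> where "hom \<rho>" "\<And>x. x \<in> {1..m} \<Longrightarrow> alive (\<rho> x)" using alive_retract by blast
  then show ?thesis using end_vertex unfolding hom_def by metis
qed

lemma alive_en:
  assumes "i \<in> {2..m}" "alive i" shows "alive (en b i)"
  using assms alive_iff[of i] child[of i] by (cases "b = dir i") (auto simp: par_def)

lemma alive_edge:
  assumes "f \<in> {2..m}" "alive (en False f)" "alive (en True f)" shows "alive f"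
  using assms child[of f] by (cases "dir f") auto

text \<open>Composed with the retraction, \<open>\<psi>\<close> becomes an endomorphism of the whole tree. The smallest vertex that it
moves fits at its image, which is alive and hangs at the same parent by an edge of the same kind; then that vertex
would not have been alive.\<close>

theorem alive_rigid:
  assumes \<psi>: "\<psi> ` {x \<in> {1..m}. alive x} \<subseteq> {x \<in> {1..m}. alive x}" "\<psi> 1 = 1" "\<psi> t = t"
    and edge: "\<And>i. i \<in> {2..m} \<Longrightarrow> alive i \<Longrightarrow>
      \<exists>f \<in> {2..m}. lab f = lab i \<and> (\<forall>b. en b f = \<psi> (en b i))"
    and x: "x \<in> {1..m}" "alive x"
  shows "\<psi> x = x"
proof -
  obtain \<rho> where \<rho>: "hom \<rho>" "\<And>x. x \<in> {1..m} \<Longrightarrow> alive (\<rho> x)"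
    "\<And>x. x \<in> {1..m} \<Longrightarrow> alive x \<Longrightarrow> \<rho> x = x" using alive_retract by blast
  have link: "link i (\<psi> x) (\<psi> y)" if "link i x y" "alive x" "alive y" for i x y
  proof -
    from that obtain f where f: "f \<in> {2..m}" "lab f = lab i" "en (\<not> dir i) f = x" "en (dir i) f = y"
      unfolding link_def by blast
    have "alive f" using f that(2,3) alive_edge[OF f(1)] by (cases "dir i") auto
    from edge[OF f(1) this] show ?thesis unfolding link_def using f by auto
  qed
  have hom: "hom (\<psi> \<circ> \<rho>)"
    unfolding hom_def
  proof (intro conjI ballI)
    show "(\<psi> \<circ> \<rho>) ` {1..m} \<subseteq> {1..m}" using \<psi>(1) \<rho>(1,2) unfolding hom_def image_subset_iff by simp
    fix i assume i: "i \<in> {2..m}"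
    then have "par i \<in> {1..m}" using par_less[OF i] by auto
    then show "link i ((\<psi> \<circ> \<rho>) (par i)) ((\<psi> \<circ> \<rho>) i)"
      using link \<rho> i unfolding hom_def by auto
  qed (use \<rho>(1) \<psi> in \<open>auto simp: hom_def\<close>)
  show ?thesis using x
  proof (induction x rule: less_induct)
    case (less w)
    show ?case
    proof (cases "w = 1")
      case False
      then have w: "w \<in> {2..m}" using less by auto
      then have p: "alive (par w)" "par w \<in> {1..m}" "\<psi> (par w) = par w"
        using alive_iff[OF w] less par_less[OF w] by auto
      have "link w (par w) (\<psi> w)" using link[OF link_self[OF w]] p less by simp
      moreover have "fits w (\<psi> w)" using hom_fits[OF hom, of w] \<rho>(3) less by simp
      moreover have "alive (\<psi> w)" using \<psi>(1) less by blast
      ultimately show ?thesis using alive_iff[OF w] less by auto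
    qed (use \<psi> in simp)
  qed
qed

end

section \<open>Numberings of undirected trees\<close>

definition arc_end :: "('v, 'e) pre_digraph \<Rightarrow> bool \<Rightarrow> 'e \<Rightarrow> 'v" where
  "arc_end G b e = (if b then head G e else tail G e)"

lemma both_ways_simps:
  "verts (both_ways G) = verts G" "arcs (both_ways G) = arcs G \<times> UNIV"
  "tail (both_ways G) (e, b) = arc_end G (\<not> b) e" "head (both_ways G) (e, b) = arc_end G b e"
  by (auto simp: both_ways_def arc_end_def)

lemma arc_end_verts: "wf_digraph G \<Longrightarrow> e \<in> arcs G \<Longrightarrow> arc_end G b e \<in> verts G"
  by (simp add: arc_end_def wf_digraph.head_in_verts wf_digraph.tail_in_verts)

lemma arcs_ends_mk_symmetric:
  "u \<rightarrow>\<^bsub>mk_symmetric G\<^esub> v \<longleftrightarrow> (\<exists>e \<in> arcs G. \<exists>b. u = arc_end G (\<not> b) e \<and> v = arc_end G b e)"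
  by (auto simp: parcs_mk_symmetric arc_end_def ex_bool_eq)

text \<open>The form in which connectedness is used: a nonempty set of vertices that is closed under the
edges in both directions contains all vertices.\<close>

lemma connected_spread:
  assumes "connected G" "X \<subseteq> verts G" "X \<noteq> {}"
    and closed: "\<And>e b. e \<in> arcs G \<Longrightarrow> arc_end G (\<not> b) e \<in> X \<Longrightarrow> arc_end G b e \<in> X"
  shows "X = verts G"
proof
  show "verts G \<subseteq> X"
  proof
    fix v assume "v \<in> verts G"
    moreover obtain u where u: "u \<in> X" using assms by blast
    ultimately have "u \<rightarrow>\<^sup>*\<^bsub>mk_symmetric G\<^esub> v"
      using assms(1,2) unfolding connected_def strongly_connected_def by auto
    then have "(u, v) \<in> (arcs_ends (with_proj (mk_symmetric G)))\<^sup>*" by (rule reachable_rtranclI)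
    then show "v \<in> X"
    proof (induction rule: rtrancl_induct)
      case (step x y)
      then obtain e b where "e \<in> arcs G" "x = arc_end G (\<not> b) e" "y = arc_end G b e"
        unfolding arcs_ends_mk_symmetric by blast
      then show ?case using closed step(3) by simp
    qed (rule u)
  qed
qed (rule assms)

abbreviation "walk G \<equiv> pre_digraph.cas (both_ways G)"
abbreviation "walk_verts G \<equiv> pre_digraph.awalk_verts (both_ways G)"

lemmas walk_simps = pre_digraph.cas.simps pre_digraph.awalk_verts.simps both_ways_simps

lemma walk_ends:
  assumes "walk G u p v" "(e, c) \<in> set p"
  shows "arc_end G b e \<in> set (walk_verts G u p)"
  using assms
proof (induction p arbitrary: u)
  case (Cons a p)
  obtain e' c' where a: "a = (e', c')" by (cases a)
  have hd: "w \<in> set (walk_verts G w q)"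
    if "walk G w q v" for w q
    using that by (cases q) (auto simp: walk_simps)
  show ?case
  proof (cases "e = e'")
    case True
    then show ?thesis using Cons(2) hd[of "arc_end G c' e'" p] a
      by (cases "b = c'") (auto simp: walk_simps)
  next
    case False
    then show ?thesis using Cons(2,3) Cons(1)[of "arc_end G c' e'"] a
      by (auto simp: walk_simps)
  qed
qed simp

text \<open>Using an edge twice, in whatever directions, visits one of its ends twice.\<close>

lemma path_distinct_edges:
  assumes "walk G u p v"
    "distinct (walk_verts G u p)"
  shows "distinct (map fst p)"
  using assms
proof (induction p arbitrary: u)
  case (Cons a p)
  obtain e c where a: "a = (e, c)" by (cases a)
  then have *: "walk G (arc_end G c e) p v"
    "arc_end G (\<not> c) e \<notin> set (walk_verts G (arc_end G c e) p)"
    "distinct (walk_verts G (arc_end G c e) p)"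
    using Cons(2,3) by (auto simp: walk_simps)
  then have "e \<notin> fst ` set p" using walk_ends[OF *(1), of e _ "\<not> c"] by auto
  then show ?case using Cons(1)[OF *(1,3)] a by simp
qed simp

text \<open>A part of the tree \<open>T\<close> that has been explored from the start vertex: \<open>vt i\<close> is the vertex with number \<open>i\<close>, and
for \<open>i \<ge> 2\<close> the edge \<open>ge i\<close> leads to it from a vertex with a smaller number. The functions
\<open>en\<close> and \<open>dir\<close> describe these edges in terms of the numbers.\<close>

definition numbering ::
  "('v, 'e, 'l) labelled_digraph \<Rightarrow> nat \<Rightarrow> (nat \<Rightarrow> 'v) \<Rightarrow> (nat \<Rightarrow> 'e) \<Rightarrow>
   (bool \<Rightarrow> nat \<Rightarrow> nat) \<Rightarrow> (nat \<Rightarrow> bool) \<Rightarrow> bool" where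
  "numbering T k vt ge en dir \<longleftrightarrow> 1 \<le> k \<and> vt 1 = start_vertex T \<and> inj_on vt {1..k} \<and>
     (\<forall>i \<in> {2..k}. ge i \<in> arcs (graph_of T) \<and> en (dir i) i = i \<and> en (\<not> dir i) i \<in> {1..<i} \<and>
        (\<forall>b. vt (en b i) = arc_end (graph_of T) b (ge i)))"

lemma numbering_1: "numbering T 1 (\<lambda>_. start_vertex T) ge en dir"
  by (simp add: numbering_def)

lemma numbering_Suc:
  assumes "numbering T k vt ge en dir" "e \<in> arcs (graph_of T)" "p \<in> {1..k}"
    "arc_end (graph_of T) (\<not> b) e = vt p" "arc_end (graph_of T) b e \<notin> vt ` {1..k}"
  shows "numbering T (Suc k) (vt(Suc k := arc_end (graph_of T) b e)) (ge(Suc k := e))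
    (\<lambda>c. (en c)(Suc k := if c = b then Suc k else p)) (dir(Suc k := b))"
proof -
  let ?vt = "vt(Suc k := arc_end (graph_of T) b e)"
  have eq: "?vt i = vt i" if "i \<le> k" for i using that by simp
  then have im: "?vt ` {1..k} = vt ` {1..k}" by simp
  have "inj_on ?vt {1..k} \<longleftrightarrow> inj_on vt {1..k}" using eq by (intro inj_on_cong) simp
  then have "inj_on ?vt {1..k}" using assms(1) by (simp add: numbering_def)
  moreover have "?vt (Suc k) \<notin> ?vt ` {1..k}" 
    unfolding im using assms(5) by simp
  ultimately have "inj_on ?vt (insert (Suc k) {1..k})" by (simp del: fun_upd_apply)
  then have inj: "inj_on ?vt {1..Suc k}" by (simp add: atLeastAtMostSuc_conv)
  have new: "?vt (if c = b then Suc k else p) = arc_end (graph_of T) c e" for c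
    using assms(3,4) by (cases "c = b") auto
  have old: "ge i \<in> arcs (graph_of T) \<and> en (dir i) i = i \<and> en (\<not> dir i) i \<in> {1..<i} \<and>
      (\<forall>c. ?vt (en c i) = arc_end (graph_of T) c (ge i))" if i: "i \<in> {2..k}" for i
  proof -
    from assms(1) i have *: "en (dir i) i = i" "en (\<not> dir i) i \<in> {1..<i}" "ge i \<in> arcs (graph_of T)"
      "\<forall>c. vt (en c i) = arc_end (graph_of T) c (ge i)" by (auto simp: numbering_def)
    have "en c i \<le> k" for c using * i by (cases "c = dir i") auto
    then have "?vt (en c i) = vt (en c i)" for c by (rule eq)
    then show ?thesis using * by (simp del: fun_upd_apply)
  qed
  have "1 \<le> k" "vt 1 = start_vertex T" using assms(1) by (auto simp: numbering_def)
  then show ?thesis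
    unfolding numbering_def
  proof (intro conjI ballI allI)
    fix i c assume i: "i \<in> {2..Suc k}"
    show "(ge(Suc k := e)) i \<in> arcs (graph_of T)" using i old[of i] assms(2) by (cases "i = Suc k") auto
    show "((en ((dir(Suc k := b)) i))(Suc k := if (dir(Suc k := b)) i = b then Suc k else p)) i = i"
      using i old[of i] by (cases "i = Suc k") auto
    show "((en (\<not> (dir(Suc k := b)) i))(Suc k := if (\<not> (dir(Suc k := b)) i) = b then Suc k else p)) i
        \<in> {1..<i}"
      using i old[of i] assms(3) by (cases "i = Suc k") auto
    show "?vt (((en c)(Suc k := if c = b then Suc k else p)) i) =
        arc_end (graph_of T) c ((ge(Suc k := e)) i)"
      using i old[of i] new[of c] by (cases "i = Suc k") (auto simp del: fun_upd_apply simp: fun_upd_same fun_upd_other)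
  qed (use inj in auto)
qed

locale tree_numbering =
  fixes \<Sigma> :: "'l set" and T :: "('v, 'e, 'l) labelled_digraph"
    and k :: nat and vt :: "nat \<Rightarrow> 'v" and ge :: "nat \<Rightarrow> 'e"
    and en :: "bool \<Rightarrow> nat \<Rightarrow> nat" and dir :: "nat \<Rightarrow> bool"
  assumes tree: "sigma_tree \<Sigma> T" and num: "numbering T k vt ge en dir"
begin

abbreviation "G \<equiv> graph_of T"

sublocale fin_digraph G using tree by (simp add: sigma_tree_def)

lemma arc: "i \<in> {2..k} \<Longrightarrow> ge i \<in> arcs G"
  and child: "i \<in> {2..k} \<Longrightarrow> en (dir i) i = i"
  and parent: "i \<in> {2..k} \<Longrightarrow> en (\<not> dir i) i \<in> {1..<i}"
  and ends: "i \<in> {2..k} \<Longrightarrow> vt (en b i) = arc_end G b (ge i)"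
  and inj: "inj_on vt {1..k}"
  using num by (auto simp: numbering_def)

lemma en_range: "i \<in> {2..k} \<Longrightarrow> en b i \<in> {1..i}"
  using child[of i] parent[of i] by (cases "b = dir i") auto

lemma verts: "vt ` {1..k} \<subseteq> verts G"
proof
  fix v assume "v \<in> vt ` {1..k}"
  then obtain i where i: "v = vt i" "i \<in> {1..k}" by blast
  show "v \<in> verts G"
  proof (cases "i = 1")
    case True
    then show ?thesis using i num tree by (simp add: numbering_def sigma_tree_def)
  next
    case False
    then have j: "i \<in> {2..k}" using i by auto
    then show ?thesis
      using ends[OF j, of "dir i"] child[OF j] arc[OF j] i arc_end_verts[OF wf_digraph_axioms] by auto
  qed
qed

text \<open>The vertex with the larger number is not an end of the edge that discovered the one with the smaller number.\<close>

lemma ge_inj: "inj_on ge {2..k}"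
proof (rule inj_onI)
  have False if "i \<in> {2..k}" "j \<in> {2..k}" "ge i = ge j" "i < j" for i j
  proof -
    have "vt (en (dir j) i) = vt j" using that ends child by metis
    moreover have "en (dir j) i \<in> {1..i}" using en_range that by blast
    ultimately have "en (dir j) i = j" using inj_onD[OF inj] that by auto
    then show False using \<open>en (dir j) i \<in> {1..i}\<close> \<open>i < j\<close> by auto
  qed
  then show "i = j" if "i \<in> {2..k}" "j \<in> {2..k}" "ge i = ge j" for i j
    using that by (metis linorder_neqE_nat)
qed

text \<open>The numbered edges connect all numbered vertices. Any other edge between two of them would close an undirected cycle.\<close>

lemma inner_arc_numbered:
  assumes e: "e \<in> arcs G" "\<And>b. arc_end G b e \<in> vt ` {1..k}"
  shows "e \<in> ge ` {2..k}"
proof (rule ccontr)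
  assume new: "e \<notin> ge ` {2..k}"
  \<comment> \<open>The numbered edges alone; a path in \<open>H\<close> avoids \<open>e\<close>.\<close>
  define H where "H = (both_ways G)\<lparr> arcs := ge ` {2..k} \<times> UNIV \<rparr>"
  have Hs: "verts H = verts G" "arcs H = ge ` {2..k} \<times> UNIV"
    "tail H = tail (both_ways G)" "head H = head (both_ways G)"
    by (simp_all add: H_def both_ways_simps)
  interpret H: wf_digraph H
  proof
    fix a assume "a \<in> arcs H"
    then obtain i b where "a = (ge i, b)" "i \<in> {2..k}" by (auto simp: Hs)
    then show "tail H a \<in> verts H" "head H a \<in> verts H"
      using arc_end_verts[OF wf_digraph_axioms] arc by (auto simp: Hs both_ways_simps)
  qed
  have dom: "vt (en (\<not> b) i) \<rightarrow>\<^bsub>H\<^esub> vt (en b i)" if "i \<in> {2..k}" for i b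
    using that ends by (intro H.dominatesI[of "(ge i, b)"])
      (auto simp: arc_to_ends_def Hs both_ways_simps)
  have root: "vt 1 \<rightarrow>\<^sup>*\<^bsub>H\<^esub> vt i \<and> vt i \<rightarrow>\<^sup>*\<^bsub>H\<^esub> vt 1" if "i \<in> {1..k}" for i
    using that
  proof (induction i rule: less_induct)
    case (less i)
    show ?case
    proof (cases "i = 1")
      case True
      then have "vt i \<in> verts H" using verts less(2) Hs(1) by blast
      then show ?thesis using True by simp
    next
      case False
      then have i: "i \<in> {2..k}" using less by auto
      then have "vt 1 \<rightarrow>\<^sup>*\<^bsub>H\<^esub> vt (en (\<not> dir i) i)" "vt (en (\<not> dir i) i) \<rightarrow>\<^sup>*\<^bsub>H\<^esub> vt 1"
        using less(1)[of "en (\<not> dir i) i"] parent[OF i] by auto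
      then show ?thesis using dom[OF i, of "dir i"] dom[OF i, of "\<not> dir i"] child[OF i]
        by (metis (full_types) H.adj_reachable_trans H.reachable_adj_trans)
    qed
  qed
  obtain i j where ij: "i \<in> {1..k}" "head G e = vt i" "j \<in> {1..k}" "tail G e = vt j"
    using e(2)[of True] e(2)[of False] by (auto simp: arc_end_def)
  with root H.reachable_trans have "head G e \<rightarrow>\<^sup>*\<^bsub>H\<^esub> tail G e" by metis
  then obtain p where p: "H.apath (head G e) p (tail G e)" using H.reachable_apath by blast
  have cas: "pre_digraph.cas H u q v = walk G u q v"
    and av: "pre_digraph.awalk_verts H u q = walk_verts G u q" for u q v
    by (induction q arbitrary: u)
      (simp_all add: walk_simps Hs)
  from p have p: "set p \<subseteq> ge ` {2..k} \<times> UNIV"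
    "walk G (head G e) p (tail G e)"
    "distinct (walk_verts G (head G e) p)"
    unfolding H.apath_def H.awalk_def by (auto simp: Hs cas av)
  \<comment> \<open>Go along \<open>e\<close> and back on a path of numbered edges. If \<open>e\<close> is a loop, then \<open>p\<close> is empty.\<close>
  have "undirected_cycle G ((e, True) # p)"
    unfolding undirected_cycle_def pre_digraph.cycle_def pre_digraph.awalk_def
  proof (intro conjI exI[of _ "tail G e"])
    show "set ((e, True) # p) \<subseteq> arcs (both_ways G)"
      using p(1) e(1) arc by (auto simp: both_ways_simps)
    show "distinct (map fst ((e, True) # p))"
      using path_distinct_edges[OF p(2,3)] p(1) new by auto
  qed (use p e in \<open>auto simp: walk_simps arc_end_def\<close>)
  then show False using tree by (auto simp: sigma_tree_def undirected_tree_def)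
qed

text \<open>By connectedness all vertices are numbered, and then every edge has two numbered ends.\<close>

lemma numbering_complete:
  assumes "\<And>e b. e \<in> arcs G \<Longrightarrow> arc_end G (\<not> b) e \<in> vt ` {1..k} \<Longrightarrow> arc_end G b e \<in> vt ` {1..k}"
  shows "vt ` {1..k} = verts G" "ge ` {2..k} = arcs G"
proof -
  have "{1..k} \<noteq> {}" using num by (simp add: numbering_def)
  then show V: "vt ` {1..k} = verts G"
    using assms verts tree by (intro connected_spread) (auto simp: sigma_tree_def undirected_tree_def)
  show "ge ` {2..k} = arcs G"
    using inner_arc_numbered V arc_end_verts[OF wf_digraph_axioms] arc by blast
qed

lemma numbering_size: "k \<le> Suc (card (arcs G))"
proof -
  have "ge ` {2..k} \<subseteq> arcs G" using arc by blast
  then have "card (ge ` {2..k}) \<le> card (arcs G)" by (rule card_mono[OF finite_arcs])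
  then show ?thesis using card_image[OF ge_inj] by simp
qed

end

text \<open>An injective map of graphs preserves undirected cycles; so a subgraph of a tree has none.\<close>

lemma undirected_cycle_image:
  assumes p: "undirected_cycle S p" and wf: "wf_digraph S"
    and f: "inj_on f (verts S)" "f ` verts S \<subseteq> verts G"
    and g: "inj_on g (arcs S)" "g ` arcs S \<subseteq> arcs G"
    and ends: "\<And>e b. e \<in> arcs S \<Longrightarrow> arc_end G b (g e) = f (arc_end S b e)"
  shows "undirected_cycle G (map (map_prod g id) p)"
proof -
  have cas: "walk G (f u) (map (map_prod g id) q) (f v)"
    if "walk S u q v" "set q \<subseteq> arcs S \<times> UNIV" for u q v
    using that
  proof (induction q arbitrary: u)
    case (Cons a q)
    then show ?case by (cases a) (auto simp: walk_simps ends)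
  qed (simp add: walk_simps)
  have av: "walk_verts G (f u) (map (map_prod g id) q) =
      map f (walk_verts S u q)"
    if "set q \<subseteq> arcs S \<times> UNIV" for u q
    using that
  proof (induction q arbitrary: u)
    case (Cons a q)
    then show ?case by (cases a) (auto simp: walk_simps ends)
  qed (simp add: walk_simps)
  have vs: "set (walk_verts S u q) \<subseteq> verts S"
    if "u \<in> verts S" "set q \<subseteq> arcs S \<times> UNIV" for u q
    using that
  proof (induction q arbitrary: u)
    case (Cons a q)
    then show ?case
      by (cases a) (auto simp: walk_simps arc_end_verts[OF wf])
  qed (simp add: walk_simps)
  from p obtain u where u: "u \<in> verts S" "set p \<subseteq> arcs S \<times> UNIV"
    "walk S u p u"
    "distinct (tl (walk_verts S u p))" "p \<noteq> []" "distinct (map fst p)"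
    by (auto simp: undirected_cycle_def pre_digraph.cycle_def pre_digraph.awalk_def both_ways_simps)
  have "set (tl (walk_verts S u p)) \<subseteq> verts S"
    using vs[OF u(1,2)] by (meson list.set_sel(2) subset_iff
        pre_digraph.awalk_verts_non_Nil)
  then have "distinct (map f (tl (walk_verts S u p)))"
    using u(4) f(1) by (simp add: distinct_map inj_on_subset)
  moreover have "fst ` set p \<subseteq> arcs S" using u(2) by auto
  then have "distinct (map g (map fst p))"
    using u(6) g(1) by (simp only: distinct_map[of g]) (simp add: inj_on_subset)
  then have "distinct (map fst (map (map_prod g id) p))" by (simp add: comp_def)
  ultimately show ?thesis
    unfolding undirected_cycle_def pre_digraph.cycle_def pre_digraph.awalk_def
    using u cas[OF u(3,2)] av[OF u(2), of u] f(2) g(2)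
    by (intro conjI exI[of _ "f u"]) (auto simp: both_ways_simps map_tl)
qed

section \<open>The pruning of a numbered tree\<close>

text \<open>A complete numbering of \<open>T\<close> together with the outcome of the folding process.\<close>

locale folding = tree_numbering \<Sigma> T m vt ge en dir
  for \<Sigma> :: "'l set" and T :: "('v, 'e, 'l) labelled_digraph" and m vt ge en dir +
  fixes t :: nat and alive :: "nat \<Rightarrow> bool"
  assumes all_verts: "vt ` {1..m} = verts G" and all_arcs: "ge ` {2..m} = arcs G"
    and t: "t \<in> {1..m}" "vt t = end_vertex T"
    and folded: "folded_tree m (\<lambda>i. label T (ge i)) en dir t alive"
begin

sublocale nt: folded_tree m "\<lambda>i. label T (ge i)" en dir t alive
  by (rule folded)

definition kept :: "nat list" where
  "kept = filter alive [2..<Suc m]"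

definition folded_store :: "'l stored_tree" where
  "folded_store = (1, t, map (\<lambda>i. (label T (ge i), en False i, en True i)) kept)"

abbreviation "P \<equiv> tree_of folded_store"

abbreviation "A \<equiv> {x \<in> {1..m}. alive x}"

lemma kept_set: "set kept = {i \<in> {2..m}. alive i}"
  by (auto simp: kept_def simp del: upt_Suc)

lemma kept_nth: "k < length kept \<Longrightarrow> kept ! k \<in> {2..m} \<and> alive (kept ! k)"
  using nth_mem[of k kept] unfolding kept_set by blast

lemma kept_index: "i \<in> {2..m} \<Longrightarrow> alive i \<Longrightarrow> \<exists>k < length kept. kept ! k = i"
  using kept_set by (auto simp: in_set_conv_nth[symmetric])

lemma kept_distinct: "distinct kept"
  by (simp add: kept_def)

lemma en_alive: "i \<in> {2..m} \<Longrightarrow> alive i \<Longrightarrow> en b i \<in> A"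
  using nt.alive_en en_range[of i b] by auto

lemma P_simps:
  "arcs (graph_of P) = {..<length kept}" "start_vertex P = 1" "end_vertex P = t"
  "k < length kept \<Longrightarrow> arc_end (graph_of P) b k = en b (kept ! k)"
  "k < length kept \<Longrightarrow> label P k = label T (ge (kept ! k))"
  by (auto simp: folded_store_def arc_end_def)

lemma P_verts: "verts (graph_of P) = A"
proof -
  have "verts (graph_of P) = {1, t} \<union> (\<Union>i \<in> set kept. {en False i, en True i})"
    by (auto simp: folded_store_def)
  moreover have "(\<Union>i \<in> set kept. {en False i, en True i}) \<subseteq> A"
    using en_alive unfolding kept_set by blast
  moreover have "x \<in> (\<Union>i \<in> set kept. {en False i, en True i})" if "x \<in> A" "x \<noteq> 1" for x
  proof -
    have x: "x \<in> set kept" using that by (simp add: kept_set)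
    have "en (dir x) x = x" using that by (intro child) auto
    then have "x \<in> {en False x, en True x}" by (cases "dir x") auto
    with x show ?thesis by blast
  qed
  then have "A \<subseteq> {1} \<union> (\<Union>i \<in> set kept. {en False i, en True i})" by blast
  moreover have "1 \<in> A" "t \<in> A" using t nt.root nt.alive_root nt.alive_t by auto
  ultimately show ?thesis by auto
qed

lemma wf_P: "fin_digraph (graph_of P)"
proof
  fix e assume "e \<in> arcs (graph_of P)"
  then have e: "e < length kept" by (simp add: P_simps)
  then have "arc_end (graph_of P) b e \<in> verts (graph_of P)" for b
    using kept_nth en_alive by (simp add: P_simps P_verts)
  from this[of False] this[of True]
  show "tail (graph_of P) e \<in> verts (graph_of P)" "head (graph_of P) e \<in> verts (graph_of P)"
    by (simp_all add: arc_end_def)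
qed (simp_all add: P_verts P_simps)

lemma P_acyclic: "\<not> undirected_cycle (graph_of P) p"
proof
  assume p: "undirected_cycle (graph_of P) p"
  have "undirected_cycle G (map (map_prod (\<lambda>k. ge (kept ! k)) id) p)"
  proof (rule undirected_cycle_image[OF p])
    show "wf_digraph (graph_of P)" using wf_P by (simp add: fin_digraph_def)
    show "inj_on vt (verts (graph_of P))" unfolding P_verts using inj by (rule inj_on_subset) auto
    show "vt ` verts (graph_of P) \<subseteq> verts G" using all_verts by (auto simp: P_verts)
    show "inj_on (\<lambda>k. ge (kept ! k)) (arcs (graph_of P))"
    proof (rule inj_onI)
      fix k l assume "k \<in> arcs (graph_of P)" "l \<in> arcs (graph_of P)" "ge (kept ! k) = ge (kept ! l)"
      then have "kept ! k = kept ! l" "k < length kept" "l < length kept"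
        using inj_onD[OF ge_inj] kept_nth by (auto simp: P_simps)
      then show "k = l" using kept_distinct nth_eq_iff_index_eq by blast
    qed
    show "(\<lambda>k. ge (kept ! k)) ` arcs (graph_of P) \<subseteq> arcs G"
      using kept_nth arc by (auto simp: P_simps)
    show "arc_end G b (ge (kept ! e)) = vt (arc_end (graph_of P) b e)"
      if "e \<in> arcs (graph_of P)" for e b
      using that kept_nth ends by (simp add: P_simps)
  qed
  then show False using tree by (auto simp: sigma_tree_def undirected_tree_def)
qed

text \<open>The parent of a surviving vertex survives, so every surviving vertex is still joined to the root.\<close>

lemma P_connected: "connected (graph_of P)"
proof -
  let ?S = "with_proj (mk_symmetric (graph_of P))"
  interpret P: fin_digraph "graph_of P" by (rule wf_P)
  interpret S: pair_wf_digraph "mk_symmetric (graph_of P)" by (rule P.wellformed_mk_symmetric)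
  have step: "en (\<not> b) i \<rightarrow>\<^bsub>?S\<^esub> en b i" if "i \<in> {2..m}" "alive i" for i b
  proof -
    obtain k where "k < length kept" "kept ! k = i" using kept_index \<open>i \<in> {2..m}\<close> \<open>alive i\<close> by blast
    then show ?thesis unfolding arcs_ends_mk_symmetric
      by (intro bexI[of _ k] exI[of _ b]) (auto simp: P_simps)
  qed
  have root: "1 \<rightarrow>\<^sup>*\<^bsub>?S\<^esub> x \<and> x \<rightarrow>\<^sup>*\<^bsub>?S\<^esub> 1" if "x \<in> A" for x
    using that
  proof (induction x rule: less_induct)
    case (less x)
    show ?case
    proof (cases "x = 1")
      case True
      then show ?thesis using less(2) P_verts by (auto intro: S.reachable_refl)
    next
      case False
      then have x: "x \<in> {2..m}" "alive x" using less(2) by auto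
      have "1 \<rightarrow>\<^sup>*\<^bsub>?S\<^esub> en (\<not> dir x) x \<and> en (\<not> dir x) x \<rightarrow>\<^sup>*\<^bsub>?S\<^esub> 1"
        using less(1)[of "en (\<not> dir x) x"] en_alive[OF x] parent[OF x(1)] by auto
      moreover have "en (\<not> dir x) x \<rightarrow>\<^bsub>?S\<^esub> x" "x \<rightarrow>\<^bsub>?S\<^esub> en (\<not> dir x) x"
        using step[OF x, of "dir x"] step[OF x, of "\<not> dir x"] child[OF x(1)] by auto
      ultimately show ?thesis
        using S.reachable_adj_trans[of 1 "en (\<not> dir x) x" x] S.adj_reachable_trans[of x "en (\<not> dir x) x" 1]
        by simp
    qed
  qed
  show ?thesis
    unfolding connected_def strongly_connected_def
  proof (intro conjI ballI)
    show "verts ?S \<noteq> {}"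
      using nt.root nt.alive_root P_verts by auto
    fix u v assume "u \<in> verts ?S"
      "v \<in> verts ?S"
    then have "u \<in> A" "v \<in> A" using P_verts by auto
    then show "u \<rightarrow>\<^sup>*\<^bsub>?S\<^esub> v" using root S.reachable_trans by blast
  qed
qed

definition nv :: "'v \<Rightarrow> nat" where
  "nv = the_inv_into {1..m} vt"

definition na :: "'e \<Rightarrow> nat" where
  "na = the_inv_into {2..m} ge"

lemma nv: "x \<in> {1..m} \<Longrightarrow> nv (vt x) = x" "v \<in> verts G \<Longrightarrow> nv v \<in> {1..m} \<and> vt (nv v) = v"
  using the_inv_into_f_f[OF inj] the_inv_into_into[OF inj _ order.refl] f_the_inv_into_f[OF inj] all_verts
  unfolding nv_def by auto

lemma na: "i \<in> {2..m} \<Longrightarrow> na (ge i) = i" "e \<in> arcs G \<Longrightarrow> na e \<in> {2..m} \<and> ge (na e) = e"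
  using the_inv_into_f_f[OF ge_inj] the_inv_into_into[OF ge_inj _ order.refl]
    f_the_inv_into_f[OF ge_inj] all_arcs
  unfolding na_def by auto

lemma nv_ends: "e \<in> arcs G \<Longrightarrow> nv (arc_end G b e) = en b (na e)"
proof -
  assume e: "e \<in> arcs G"
  from na(2)[OF e] have "arc_end G b e = vt (en b (na e))" using ends by metis
  moreover have "en b (na e) \<in> {1..m}" using na(2)[OF e] en_range[of "na e" b] by auto
  ultimately show ?thesis using nv(1) by simp
qed

text \<open>The surviving edge \<open>f\<close> can serve as the image of the edge \<open>i\<close> if the vertices are mapped by \<open>\<rho>\<close>.\<close>

definition maps_edge :: "(nat \<Rightarrow> nat) \<Rightarrow> nat \<Rightarrow> nat \<Rightarrow> bool" where
  "maps_edge \<rho> i f \<longleftrightarrow> f \<in> {2..m} \<and> alive f \<and> label T (ge f) = label T (ge i) \<and>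
     (\<forall>b. en b f = \<rho> (en b i))"

text \<open>Surviving edges are mapped to themselves, which makes the edge map idempotent.\<close>

lemma edge_retract:
  obtains \<rho> r where "nt.hom \<rho>" "\<And>x. x \<in> {1..m} \<Longrightarrow> \<rho> x \<in> A" "\<And>x. x \<in> A \<Longrightarrow> \<rho> x = x"
    "\<And>i. i \<in> {2..m} \<Longrightarrow> maps_edge \<rho> i (r i)" "\<And>i. alive i \<Longrightarrow> r i = i"
proof -
  obtain \<rho> where \<rho>: "nt.hom \<rho>" "\<And>x. x \<in> {1..m} \<Longrightarrow> alive (\<rho> x)"
    "\<And>x. x \<in> {1..m} \<Longrightarrow> alive x \<Longrightarrow> \<rho> x = x" using nt.alive_retract by blast
  have 1: "\<rho> x \<in> A" if "x \<in> {1..m}" for x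
    using \<rho>(2)[OF that] \<rho>(1) that unfolding nt.hom_def by blast
  have "\<exists>f. maps_edge \<rho> i f" if i: "i \<in> {2..m}" for i
  proof -
    have "nt.link i (\<rho> (nt.par i)) (\<rho> i)" using \<rho>(1) i unfolding nt.hom_def by blast
    then obtain f where f: "f \<in> {2..m}" "label T (ge f) = label T (ge i)"
      "en (\<not> dir i) f = \<rho> (en (\<not> dir i) i)" "en (dir i) f = \<rho> i"
      unfolding nt.link_def nt.par_def by blast
    have e: "en b f = \<rho> (en b i)" for b using f child[OF i] by (cases "b = dir i") auto
    have "en b i \<in> {1..m}" for b using en_range[OF i, of b] i by auto
    then have "alive (en b f)" for b using e \<rho>(2) by simp
    then show ?thesis using f e nt.alive_edge unfolding maps_edge_def by blast
  qed
  then obtain r where r: "\<And>i. i \<in> {2..m} \<Longrightarrow> maps_edge \<rho> i (r i)" by metis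
  let ?r = "\<lambda>i. if alive i then i else r i"
  have "maps_edge \<rho> i (?r i)" if i: "i \<in> {2..m}" for i
    using r[OF i] i en_alive[OF i] \<rho>(3) by (auto simp: maps_edge_def)
  with that[of \<rho> ?r] 1 \<rho> show thesis by auto
qed

text \<open>The retraction maps the directed path from the start vertex to the end vertex to such a path in the
surviving tree.\<close>

lemma P_reachable: "start_vertex P \<rightarrow>\<^sup>*\<^bsub>graph_of P\<^esub> end_vertex P"
proof -
  obtain \<rho> r where \<rho>: "nt.hom \<rho>" "\<And>x. x \<in> {1..m} \<Longrightarrow> \<rho> x \<in> A" "\<And>x. x \<in> A \<Longrightarrow> \<rho> x = x"
    and r: "\<And>i. i \<in> {2..m} \<Longrightarrow> maps_edge \<rho> i (r i)" "\<And>i. alive i \<Longrightarrow> r i = i"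
    by (rule edge_retract, rule that)
  note r = r[unfolded maps_edge_def]
  interpret P: fin_digraph "graph_of P" by (rule wf_P)
  have "start_vertex T \<rightarrow>\<^sup>*\<^bsub>G\<^esub> end_vertex T" using tree by (simp add: sigma_tree_def)
  then have "\<rho> (nv (start_vertex T)) \<rightarrow>\<^sup>*\<^bsub>graph_of P\<^esub> \<rho> (nv (end_vertex T))"
  proof (induction rule: reachable_induct)
    case base
    then show ?case using \<rho>(2) nv(2) P_verts by (auto intro: P.reachable_refl)
  next
    case (step x y)
    then obtain e where e: "e \<in> arcs G" "x = arc_end G False e" "y = arc_end G True e"
      by (auto simp: arc_end_def)
    with r(1)[of "na e"] na(2) obtain k where k: "k < length kept" "kept ! k = r (na e)"
      using kept_index by metis
    have "en b (kept ! k) = \<rho> (nv (arc_end G b e))" for b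
      using r(1)[of "na e"] na(2)[OF e(1)] nv_ends[OF e(1)] k(2) by simp
    then have "arc_end (graph_of P) b k = \<rho> (nv (arc_end G b e))" for b
      using P_simps(4)[OF k(1)] by simp
    from this[of False] this[of True] have "arc_to_ends (graph_of P) k = (\<rho> (nv x), \<rho> (nv y))"
      using e by (simp add: arc_end_def arc_to_ends_def)
    then have "\<rho> (nv x) \<rightarrow>\<^bsub>graph_of P\<^esub> \<rho> (nv y)" by (rule P.dominatesI) (simp add: P_simps k)
    with step(3) show ?case by (rule P.reachable_adj_trans)
  qed
  moreover have "start_vertex T = vt 1" using num by (simp add: numbering_def)
  then have "nv (start_vertex T) = 1" using nv(1)[OF nt.root] by simp
  moreover have "nv (end_vertex T) = t" using nv(1) t by metis
  moreover have "\<rho> 1 = 1" "\<rho> t = t" using \<rho>(1) by (auto simp: nt.hom_def)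
  ultimately show ?thesis by (simp add: P_simps)
qed

lemma sigma_tree_P: "sigma_tree \<Sigma> P"
proof -
  have "label P ` arcs (graph_of P) \<subseteq> \<Sigma>"
  proof
    fix a assume "a \<in> label P ` arcs (graph_of P)"
    then obtain k where "k < length kept" "a = label T (ge (kept ! k))" by (auto simp: P_simps)
    then show "a \<in> \<Sigma>" using kept_nth arc tree unfolding sigma_tree_def by blast
  qed
  moreover have "1 \<in> A" "t \<in> A" using t nt.root nt.alive_root nt.alive_t by auto
  ultimately show ?thesis using wf_P P_connected P_acyclic P_reachable
    unfolding sigma_tree_def undirected_tree_def by (simp add: P_simps P_verts)
qed

text \<open>The vertices are fixed by \<open>alive_rigid\<close>. The edges follow, because an edge is named by the larger of its two ends.\<close>

lemma pruned_P: "pruned P"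
  unfolding pruned_def
proof (intro allI impI)
  fix f g assume "retraction P f g"
  then have mor: "morphism P P f g" by (simp add: retraction_def)
  have ends: "g k < length kept \<and> label T (ge (kept ! g k)) = label T (ge (kept ! k)) \<and>
      (\<forall>b. en b (kept ! g k) = f (en b (kept ! k)))" if k: "k < length kept" for k
  proof -
    have g: "g k < length kept" using mor k unfolding morphism_def by (auto simp: P_simps)
    have "arc_end (graph_of P) b (g k) = f (arc_end (graph_of P) b k)" for b
      using mor k unfolding morphism_def by (auto simp: P_simps arc_end_def)
    moreover have "label P (g k) = label P k" using mor k unfolding morphism_def by (auto simp: P_simps)
    ultimately show ?thesis using g k by (simp add: P_simps)
  qed
  have id: "f x = x" if x: "x \<in> A" for x
  proof (rule nt.alive_rigid)
    show "f ` A \<subseteq> A" "f 1 = 1" "f t = t"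
      using mor unfolding morphism_def by (simp_all only: P_simps P_verts)
    fix i assume "i \<in> {2..m}" "alive i"
    then obtain k where "k < length kept" "kept ! k = i" using kept_index by blast
    with ends[of k] kept_nth[of "g k"]
    show "\<exists>f' \<in> {2..m}. label T (ge f') = label T (ge i) \<and> (\<forall>b. en b f' = f (en b i))" by blast
  qed (use x in auto)
  have "g k = k" if k: "k < length kept" for k
  proof -
    have ik: "kept ! k \<in> {2..m}" "alive (kept ! k)" and ig: "kept ! g k \<in> {2..m}"
      using kept_nth k ends[OF k] by auto
    have eq: "en b (kept ! g k) = en b (kept ! k)" for b
      using ends[OF k] id en_alive[OF ik] by auto
    have "kept ! k \<in> {1..kept ! g k}"
      using eq[of "dir (kept ! k)"] en_range[OF ig, of "dir (kept ! k)"] child[OF ik(1)] by simp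
    moreover have "kept ! g k \<in> {1..kept ! k}"
      using eq[of "dir (kept ! g k)"] en_range[OF ik(1), of "dir (kept ! g k)"] child[OF ig] by simp
    ultimately have "kept ! g k = kept ! k" by simp
    then show ?thesis using kept_distinct k ends[OF k] nth_eq_iff_index_eq by blast
  qed
  then show "(\<forall>v \<in> verts (graph_of P). f v = v) \<and> (\<forall>e \<in> arcs (graph_of P). g e = e)"
    using id by (simp add: P_verts P_simps)
qed

theorem is_pruning_P: "is_pruning \<Sigma> P T"
proof -
  obtain \<rho> r where \<rho>: "nt.hom \<rho>" "\<And>x. x \<in> {1..m} \<Longrightarrow> \<rho> x \<in> A" "\<And>x. x \<in> A \<Longrightarrow> \<rho> x = x"
    and r: "\<And>i. i \<in> {2..m} \<Longrightarrow> maps_edge \<rho> i (r i)" "\<And>i. alive i \<Longrightarrow> r i = i"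
    by (rule edge_retract, rule that)
  note r = r[unfolded maps_edge_def]
  define f where "f v = vt (\<rho> (nv v))" for v
  define g where "g e = ge (r (na e))" for e
  have start: "start_vertex T = vt 1" using num by (simp add: numbering_def)
  have fv: "f (vt x) = vt (\<rho> x)" if "x \<in> {1..m}" for x using nv(1)[OF that] by (simp add: f_def)
  have ga: "g (ge i) = ge (r i)" if "i \<in> {2..m}" for i using na(1)[OF that] by (simp add: g_def)
  have ends_g: "arc_end G b (g e) = f (arc_end G b e)" if e: "e \<in> arcs G" for e b
  proof -
    have "r (na e) \<in> {2..m}" using r(1) na(2)[OF e] by blast
    from ends[OF this, of b] have "arc_end G b (g e) = vt (en b (r (na e)))" by (simp add: g_def)
    also have "\<dots> = f (arc_end G b e)" using r(1) na(2)[OF e] nv_ends[OF e] by (simp add: f_def)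
    finally show ?thesis .
  qed
  have "morphism T T f g"
    unfolding morphism_def
  proof (intro conjI ballI)
    show "f ` verts G \<subseteq> verts G" using \<rho>(2) nv(2) all_verts unfolding f_def by blast
    show "g ` arcs G \<subseteq> arcs G" using r(1) na(2) arc unfolding g_def by blast
    show "tail G (g e) = f (tail G e)" "head G (g e) = f (head G e)" if "e \<in> arcs G" for e
      using ends_g[OF that, of False] ends_g[OF that, of True] by (simp_all add: arc_end_def)
    show "label T (g e) = label T e" if "e \<in> arcs G" for e
      using r(1) na(2)[OF that] unfolding g_def by metis
    show "f (start_vertex T) = start_vertex T" "f (end_vertex T) = end_vertex T"
      using start fv[OF nt.root] fv[OF t(1)] t(2) \<rho>(1) by (auto simp: nt.hom_def)
  qed
  moreover have "f (f v) = f v" if "v \<in> verts G" for v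
  proof -
    have "\<rho> (nv v) \<in> A" using \<rho>(2) nv(2)[OF that] by blast
    then show ?thesis using fv[of "\<rho> (nv v)"] \<rho>(3) unfolding f_def[of v] by simp
  qed
  moreover have "g (g e) = g e" if "e \<in> arcs G" for e
    using r na(2)[OF that] ga[of "r (na e)"] unfolding g_def[of e] by simp
  ultimately have "retraction T f g" by (simp add: retraction_def)
  moreover have "isomorphic P (image_of T f g)"
    unfolding isomorphic_def
  proof (intro exI conjI)
    let ?h = "\<lambda>k. ge (kept ! k)"
    have I: "verts (graph_of (image_of T f g)) = f ` verts G" "arcs (graph_of (image_of T f g)) = g ` arcs G"
      "tail (graph_of (image_of T f g)) = tail G" "head (graph_of (image_of T f g)) = head G"
      "label (image_of T f g) = label T" "start_vertex (image_of T f g) = start_vertex T"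
      "end_vertex (image_of T f g) = end_vertex T"
      by (simp_all add: image_of_def)
    have V: "vt ` A = f ` verts G"
    proof
      show "vt ` A \<subseteq> f ` verts G"
      proof
        fix v assume "v \<in> vt ` A"
        then obtain x where "x \<in> A" "v = vt x" by blast
        then have "v = f (vt x)" "vt x \<in> verts G" using fv[of x] \<rho>(3)[of x] verts by auto
        then show "v \<in> f ` verts G" by blast
      qed
      show "f ` verts G \<subseteq> vt ` A" using \<rho>(2) nv(2) unfolding f_def by blast
    qed
    have E: "?h ` {..<length kept} = g ` arcs G"
    proof
      show "?h ` {..<length kept} \<subseteq> g ` arcs G"
      proof
        fix e assume "e \<in> ?h ` {..<length kept}"
        then obtain k where k: "k < length kept" "e = ge (kept ! k)" by blast
        then have "e = g (ge (kept ! k))" "ge (kept ! k) \<in> arcs G"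
          using ga r(2) kept_nth arc by auto
        then show "e \<in> g ` arcs G" by blast
      qed
      show "g ` arcs G \<subseteq> ?h ` {..<length kept}"
      proof
        fix e' assume "e' \<in> g ` arcs G"
        then obtain e where e: "e \<in> arcs G" "e' = ge (r (na e))" by (auto simp: g_def)
        with r(1)[of "na e"] na(2) kept_index obtain k where "k < length kept" "kept ! k = r (na e)"
          by metis
        then show "e' \<in> ?h ` {..<length kept}" using e by force
      qed
    qed
    show "bij_betw vt (verts (graph_of P)) (verts (graph_of (image_of T f g)))"
      unfolding I P_verts bij_betw_def using inj by (intro conjI V) (rule inj_on_subset, auto)
    show "bij_betw ?h (arcs (graph_of P)) (arcs (graph_of (image_of T f g)))"
      unfolding I P_simps bij_betw_def
    proof (intro conjI E inj_onI)
      fix k l assume "k \<in> {..<length kept}" "l \<in> {..<length kept}" "?h k = ?h l"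
      then have "kept ! k = kept ! l" "k < length kept" "l < length kept"
        using inj_onD[OF ge_inj] kept_nth by auto
      then show "k = l" using kept_distinct nth_eq_iff_index_eq by blast
    qed
    show "morphism P (image_of T f g) vt ?h"
      unfolding morphism_def I P_verts P_simps
    proof (intro conjI ballI)
      show "vt ` A \<subseteq> f ` verts G" "?h ` {..<length kept} \<subseteq> g ` arcs G" using V E by simp_all
      show "vt 1 = start_vertex T" "vt t = end_vertex T" using start t(2) by simp_all
      fix k assume k: "k \<in> {..<length kept}"
      then show "label T (?h k) = label P k" by (simp add: P_simps)
      have "arc_end G b (?h k) = vt (arc_end (graph_of P) b k)" for b
        using k kept_nth ends by (simp add: P_simps)
      from this[of False] this[of True]
      show "tail G (?h k) = vt (tail (graph_of P) k)" "head G (?h k) = vt (head (graph_of P) k)"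
        by (simp_all add: arc_end_def)
    qed
  qed
  ultimately show ?thesis using sigma_tree_P pruned_P unfolding is_pruning_def by blast
qed

end

section \<open>A structured language for the machine\<close>

datatype var = Vn | Vw | Vk | Vi | Vj | Vq | Vb | Vp | Vr | Vg | Vt | Vd

text \<open>Variables live in the positive even registers. Register \<open>0\<close> holds the size of the input area, and the odd
registers hold intermediate results.\<close>

fun var_reg :: "var \<Rightarrow> nat" where
  "var_reg Vn = 2" | "var_reg Vw = 4" | "var_reg Vk = 6" | "var_reg Vi = 8"
| "var_reg Vj = 10" | "var_reg Vq = 12" | "var_reg Vb = 14" | "var_reg Vp = 16"
| "var_reg Vr = 18" | "var_reg Vg = 20" | "var_reg Vt = 22" | "var_reg Vd = 24"

datatype arr = Raw | Lab | End | Dir | Idx | Dead | Mark | Fit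

text \<open>\<open>Raw\<close> is the input area itself. The other arrays are unbounded; their cells are interleaved
with period \<open>8\<close> behind the input area, which has \<open>L\<close> cells.\<close>

fun arr_num :: "arr \<Rightarrow> nat" where
  "arr_num Raw = 0" | "arr_num Lab = 1" | "arr_num End = 2" | "arr_num Dir = 3"
| "arr_num Idx = 4" | "arr_num Dead = 5" | "arr_num Mark = 6" | "arr_num Fit = 7"

type_synonym store = "(var \<Rightarrow> int) \<times> (arr \<Rightarrow> int \<Rightarrow> int)"

datatype exp =
    Num int
  | Var var
  | Plus exp exp (infixl \<open>\<oplus>\<close> 65)
  | Minus exp exp (infixl \<open>\<ominus>\<close> 65)
  | Get arr exp

datatype com =
    Skip
  | Assign var exp (infix \<open>:==\<close> 62)
  | Put arr exp exp
  | Seq com com (infixr \<open>;;\<close> 60)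
  | If_zero exp com com
  | While_neg exp com

fun eval :: "exp \<Rightarrow> store \<Rightarrow> int" where
  "eval (Num z) s = z"
| "eval (Var x) s = fst s x"
| "eval (e \<oplus> e') s = eval e s + eval e' s"
| "eval (e \<ominus> e') s = eval e s - eval e' s"
| "eval (Get a e) s = snd s a (eval e s)"

definition valid :: "int \<Rightarrow> arr \<Rightarrow> int \<Rightarrow> bool" where
  "valid L a i \<longleftrightarrow> 0 \<le> i \<and> (a = Raw \<longrightarrow> i < L)"

fun safe :: "int \<Rightarrow> exp \<Rightarrow> store \<Rightarrow> bool" where
  "safe L (Num z) s \<longleftrightarrow> True"
| "safe L (Var x) s \<longleftrightarrow> True"
| "safe L (e \<oplus> e') s \<longleftrightarrow> safe L e s \<and> safe L e' s"
| "safe L (e \<ominus> e') s \<longleftrightarrow> safe L e s \<and> safe L e' s"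
| "safe L (Get a e) s \<longleftrightarrow> safe L e s \<and> valid L a (eval e s)"

text \<open>Turns the index in register \<open>2 * d + 1\<close> into a memory address. Multiplication by \<open>8\<close> is done by three
doublings, to keep the code free of multiplications.\<close>

fun address_code :: "arr \<Rightarrow> nat \<Rightarrow> instr list" where
  "address_code a d = (if a = Raw then [] else
     [Add (2*d+1) (2*d+1) (2*d+1), Add (2*d+1) (2*d+1) (2*d+1), Add (2*d+1) (2*d+1) (2*d+1),
      Add (2*d+1) (2*d+1) 0, Const (2*d+3) (int (arr_num a)), Add (2*d+1) (2*d+1) (2*d+3)])"

fun exp_code :: "exp \<Rightarrow> nat \<Rightarrow> instr list" where
  "exp_code (Num z) d = [Const (2*d+1) z]"
| "exp_code (Var x) d = [Const (2*d+1) 0, Add (2*d+1) (2*d+1) (var_reg x)]"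
| "exp_code (e \<oplus> e') d = exp_code e d @ exp_code e' (Suc d) @ [Add (2*d+1) (2*d+1) (2*d+3)]"
| "exp_code (e \<ominus> e') d = exp_code e d @ exp_code e' (Suc d) @ [Sub (2*d+1) (2*d+1) (2*d+3)]"
| "exp_code (Get a e) d = exp_code e d @ address_code a d @ [Load (2*d+1) (2*d+1)]"

definition exp_cost :: "exp \<Rightarrow> nat" where
  "exp_cost e = length (exp_code e 0)"

fun com_size :: "com \<Rightarrow> nat" where
  "com_size Skip = 0"
| "com_size (x :== e) = exp_cost e + 2"
| "com_size (Put a e e') = exp_cost e + length (address_code a 0) + exp_cost e' + 1"
| "com_size (c ;; c') = com_size c + com_size c'"
| "com_size (If_zero e c c') = exp_cost e + 1 + com_size c' + 1 + com_size c"
| "com_size (While_neg e c) = exp_cost e + 2 + com_size c + 1"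

fun com_code :: "com \<Rightarrow> nat \<Rightarrow> instr list" where
  "com_code Skip p = []"
| "com_code (x :== e) p = exp_code e 0 @ [Const 3 0, Add (var_reg x) 1 3]"
| "com_code (Put a e e') p = exp_code e 0 @ address_code a 0 @ exp_code e' 1 @ [Store 1 3]"
| "com_code (c ;; c') p = com_code c p @ com_code c' (p + com_size c)"
| "com_code (If_zero e c c') p =
     (let q = p + exp_cost e + 1; r = q + com_size c' + 1; s = r + com_size c
      in exp_code e 0 @ JumpZero 1 r # com_code c' q @ Jump s # com_code c r)"
| "com_code (While_neg e c) p =
     (let q = p + exp_cost e + 2; r = q + com_size c + 1
      in exp_code e 0 @ JumpNeg 1 q # Jump r # com_code c q @ [Jump p])"

inductive run :: "int \<Rightarrow> com \<Rightarrow> store \<Rightarrow> nat \<Rightarrow> store \<Rightarrow> bool" for L where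
  run_Skip: "run L Skip s 0 s"
| run_Assign: "safe L e s \<Longrightarrow> run L (x :== e) s (exp_cost e + 2) ((fst s)(x := eval e s), snd s)"
| run_Put: "safe L e s \<Longrightarrow> valid L a (eval e s) \<Longrightarrow> safe L e' s \<Longrightarrow>
    run L (Put a e e') s (exp_cost e + length (address_code a 0) + exp_cost e' + 1)
      (fst s, (snd s)(a := (snd s a)(eval e s := eval e' s)))"
| run_Seq: "run L c s n s' \<Longrightarrow> run L c' s' n' s'' \<Longrightarrow> run L (c ;; c') s (n + n') s''"
| run_zero: "safe L e s \<Longrightarrow> eval e s = 0 \<Longrightarrow> run L c s n s' \<Longrightarrow>
    run L (If_zero e c c') s (exp_cost e + 1 + n) s'"
| run_nonzero: "safe L e s \<Longrightarrow> eval e s \<noteq> 0 \<Longrightarrow> run L c' s n s' \<Longrightarrow>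
    run L (If_zero e c c') s (exp_cost e + 1 + n + 1) s'"
| run_stop: "safe L e s \<Longrightarrow> 0 \<le> eval e s \<Longrightarrow> run L (While_neg e c) s (exp_cost e + 2) s"
| run_loop: "safe L e s \<Longrightarrow> eval e s < 0 \<Longrightarrow> run L c s n s' \<Longrightarrow>
    run L (While_neg e c) s' n' s'' \<Longrightarrow> run L (While_neg e c) s (exp_cost e + 1 + n + 1 + n') s''"

section \<open>Correctness of the compilation\<close>

fun code_at :: "instr list \<Rightarrow> nat \<Rightarrow> instr list \<Rightarrow> bool" where
  "code_at P i [] \<longleftrightarrow> True"
| "code_at P i (x # c) \<longleftrightarrow> i < length P \<and> P ! i = x \<and> code_at P (Suc i) c"

lemma code_at_append: "code_at P i (c @ c') \<longleftrightarrow> code_at P i c \<and> code_at P (i + length c) c'"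
  by (induction c arbitrary: i) auto

lemma code_at_infix: "code_at (xs @ c @ ys) (length xs) c"
proof (induction c arbitrary: xs)
  case (Cons x c)
  from Cons[of "xs @ [x]"] show ?case by (simp add: nth_append)
qed simp

text \<open>Under unit cost the accumulated cost is the number of steps.\<close>

lemma exec_Suc: "step P s = Some s' \<Longrightarrow> exec unit_cost P s' n s'' \<Longrightarrow> exec unit_cost P s (Suc n) s''"
  using exec_step[of P s s' unit_cost n s''] by (simp add: unit_cost_def)

lemma exec_trans: "exec cost P s n s' \<Longrightarrow> exec cost P s' n' s'' \<Longrightarrow> exec cost P s (n + n') s''"
  by (induction rule: exec.induct) (auto simp: add.assoc intro: exec_step)

lemma exec_one: "step P s = Some s' \<Longrightarrow> exec unit_cost P s 1 s'"
  using exec_Suc exec_refl by fastforce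

definition address :: "int \<Rightarrow> arr \<Rightarrow> int \<Rightarrow> int" where
  "address L a i = (if a = Raw then i else L + 8 * i + int (arr_num a))"

lemma address_inj:
  assumes "address L a i = address L b j" "valid L a i" "valid L b j"
  shows "a = b \<and> i = j"
proof -
  have num: "arr_num c \<noteq> 0" "arr_num c < 8" if "c \<noteq> Raw" for c using that by (cases c; simp)+
  have eq: "8 * i + int n = 8 * j + int m \<Longrightarrow> n < 8 \<Longrightarrow> m < 8 \<Longrightarrow> n = m \<and> i = j" for n m
    by presburger
  have "arr_num a = arr_num b \<and> i = j"
    using assms num[of a] num[of b] eq[of "arr_num a" "arr_num b"]
    by (auto simp: address_def valid_def split: if_splits)
  then show ?thesis by (cases a; cases b) auto
qed

lemma address_nonneg: "0 \<le> L \<Longrightarrow> valid L a i \<Longrightarrow> 0 \<le> address L a i"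
  by (simp add: address_def valid_def)

text \<open>The machine state stores the variables and arrays of the language; odd registers and the program counter are arbitrary.\<close>

definition represents :: "int \<Rightarrow> ram_state \<Rightarrow> store \<Rightarrow> bool" where
  "represents L s st \<longleftrightarrow> reg s 0 = L \<and> (\<forall>x. reg s (var_reg x) = fst st x) \<and>
     (\<forall>a i. valid L a i \<longrightarrow> mem s (nat (address L a i)) = snd st a i)"

lemma var_reg_even: "even (var_reg x)" "var_reg x \<noteq> 0"
  by (cases x; simp)+

lemma var_reg_inj: "var_reg x = var_reg y \<longleftrightarrow> x = y"
  by (cases x; cases y) simp_all

text \<open>The lower odd registers are kept, as they may hold the results of other subexpressions, and so are the
  even ones, which hold the variables.\<close>

definition evaluated :: "nat \<Rightarrow> nat \<Rightarrow> int \<Rightarrow> ram_state \<Rightarrow> ram_state \<Rightarrow> bool" where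
  "evaluated d n z s s' \<longleftrightarrow> pc s' = pc s + n \<and> mem s' = mem s \<and> reg s' (2*d+1) = z \<and>
     (\<forall>r. even r \<or> r < 2*d+1 \<longrightarrow> reg s' r = reg s r)"

lemma evaluatedD:
  assumes "evaluated d n z s s'"
  shows "represents L s st \<Longrightarrow> represents L s' st" "pc s' = pc s + n" "reg s' (2*d+1) = z"
  using assms var_reg_even by (simp_all add: represents_def evaluated_def)

lemma exec_refl': "s = s' \<Longrightarrow> exec cost P s 0 s'"
  by (simp add: exec_refl)

lemma address_code_correct:
  assumes "code_at P (pc s) (address_code a d)" "reg s 0 = L" "reg s (2*d+1) = i"
  shows "\<exists>s'. exec unit_cost P s (length (address_code a d)) s' \<and>
    evaluated d (length (address_code a d)) (address L a i) s s'"
proof (cases "a = Raw")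
  case True
  then show ?thesis using assms by (auto simp: address_def evaluated_def intro: exec_refl)
next
  case False
  have six: "length (address_code a d) = Suc (Suc (Suc (Suc (Suc (Suc 0)))))" using False by simp
  define s' where "s' = \<lparr> pc = pc s + 6,
    reg = (reg s)(2*d+1 := address L a i, 2*d+3 := int (arr_num a)), mem = mem s \<rparr>"
  have "exec unit_cost P s (length (address_code a d)) s'"
    unfolding six using assms False
    by (intro exec_Suc exec_refl') (auto simp: step_def set_reg_def s'_def address_def fun_eq_iff)
  moreover have "evaluated d (length (address_code a d)) (address L a i) s s'"
    unfolding six by (auto simp: evaluated_def s'_def)
  ultimately show ?thesis by blast
qed

lemma exp_code_length: "length (exp_code e d) = exp_cost e"
proof -
  have "length (exp_code e d) = length (exp_code e d')" for d d'
  proof (induction e arbitrary: d d')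
    case (Plus e e')
    show ?case using Plus(1)[of d d'] Plus(2)[of "Suc d" "Suc d'"] by simp
  next
    case (Minus e e')
    show ?case using Minus(1)[of d d'] Minus(2)[of "Suc d" "Suc d'"] by simp
  qed auto
  then show ?thesis unfolding exp_cost_def by blast
qed

lemma com_code_length: "length (com_code c p) = com_size c"
  by (induction c arbitrary: p) (simp_all add: Let_def exp_code_length)

lemma binary_code_correct:
  assumes e: "\<And>d s. code_at P (pc s) (exp_code e d) \<Longrightarrow> represents L s st \<Longrightarrow>
      \<exists>s'. exec unit_cost P s (exp_cost e) s' \<and> evaluated d (exp_cost e) z s s'"
    and e': "\<And>d s. code_at P (pc s) (exp_code e' d) \<Longrightarrow> represents L s st \<Longrightarrow>
      \<exists>s'. exec unit_cost P s (exp_cost e') s' \<and> evaluated d (exp_cost e') z' s s'"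
    and s: "code_at P (pc s) (exp_code e d @ exp_code e' (Suc d) @ [i])" "represents L s st"
    and op: "\<And>u. step_instr i u = Some (set_reg (2*d+1) (f (reg u (2*d+1)) (reg u (2*d+3))) u)"
  shows "\<exists>s'. exec unit_cost P s (exp_cost e + exp_cost e' + 1) s' \<and>
      evaluated d (exp_cost e + exp_cost e' + 1) (f z z') s s'"
proof -
  obtain s1 where s1: "exec unit_cost P s (exp_cost e) s1" "evaluated d (exp_cost e) z s s1"
    using e[of s d] s by (auto simp: code_at_append)
  then have "represents L s1 st" "pc s1 = pc s + exp_cost e" using evaluatedD[OF s1(2)] s by auto
  with s e'[of s1 "Suc d"] obtain s2 where s2: "exec unit_cost P s1 (exp_cost e') s2"
    "evaluated (Suc d) (exp_cost e') z' s1 s2" by (auto simp: code_at_append exp_code_length)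
  let ?s = "set_reg (2*d+1) (f (reg s2 (2*d+1)) (reg s2 (2*d+3))) s2"
  have "step P s2 = Some ?s"
    using s s1 s2 op by (auto simp: code_at_append exp_code_length step_def evaluated_def add.assoc)
  then have "exec unit_cost P s (exp_cost e + exp_cost e' + 1) ?s"
    by (intro exec_trans[OF exec_trans[OF s1(1) s2(1)]] exec_one)
  moreover have "reg s2 (2*d+1) = z" "reg s2 (2*d+3) = z'"
    using s1(2) s2(2) by (auto simp: evaluated_def numeral_3_eq_3)
  then have "evaluated d (exp_cost e + exp_cost e' + 1) (f z z') s ?s"
    using s1(2) s2(2) by (auto simp: evaluated_def set_reg_def)
  ultimately show ?thesis by blast
qed

lemma exp_code_correct:
  assumes "code_at P (pc s) (exp_code e d)" "represents L s st" "safe L e st" "0 \<le> L"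
  shows "\<exists>s'. exec unit_cost P s (exp_cost e) s' \<and> evaluated d (exp_cost e) (eval e st) s s'"
  using assms
proof (induction e arbitrary: d s)
  case (Num z)
  let ?s = "set_reg (2*d+1) z s"
  have "exec unit_cost P s 1 ?s" using Num by (intro exec_one) (auto simp: step_def)
  then show ?case by (intro exI[of _ ?s]) (auto simp: exp_cost_def evaluated_def set_reg_def)
next
  case (Var x)
  let ?s = "set_reg (2*d+1) (fst st x) (set_reg (2*d+1) 0 s)"
  have "2*d+1 \<noteq> var_reg x" using var_reg_even(1)[of x] by (metis even_plus_one_iff dvd_triv_left)
  then have "exec unit_cost P s (Suc (Suc 0)) ?s" using Var
    by (intro exec_Suc exec_refl') (auto simp: step_def set_reg_def represents_def fun_eq_iff)
  then show ?case
    by (intro exI[of _ ?s]) (auto simp: exp_cost_def evaluated_def set_reg_def)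
next
  case (Plus e e')
  have "exp_cost (e \<oplus> e') = exp_cost e + exp_cost e' + 1"
    by (simp add: exp_cost_def[of "e \<oplus> e'"] exp_code_length)
  then show ?case
    using binary_code_correct[of P e L st "eval e st" e' "eval e' st" s d _ "(+)"] Plus by simp
next
  case (Minus e e')
  have "exp_cost (e \<ominus> e') = exp_cost e + exp_cost e' + 1"
    by (simp add: exp_cost_def[of "e \<ominus> e'"] exp_code_length)
  then show ?case
    using binary_code_correct[of P e L st "eval e st" e' "eval e' st" s d _ "(-)"] Minus by simp
next
  case (Get a e)
  let ?n = "length (address_code a d)" and ?i = "eval e st"
  note [simp del] = address_code.simps
  from Get.prems Get.IH[of s d] obtain s1 where s1: "exec unit_cost P s (exp_cost e) s1"
    "evaluated d (exp_cost e) ?i s s1" by (auto simp: code_at_append)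
  then have r1: "represents L s1 st" "pc s1 = pc s + exp_cost e" "reg s1 (2*d+1) = ?i"
    using evaluatedD[OF s1(2)] Get by auto
  with Get.prems obtain s2 where s2: "exec unit_cost P s1 ?n s2"
    "evaluated d ?n (address L a ?i) s1 s2"
    using address_code_correct[of P s1 a d L ?i]
    by (auto simp: code_at_append exp_code_length represents_def)
  let ?s = "set_reg (2*d+1) (snd st a ?i) s2"
  have "mem s2 (nat (address L a ?i)) = snd st a ?i"
    using Get.prems s1 s2 by (auto simp: represents_def evaluated_def)
  then have "step P s2 = Some ?s"
    using Get.prems r1 s2 address_nonneg[of L a ?i]
    by (auto simp: step_def code_at_append exp_code_length evaluated_def add.assoc)
  then have "exec unit_cost P s (exp_cost e + ?n + 1) ?s"
    by (intro exec_trans[OF exec_trans[OF s1(1) s2(1)]] exec_one)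
  moreover have "length (address_code a 0) = ?n" by (simp add: address_code.simps)
  then have "exp_cost (Get a e) = exp_cost e + ?n + 1"
    by (simp add: exp_cost_def[of "Get a e"] exp_code_length)
  ultimately show ?case using s1 s2
    by (intro exI[of _ ?s]) (auto simp: evaluated_def set_reg_def)
qed

lemma exp_code_first:
  assumes "code_at P (pc s) (exp_code e 0)" "represents L s st" "safe L e st" "0 \<le> L"
  shows "\<exists>s1. exec unit_cost P s (exp_cost e) s1 \<and> represents L s1 st \<and> pc s1 = pc s + exp_cost e \<and>
    reg s1 1 = eval e st"
proof -
  obtain s1 where s1: "exec unit_cost P s (exp_cost e) s1" "evaluated 0 (exp_cost e) (eval e st) s s1"
    using exp_code_correct[OF assms] by blast
  then show ?thesis
    using evaluatedD(1)[OF s1(2) assms(2)] evaluatedD(2,3)[OF s1(2)] by (intro exI[of _ s1]) simp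
qed

lemma com_code_correct:
  assumes "run L c st n st'" "code_at P (pc s) (com_code c (pc s))" "represents L s st" "0 \<le> L"
  shows "\<exists>s'. exec unit_cost P s n s' \<and> pc s' = pc s + com_size c \<and> represents L s' st'"
  using assms
proof (induction arbitrary: s rule: run.induct)
  case (run_Skip st)
  then show ?case by (auto intro: exec_refl)
next
  case (run_Assign e st x)
  then obtain s1 where s1: "exec unit_cost P s (exp_cost e) s1"
    and r1: "represents L s1 st" "pc s1 = pc s + exp_cost e" "reg s1 1 = eval e st"
    using exp_code_first[of P s e L st] by (auto simp: code_at_append Let_def)
  let ?s = "set_reg (var_reg x) (eval e st) (set_reg 3 0 s1)"
  have ne: "var_reg y \<noteq> 3" "var_reg y \<noteq> 0" for y
    by (cases y; simp)+
  have "exec unit_cost P s1 (Suc (Suc 0)) ?s" using run_Assign.prems r1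
    by (intro exec_Suc exec_refl')
      (auto simp: code_at_append exp_code_length step_def set_reg_def)
  then have "exec unit_cost P s (exp_cost e + 2) ?s" using exec_trans[OF s1(1)] by fastforce
  moreover have "represents L ?s ((fst st)(x := eval e st), snd st)"
    using r1 by (auto simp: represents_def set_reg_def var_reg_inj ne)
  ultimately show ?case using r1 by (intro exI[of _ ?s]) (auto simp: set_reg_def exp_code_length)
next
  case (run_Put e st a e')
  note [simp del] = address_code.simps
  let ?n = "length (address_code a 0)" and ?i = "eval e st" and ?z = "eval e' st"
  from run_Put obtain s1 where s1: "exec unit_cost P s (exp_cost e) s1"
    and r1: "represents L s1 st" "pc s1 = pc s + exp_cost e" "reg s1 1 = ?i"
    using exp_code_first[of P s e L st] by (auto simp: code_at_append)
  with run_Put.prems obtain s2 where s2: "exec unit_cost P s1 ?n s2"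
    "evaluated 0 ?n (address L a ?i) s1 s2"
    using address_code_correct[of P s1 a 0 L ?i]
    by (auto simp: code_at_append exp_code_length represents_def)
  then have r2: "represents L s2 st" "pc s2 = pc s + exp_cost e + ?n" "reg s2 1 = address L a ?i"
    using evaluatedD[OF s2(2)] r1 by auto
  with run_Put obtain s3 where s3: "exec unit_cost P s2 (exp_cost e') s3"
    "evaluated 1 (exp_cost e') ?z s2 s3"
    using exp_code_correct[of P s2 e' 1 L st] by (auto simp: code_at_append exp_code_length add.assoc)
  have r3: "represents L s3 st" "pc s3 = pc s + exp_cost e + ?n + exp_cost e'" "reg s3 3 = ?z"
    using evaluatedD[OF s3(2)] r2 by auto
  have "reg s3 1 = address L a ?i" using s3(2) r2(3) by (simp add: evaluated_def)
  note r3 = r3 this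
  let ?s = "s3\<lparr> pc := Suc (pc s3), mem := (mem s3)(nat (address L a ?i) := ?z) \<rparr>"
  have nn: "0 \<le> address L a ?i" using address_nonneg run_Put by blast
  have "step P s3 = Some ?s" using run_Put.prems r3 nn
    by (auto simp: step_def code_at_append exp_code_length add.assoc)
  then have "exec unit_cost P s (exp_cost e + ?n + exp_cost e' + 1) ?s"
    by (intro exec_trans[OF exec_trans[OF exec_trans[OF s1(1) s2(1)] s3(1)]] exec_one)
  moreover have "nat (address L b j) = nat (address L a ?i) \<longleftrightarrow> b = a \<and> j = ?i" if "valid L b j" for b j
    using address_inj[of L b j a ?i] address_nonneg[of L b j] that run_Put(2) nn run_Put.prems by auto
  then have "represents L ?s (fst st, (snd st)(a := (snd st a)(?i := ?z)))"
    using r3 by (auto simp: represents_def)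
  ultimately show ?case using r3 by (intro exI[of _ ?s]) (auto simp: exp_code_length)
next
  case (run_Seq c st n st1 c' n' st2)
  then obtain s1 where s1: "exec unit_cost P s n s1" "pc s1 = pc s + com_size c"
    "represents L s1 st1" by (auto simp: code_at_append)
  with run_Seq.prems run_Seq.IH(2)[of s1] obtain s2 where "exec unit_cost P s1 n' s2"
    "pc s2 = pc s1 + com_size c'" "represents L s2 st2"
    by (auto simp: code_at_append com_code_length)
  then show ?case using exec_trans[OF s1(1)] s1(2) by (auto simp: com_code_length intro!: exI[of _ s2])
next
  case (run_zero e st c n st' c')
  then obtain s1 where s1: "exec unit_cost P s (exp_cost e) s1"
    and r1: "represents L s1 st" "pc s1 = pc s + exp_cost e" "reg s1 1 = 0"
    using exp_code_first[of P s e L st] by (auto simp: code_at_append Let_def)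
  let ?q = "pc s + exp_cost e + 1 + com_size c' + 1"
  let ?s = "s1\<lparr> pc := ?q \<rparr>"
  have "step P s1 = Some ?s" using run_zero.prems r1
    by (auto simp: step_def code_at_append exp_code_length Let_def)
  then have e1: "exec unit_cost P s (exp_cost e + 1) ?s"
    by (intro exec_trans[OF s1(1)] exec_one)
  have "represents L ?s st" using r1 by (simp add: represents_def)
  with run_zero.prems run_zero.IH[of ?s] obtain s2 where "exec unit_cost P ?s n s2"
    "pc s2 = ?q + com_size c" "represents L s2 st'"
    by (auto simp: code_at_append exp_code_length com_code_length Let_def)
  then show ?case using exec_trans[OF e1]
    by (auto simp: Let_def com_code_length exp_code_length intro!: exI[of _ s2])
next
  case (run_nonzero e st c' n st' c)
  then obtain s1 where s1: "exec unit_cost P s (exp_cost e) s1"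
    and r1: "represents L s1 st" "pc s1 = pc s + exp_cost e" "reg s1 1 = eval e st"
    using exp_code_first[of P s e L st] by (auto simp: code_at_append Let_def)
  let ?q = "pc s + exp_cost e + 1"
  let ?s = "s1\<lparr> pc := ?q \<rparr>"
  have "step P s1 = Some ?s" using run_nonzero.prems run_nonzero.hyps(2) r1
    by (auto simp: step_def code_at_append exp_code_length Let_def)
  then have e1: "exec unit_cost P s (exp_cost e + 1) ?s"
    by (intro exec_trans[OF s1(1)] exec_one)
  have "represents L ?s st" using r1 by (simp add: represents_def)
  with run_nonzero.prems run_nonzero.IH[of ?s] obtain s2 where s2: "exec unit_cost P ?s n s2"
    "pc s2 = ?q + com_size c'" "represents L s2 st'"
    by (auto simp: code_at_append exp_code_length com_code_length Let_def)
  let ?t = "s2\<lparr> pc := ?q + com_size c' + 1 + com_size c \<rparr>"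
  have "step P s2 = Some ?t" using run_nonzero.prems s2
    by (auto simp: step_def code_at_append exp_code_length com_code_length Let_def)
  then have "exec unit_cost P s (exp_cost e + 1 + n + 1) ?t"
    by (intro exec_trans[OF exec_trans[OF e1 s2(1)]] exec_one)
  moreover have "represents L ?t st'" using s2 by (simp add: represents_def)
  ultimately show ?case
    by (intro exI[of _ ?t]) (auto simp: Let_def com_code_length exp_code_length)
next
  case (run_stop e st c)
  then obtain s1 where s1: "exec unit_cost P s (exp_cost e) s1"
    and r1: "represents L s1 st" "pc s1 = pc s + exp_cost e" "reg s1 1 = eval e st"
    using exp_code_first[of P s e L st] by (auto simp: code_at_append Let_def)
  let ?s = "s1\<lparr> pc := pc s + exp_cost e + 2 + com_size c + 1 \<rparr>"
  have "exec unit_cost P s1 (Suc (Suc 0)) ?s" using run_stop.prems run_stop.hyps(2) r1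
    by (intro exec_Suc exec_refl') (auto simp: step_def code_at_append exp_code_length Let_def)
  then have "exec unit_cost P s (exp_cost e + 2) ?s"
    using exec_trans[OF s1(1)] by fastforce
  moreover have "represents L ?s st" using r1 by (simp add: represents_def)
  ultimately show ?case
    by (intro exI[of _ ?s]) (auto simp: Let_def com_code_length exp_code_length)
next
  case (run_loop e st c n st1 n' st2)
  then obtain s1 where s1: "exec unit_cost P s (exp_cost e) s1"
    and r1: "represents L s1 st" "pc s1 = pc s + exp_cost e" "reg s1 1 = eval e st"
    using exp_code_first[of P s e L st] by (auto simp: code_at_append Let_def)
  let ?q = "pc s + exp_cost e + 2"
  let ?s = "s1\<lparr> pc := ?q \<rparr>"
  have "step P s1 = Some ?s" using run_loop.prems run_loop.hyps(2) r1
    by (auto simp: step_def code_at_append exp_code_length Let_def)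
  then have e1: "exec unit_cost P s (exp_cost e + 1) ?s"
    by (intro exec_trans[OF s1(1)] exec_one)
  have "represents L ?s st" using r1 by (simp add: represents_def)
  with run_loop.prems run_loop.IH(1)[of ?s] obtain s2 where s2: "exec unit_cost P ?s n s2"
    "pc s2 = ?q + com_size c" "represents L s2 st1"
    by (auto simp: code_at_append exp_code_length com_code_length Let_def)
  let ?t = "s2\<lparr> pc := pc s \<rparr>"
  have "step P s2 = Some ?t" using run_loop.prems s2
    by (auto simp: step_def code_at_append exp_code_length com_code_length Let_def)
  then have e2: "exec unit_cost P s (exp_cost e + 1 + n + 1) ?t"
    by (intro exec_trans[OF exec_trans[OF e1 s2(1)]] exec_one)
  have "represents L ?t st1" using s2 by (simp add: represents_def)
  with run_loop.prems run_loop.IH(2)[of ?t] obtain s3 where "exec unit_cost P ?t n' s3"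
    "pc s3 = pc s + com_size (While_neg e c)" "represents L s3 st2" by auto
  then show ?case using exec_trans[OF e2] by blast
qed


section \<open>Logarithmic cost\<close>

definition small :: "nat \<Rightarrow> ram_state \<Rightarrow> bool" where
  "small b s \<longleftrightarrow> (\<forall>r. \<bar>reg s r\<bar> \<le> 2 ^ b) \<and> (\<forall>a. \<bar>mem s a\<bar> \<le> 2 ^ b)"

text \<open>The instructions that increase the largest absolute value at most by a factor of two, provided that it is at least
\<open>2 ^ b\<close> to begin with.\<close>

fun no_mult :: "nat \<Rightarrow> instr \<Rightarrow> bool" where
  "no_mult b (Const d k) \<longleftrightarrow> \<bar>k\<bar> \<le> 2 ^ b"
| "no_mult b (Mul d r r') \<longleftrightarrow> False"
| "no_mult b (Div d r r') \<longleftrightarrow> False"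
| "no_mult b _ \<longleftrightarrow> True"

lemma two_power_mono: "b \<le> b' \<Longrightarrow> (2::int) ^ b \<le> 2 ^ b'"
  by (rule power_increasing) auto

lemma no_mult_mono: "no_mult b i \<Longrightarrow> b \<le> b' \<Longrightarrow> no_mult b' i"
  using two_power_mono[of b b'] by (cases i) (auto intro: order_trans)

lemma no_mult_common:
  assumes "\<And>i. i \<in> set P \<Longrightarrow> \<exists>b. no_mult b i"
  shows "\<exists>b. \<forall>i \<in> set P. no_mult b i"
  using assms
proof (induction P)
  case (Cons i P)
  then obtain b' where b': "\<forall>i \<in> set P. no_mult b' i" by auto
  moreover obtain b where "no_mult b i" using Cons.prems[of i] by auto
  ultimately have "no_mult b i" "\<forall>i \<in> set P. no_mult b' i" by blast+
  then have "no_mult (max b b') i" "\<forall>i \<in> set P. no_mult (max b b') i"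
    using no_mult_mono[of b i "max b b'"] no_mult_mono[of b' _ "max b b'"] by auto
  then show ?case by auto
qed simp

lemma bit_size_le: "\<bar>z\<bar> \<le> 2 ^ b \<Longrightarrow> bit_size z \<le> b + 2"
proof -
  assume "\<bar>z\<bar> \<le> 2 ^ b"
  then have "\<bar>z\<bar> < 2 ^ nat (int (Suc b))"
    by (metis less_le_trans le_less_trans nat_int one_less_numeral_iff power_strict_increasing_iff
        semiring_norm(76) lessI)
  then have "bitlen \<bar>z\<bar> \<le> int (Suc b)" using bitlen_le_iff_power[of "\<bar>z\<bar>" "int (Suc b)"] by simp
  then show "bit_size z \<le> b + 2" by (simp add: bit_size_def)
qed

lemma step_small:
  assumes "step P s = Some s'" "\<forall>i \<in> set P. no_mult b i" "small b s"
  shows "small (Suc b) s'" "log_cost (P ! pc s) s \<le> 2 * (b + 2)"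
proof -
  have i: "step_instr (P ! pc s) s = Some s'" "no_mult b (P ! pc s)"
    using assms by (auto simp: step_def split: if_splits)
  have add: "\<bar>x + y\<bar> \<le> 2 * 2 ^ b" "\<bar>x - y\<bar> \<le> 2 * 2 ^ b"
    if "\<bar>x\<bar> \<le> 2 ^ b" "\<bar>y\<bar> \<le> 2 ^ b" for x y :: int using that by linarith+
  have le: "\<bar>x\<bar> \<le> 2 * 2 ^ b" if "\<bar>x\<bar> \<le> 2 ^ b" for x :: int using that by linarith
  show "small (Suc b) s'" using i assms(3) add le
    by (cases "P ! pc s") (auto simp: small_def set_reg_def split: if_splits)
  have bits: "bit_size (reg s r) \<le> b + 2" "bit_size (mem s a) \<le> b + 2" for r a
    using assms(3) bit_size_le by (auto simp: small_def)
  have bits2: "bit_size (reg s r) + bit_size (reg s r') \<le> 2 * (b + 2)"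
    "bit_size (reg s r) + bit_size (mem s a) \<le> 2 * (b + 2)"
    "bit_size (reg s r) \<le> 2 * (b + 2)" for r r' a
    using bits(1)[of r] bits(1)[of r'] bits(2)[of a] by simp_all
  have const: "bit_size k \<le> 2 * (b + 2)" if "\<bar>k\<bar> \<le> 2 ^ b" for k
    using bit_size_le[OF that] by simp
  show "log_cost (P ! pc s) s \<le> 2 * (b + 2)" using i bits2 const
    by (cases "P ! pc s") auto
qed

text \<open>Each step makes the numbers at most one bit longer, so after \<open>k\<close> steps they have at most about \<open>b + k\<close> bits, and
every single instruction has been charged at most twice this length.\<close>

lemma exec_log_cost:
  assumes "exec unit_cost P s k s'" "\<forall>i \<in> set P. no_mult b i" "small b s"
  shows "\<exists>m \<le> k * (2 * (b + k + 2)). exec log_cost P s m s'"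
  using assms
proof (induction arbitrary: b rule: exec.induct)
  case (exec_refl s)
  then show ?case by (auto intro: exec.exec_refl)
next
  case (exec_step s s1 n s2)
  note st = step_small[OF exec_step(1,4,5)]
  have "\<forall>i \<in> set P. no_mult (Suc b) i" using exec_step(4) no_mult_mono by (meson Suc_leI lessI less_imp_le)
  with exec_step.IH[of "Suc b"] st(1) obtain m where
    m: "m \<le> n * (2 * (Suc b + n + 2))" "exec log_cost P s1 m s2" by blast
  have "exec log_cost P s (log_cost (P ! pc s) s + m) s2"
    by (rule exec.exec_step[OF exec_step(1) m(2)])
  moreover have "log_cost (P ! pc s) s + m \<le> Suc n * (2 * (b + Suc n + 2))"
    using st(2) m(1) by (simp add: algebra_simps)
  ultimately show ?case unfolding unit_cost_def by (metis plus_1_eq_Suc)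
qed

lemma address_code_no_mult: "i \<in> set (address_code a d) \<Longrightarrow> \<exists>b. no_mult b i"
proof -
  have "\<bar>int (arr_num a)\<bar> \<le> 2 ^ 3" by (cases a) auto
  then have "no_mult 3 (Const k (int (arr_num a)))" for k by simp
  then show "i \<in> set (address_code a d) \<Longrightarrow> \<exists>b. no_mult b i" by (auto split: if_splits simp del: no_mult.simps(1))
qed

lemma const_no_mult: "\<exists>b. \<bar>z\<bar> \<le> (2::int) ^ b"
proof -
  have "nat \<bar>z\<bar> < 2 ^ nat \<bar>z\<bar>" by (rule less_exp)
  then have "\<bar>z\<bar> < 2 ^ nat \<bar>z\<bar>" by (metis nat_less_numeral_power_cancel_iff zless_nat_eq_int_zless of_nat_power of_nat_numeral)
  then show ?thesis by (meson less_imp_le)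
qed

lemma exp_code_no_mult: "i \<in> set (exp_code e d) \<Longrightarrow> \<exists>b. no_mult b i"
proof (induction e arbitrary: d)
  case (Get a e)
  then show ?case using address_code_no_mult by (auto simp del: address_code.simps)
qed (auto simp: const_no_mult)

lemma com_code_no_mult: "i \<in> set (com_code c p) \<Longrightarrow> \<exists>b. no_mult b i"
proof (induction c arbitrary: p)
  case (Put a e e')
  then show ?case using address_code_no_mult exp_code_no_mult by (auto simp del: address_code.simps)
qed (use exp_code_no_mult in \<open>fastforce simp: Let_def\<close>)+

section \<open>Programs\<close>

text \<open>The first five instructions put the length \<open>3 * n + 3\<close> of the input area into register \<open>0\<close>.\<close>

definition program :: "com \<Rightarrow> instr list" where
  "program c = [Load 1 0, Add 0 1 1, Add 0 0 1, Const 1 3, Add 0 0 1] @ com_code c 5 @ [Halt]"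

definition initial_store :: "('l \<Rightarrow> nat) \<Rightarrow> 'l stored_tree \<Rightarrow> store" where
  "initial_store code R = (\<lambda>_. 0, \<lambda>a i. if a = Raw then mem (initial_state code R) (nat i) else 0)"

lemma length_cells: "length (cells code R) = 3 * tree_size R + 3"
proof -
  have "length (concat (map (\<lambda>(a, u, v). [int (code a), int u, int v]) es)) = 3 * length es" for es
    by (induction es) auto
  then show ?thesis by (cases R) (simp add: tree_size_def)
qed

lemma program_correct:
  assumes "run (3 * int (tree_size R) + 3) c (initial_store code R) n st"
  shows "\<exists>s. exec unit_cost (program c) (initial_state code R) (5 + n) s \<and>
    halted (program c) s \<and> represents (3 * int (tree_size R) + 3) s st"
proof -
  let ?P = "program c" and ?s = "initial_state code R" and ?L = "3 * int (tree_size R) + 3"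
  obtain u v es where "R = (u, v, es)" by (cases R rule: prod_cases3)
  then have n: "mem ?s 0 = int (tree_size R)" by (simp add: initial_state_def tree_size_def)
  have init: "pc ?s = 0" "reg ?s = (\<lambda>_. 0)" by (simp_all add: initial_state_def)
  define s1 where "s1 = ?s\<lparr> pc := 5, reg := (\<lambda>_. 0)(0 := ?L, 1 := 3) \<rparr>"
  have "exec unit_cost ?P ?s (Suc (Suc (Suc (Suc (Suc 0))))) s1"
    by (intro exec_Suc exec_refl')
      (auto simp: step_def program_def set_reg_def s1_def n init fun_eq_iff)
  then have e1: "exec unit_cost ?P ?s 5 s1" by (simp add: eval_nat_numeral)
  have r: "represents ?L s1 (initial_store code R)"
    unfolding represents_def
  proof (intro conjI allI impI)
    fix a i assume v: "valid ?L a i"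
    show "mem s1 (nat (address ?L a i)) = snd (initial_store code R) a i"
    proof (cases "a = Raw")
      case False
      then have "\<not> nat (address ?L a i) < length (cells code R)"
        using v by (auto simp: address_def valid_def length_cells nat_less_iff)
      with False show ?thesis by (simp add: s1_def initial_store_def initial_state_def)
    qed (simp add: s1_def initial_store_def address_def)
  next
    fix x show "reg s1 (var_reg x) = fst (initial_store code R) x"
      by (cases x) (simp_all add: s1_def initial_store_def)
  qed (simp add: s1_def)
  have "code_at ?P 5 (com_code c 5)"
    using code_at_infix[of "[Load 1 0, Add 0 1 1, Add 0 0 1, Const 1 3, Add 0 0 1]" "com_code c 5" "[Halt]"]
    by (simp add: program_def eval_nat_numeral)
  with com_code_correct[OF assms, of ?P s1] r obtain s2 where
    s2: "exec unit_cost ?P s1 n s2" "pc s2 = 5 + com_size c" "represents ?L s2 st"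
    by (auto simp: s1_def)
  moreover have "halted ?P s2"
    using s2(2) by (simp add: halted_def program_def com_code_length nth_append)
  ultimately show ?thesis using exec_trans[OF e1 s2(1)] by blast
qed

lemma program_no_mult: "\<exists>b. \<forall>i \<in> set (program c). no_mult b i"
proof (rule no_mult_common)
  fix i assume "i \<in> set (program c)"
  moreover have "no_mult 2 (Const 1 3)" by simp
  ultimately show "\<exists>b. no_mult b i" using com_code_no_mult[of i c 5] unfolding program_def
    by (auto simp del: no_mult.simps(1))
qed

lemma cell_le_input_bits: "z \<in> set (cells code R) \<Longrightarrow> \<bar>z\<bar> \<le> 2 ^ input_bits code R"
proof -
  assume z: "z \<in> set (cells code R)"
  then have "bit_size z \<le> input_bits code R"
    unfolding input_bits_def by (intro member_le_sum_list) auto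
  then have "nat (bitlen \<bar>z\<bar>) \<le> input_bits code R" by (simp add: bit_size_def)
  then have "(2::int) ^ nat (bitlen \<bar>z\<bar>) \<le> 2 ^ input_bits code R" by (rule two_power_mono)
  moreover have "\<bar>z\<bar> \<le> 2 ^ nat (bitlen \<bar>z\<bar>)" using bitlen_bounds[of "\<bar>z\<bar>"] by (cases "z = 0") auto
  ultimately show ?thesis by linarith
qed

lemma tree_size_le_input_bits: "tree_size R \<le> input_bits code R"
proof -
  have "length xs \<le> sum_list (map bit_size xs)" for xs
    by (induction xs) (auto simp: bit_size_def)
  from this[of "cells code R"] show ?thesis by (simp add: input_bits_def length_cells)
qed

lemma small_initial: "small (input_bits code R) (initial_state code R)"
proof -
  have "\<bar>cells code R ! a\<bar> \<le> 2 ^ input_bits code R" if "a < length (cells code R)" for a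
    using that by (intro cell_le_input_bits nth_mem)
  then show ?thesis by (simp add: small_def initial_state_def)
qed

text \<open>The number of steps also bounds the lengths of the numbers, so a polynomial in the number of steps and the length of the
input bounds the logarithmic cost.\<close>

theorem program_within:
  fixes K :: "nat poly"
  assumes run: "\<And>R. sigma_tree \<Sigma> (tree_of R) \<Longrightarrow>
      \<exists>n st R'. n \<le> poly K (tree_size R) \<and>
        run (3 * int (tree_size R) + 3) c (initial_store code R) n st \<and>
        tree_size R' \<le> tree_size R \<and> (\<forall>i < length (cells code R'). snd st Raw (int i) = cells code R' ! i) \<and>
        is_pruning \<Sigma> (tree_of R') (tree_of R)"
  shows "\<exists>p. \<forall>R. sigma_tree \<Sigma> (tree_of R) \<longrightarrow>
      computes_pruning_within log_cost \<Sigma> code (program c) R (poly p (input_bits code R))"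
    and "sigma_tree \<Sigma> (tree_of R) \<Longrightarrow>
      computes_pruning_within unit_cost \<Sigma> code (program c) R (5 + poly K (tree_size R))"
proof -
  have unit: "\<exists>m s R'. m \<le> 5 + poly K (tree_size R) \<and>
      exec unit_cost (program c) (initial_state code R) m s \<and> halted (program c) s \<and>
      holds_tree code s R' \<and> is_pruning \<Sigma> (tree_of R') (tree_of R)"
    if "sigma_tree \<Sigma> (tree_of R)" for R
  proof -
    let ?L = "3 * int (tree_size R) + 3"
    from run[OF that] obtain n st R' where n: "n \<le> poly K (tree_size R)"
      "run ?L c (initial_store code R) n st" "tree_size R' \<le> tree_size R"
      "\<forall>i < length (cells code R'). snd st Raw (int i) = cells code R' ! i"
      "is_pruning \<Sigma> (tree_of R') (tree_of R)" by blast
    from program_correct[OF n(2)] obtain s where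
      s: "exec unit_cost (program c) (initial_state code R) (5 + n) s" "halted (program c) s"
      "represents ?L s st" by blast
    have "mem s i = snd st Raw (int i)" if "i < length (cells code R')" for i
    proof -
      have "valid ?L Raw (int i)" using that n(3) by (simp add: valid_def length_cells)
      then have "mem s (nat (address ?L Raw (int i))) = snd st Raw (int i)"
        using s(3) unfolding represents_def by blast
      then show ?thesis by (simp add: address_def)
    qed
    then have "holds_tree code s R'" using n(4) by (simp add: holds_tree_def)
    then show ?thesis using s n by (meson add_le_cancel_left)
  qed
  then show "sigma_tree \<Sigma> (tree_of R) \<Longrightarrow>
      computes_pruning_within unit_cost \<Sigma> code (program c) R (5 + poly K (tree_size R))"
    unfolding computes_pruning_within_def by blast
  obtain b where b: "\<forall>i \<in> set (program c). no_mult b i" using program_no_mult by blast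
  \<comment> \<open>The number of steps with the five initial instructions; then \<open>k * (2 * (b + x + k + 2))\<close>.\<close>
  let ?k = "[:5:] + K"
  let ?p = "?k * ([:2:] * ([:b, 1:] + ?k + [:2:]))"
  have mono: "poly q x \<le> poly q y" if "x \<le> y" for q :: "nat poly" and x y
    by (induction q) (use that in \<open>auto intro: mult_le_mono add_mono\<close>)
  have "computes_pruning_within log_cost \<Sigma> code (program c) R (poly ?p (input_bits code R))"
    if T: "sigma_tree \<Sigma> (tree_of R)" for R
  proof -
    let ?x = "input_bits code R"
    from unit[OF T] obtain m s R' where m: "m \<le> 5 + poly K (tree_size R)"
      "exec unit_cost (program c) (initial_state code R) m s" "halted (program c) s"
      "holds_tree code s R'" "is_pruning \<Sigma> (tree_of R') (tree_of R)" by blast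
    have "\<forall>i \<in> set (program c). no_mult (b + ?x) i"
      using b no_mult_mono by (meson le_add1)
    moreover have "small (b + ?x) (initial_state code R)"
      using small_initial[of code R] two_power_mono[of ?x "b + ?x"] unfolding small_def
      by (meson le_add2 order_trans)
    ultimately obtain m' where m': "m' \<le> m * (2 * (b + ?x + m + 2))"
      "exec log_cost (program c) (initial_state code R) m' s"
      using exec_log_cost[OF m(2)] by blast
    have k: "m \<le> poly ?k ?x"
      using m(1) mono[OF tree_size_le_input_bits[of R code], of K] by simp
    note m'(1)
    also have "m * (2 * (b + ?x + m + 2)) \<le> poly ?k ?x * (2 * (b + ?x + poly ?k ?x + 2))"
      using k by (intro mult_le_mono) auto
    also have "\<dots> = poly ?p ?x" by simp
    finally show ?thesis unfolding computes_pruning_within_def using m' m by blast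
  qed
  then show "\<exists>p. \<forall>R. sigma_tree \<Sigma> (tree_of R) \<longrightarrow>
      computes_pruning_within log_cost \<Sigma> code (program c) R (poly p (input_bits code R))" by blast
qed

section \<open>Total correctness with time bounds\<close>

definition hoare :: "int \<Rightarrow> com \<Rightarrow> store \<Rightarrow> nat \<Rightarrow> (store \<Rightarrow> bool) \<Rightarrow> bool" where
  "hoare L c s N Q \<longleftrightarrow> (\<exists>n s'. run L c s n s' \<and> n \<le> N \<and> Q s')"

fun wp :: "int \<Rightarrow> com \<Rightarrow> (store \<Rightarrow> bool) \<Rightarrow> store \<Rightarrow> bool" where
  "wp L Skip Q s \<longleftrightarrow> Q s"
| "wp L (x :== e) Q s \<longleftrightarrow> safe L e s \<and> Q ((fst s)(x := eval e s), snd s)"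
| "wp L (Put a e e') Q s \<longleftrightarrow> safe L e s \<and> valid L a (eval e s) \<and> safe L e' s \<and>
     Q (fst s, (snd s)(a := (snd s a)(eval e s := eval e' s)))"
| "wp L (c ;; c') Q s \<longleftrightarrow> wp L c (wp L c' Q) s"
| "wp L (If_zero e c c') Q s \<longleftrightarrow> safe L e s \<and> (if eval e s = 0 then wp L c Q s else wp L c' Q s)"
| "wp L (While_neg e c) Q s \<longleftrightarrow> False"

text \<open>A bound for the number of steps of a command without loops, counting both branches of a conditional.\<close>

fun cost :: "com \<Rightarrow> nat" where
  "cost Skip = 0"
| "cost (x :== e) = exp_cost e + 2"
| "cost (Put a e e') = exp_cost e + length (address_code a 0) + exp_cost e' + 1"
| "cost (c ;; c') = cost c + cost c'"
| "cost (If_zero e c c') = exp_cost e + 2 + cost c + cost c'"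
| "cost (While_neg e c) = exp_cost e + 2"

lemma hoare_wp: "wp L c Q s \<Longrightarrow> hoare L c s (cost c) Q"
proof (induction c arbitrary: s Q)
  case Skip
  then show ?case unfolding hoare_def wp.simps cost.simps by (blast intro: run_Skip)
next
  case (Assign x e)
  then show ?case unfolding hoare_def wp.simps cost.simps by (blast intro: run_Assign)
next
  case (Put a e e')
  then show ?case unfolding hoare_def wp.simps cost.simps by (blast intro: run_Put)
next
  case (Seq c c')
  from Seq.IH(1)[of "wp L c' Q" s] Seq.prems obtain n s' where
    1: "run L c s n s'" "n \<le> cost c" "wp L c' Q s'" by (auto simp: hoare_def)
  from Seq.IH(2)[OF 1(3)] obtain n' s'' where "run L c' s' n' s''" "n' \<le> cost c'" "Q s''"
    by (auto simp: hoare_def)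
  then show ?case using 1 run_Seq unfolding hoare_def cost.simps by (meson add_mono)
next
  case (If_zero e c c')
  show ?case
  proof (cases "eval e s = 0")
    case True
    with If_zero.prems If_zero.IH(1)[of Q s] obtain n s' where "run L c s n s'" "n \<le> cost c" "Q s'"
      by (auto simp: hoare_def)
    then show ?thesis using run_zero[of L e s c n s' c'] True If_zero.prems
      unfolding hoare_def by (intro exI[of _ "exp_cost e + 1 + n"] exI[of _ s']) auto
  next
    case False
    with If_zero.prems If_zero.IH(2)[of Q s] obtain n s' where "run L c' s n s'" "n \<le> cost c'" "Q s'"
      by (auto simp: hoare_def)
    then show ?thesis using run_nonzero[of L e s c' n s' c] False If_zero.prems
      unfolding hoare_def by (intro exI[of _ "exp_cost e + 1 + n + 1"] exI[of _ s']) auto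
  qed
qed simp

lemma hoare_seq:
  assumes "hoare L c s N Q" "\<And>s'. Q s' \<Longrightarrow> hoare L c' s' N' Q'"
  shows "hoare L (c ;; c') s (N + N') Q'"
proof -
  from assms(1) obtain n s' where 1: "run L c s n s'" "n \<le> N" "Q s'" by (auto simp: hoare_def)
  from assms(2)[OF 1(3)] obtain n' s'' where "run L c' s' n' s''" "n' \<le> N'" "Q' s''"
    by (auto simp: hoare_def)
  then show ?thesis using 1 run_Seq unfolding hoare_def by (meson add_mono)
qed

lemma hoare_weaken:
  "hoare L c s N Q \<Longrightarrow> N \<le> N' \<Longrightarrow> (\<And>s'. Q s' \<Longrightarrow> Q' s') \<Longrightarrow> hoare L c s N' Q'"
  unfolding hoare_def by (meson order_trans)

text \<open>The time for \<open>k\<close> rounds of a loop with condition \<open>e\<close> whose body takes time \<open>N\<close>.\<close>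

definition loop_cost :: "exp \<Rightarrow> nat \<Rightarrow> nat \<Rightarrow> nat" where
  "loop_cost e N k = k * (exp_cost e + 2 + N) + (exp_cost e + 2)"

lemma loop_cost_mono: "k \<le> k' \<Longrightarrow> loop_cost e N k \<le> loop_cost e N k'"
  unfolding loop_cost_def by (intro add_mono mult_le_mono) simp_all

lemma hoare_while:
  fixes a b :: nat
  assumes "a \<le> b" "Inv a s"
    and body: "\<And>j s. a \<le> j \<Longrightarrow> j < b \<Longrightarrow> Inv j s \<Longrightarrow>
      safe L e s \<and> eval e s < 0 \<and> hoare L c s N (Inv (Suc j))"
    and stop: "\<And>s. Inv b s \<Longrightarrow> safe L e s \<and> 0 \<le> eval e s"
  shows "hoare L (While_neg e c) s (loop_cost e N (b - a)) (Inv b)"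
proof -
  have "hoare L (While_neg e c) s (loop_cost e N (b - i)) (Inv b)"
    if "a \<le> i" "i \<le> b" "Inv i s" for i s
    using that
  proof (induction "b - i" arbitrary: i s)
    case 0
    then have "Inv b s" by simp
    with stop[of s] have "run L (While_neg e c) s (exp_cost e + 2) s" using run_stop by blast
    moreover have "exp_cost e + 2 \<le> loop_cost e N (b - i)" by (simp add: loop_cost_def)
    ultimately show ?case unfolding hoare_def using \<open>Inv b s\<close> by blast
  next
    case (Suc d)
    then have "i < b" by simp
    from body[OF Suc(3) this Suc(5)] obtain n s1 where
      1: "safe L e s" "eval e s < 0" "run L c s n s1" "n \<le> N" "Inv (Suc i) s1"
      unfolding hoare_def by blast
    have d: "d = b - Suc i" "a \<le> Suc i" "Suc i \<le> b" using Suc(2,3) \<open>i < b\<close> by auto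
    from Suc(1)[OF d 1(5)] obtain n' s2 where
      2: "run L (While_neg e c) s1 n' s2" "n' \<le> loop_cost e N d" "Inv b s2"
      unfolding hoare_def d(1) by blast
    have "exp_cost e + 1 + n + 1 + n' \<le> loop_cost e N (b - i)"
      using 1(4) 2(2) unfolding Suc(2)[symmetric] by (simp add: loop_cost_def)
    then show ?case using run_loop[OF 1(1-3) 2(1)] 2(3) unfolding hoare_def by blast
  qed
  then show ?thesis using assms(1,2) by blast
qed

section \<open>Numbering the vertices\<close>

text \<open>Looks at one of the two ends of an edge that is stored from cell \<open>Vq\<close> on: the target if \<open>Vb = 1\<close> and the source if \<open>Vb = 0\<close>. If
this end is unnumbered and the opposite end is numbered, then it gets the next number and the edge is
recorded under this number. An entry \<open>0\<close> of \<open>Idx\<close> means unnumbered.\<close>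

definition visit :: com where
  "visit =
    (Vp :== Get Idx (Get Raw (Var Vq \<oplus> Num 2 \<ominus> Var Vb));;
     If_zero (Var Vp) Skip
      (If_zero (Get Idx (Get Raw (Var Vq \<oplus> Num 1 \<oplus> Var Vb)))
        (Vk :== Var Vk \<oplus> Num 1;;
         Put Idx (Get Raw (Var Vq \<oplus> Num 1 \<oplus> Var Vb)) (Var Vk);;
         Put Lab (Var Vk) (Get Raw (Var Vq));;
         Put Dir (Var Vk) (Var Vb);;
         Put End (Var Vk \<oplus> Var Vk \<oplus> Var Vb) (Var Vk);;
         Put End (Var Vk \<oplus> Var Vk \<oplus> Num 1 \<ominus> Var Vb) (Var Vp))
        Skip))"

text \<open>One scan goes through the edge list once and numbers new vertices as it finds them. As long as the numbering is
incomplete, each scan succeeds at least once, so \<open>n\<close> scans suffice.\<close>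

definition scan_body :: com where
  "scan_body =
    (Vb :== Num 0;; visit;; Vb :== Num 1;; visit;;
     Vq :== Var Vq \<oplus> Num 3;; Vj :== Var Vj \<oplus> Num 1)"

definition scan :: com where
  "scan = (Vq :== Num 3;; Vj :== Num 0;; While_neg (Var Vj \<ominus> Var Vn) scan_body;; Vi :== Var Vi \<oplus> Num 1)"

definition prepare_code :: com where
  "prepare_code =
    (Vn :== Get Raw (Num 0);; Vw :== Var Vn \<oplus> Num 2;; Vk :== Num 1;;
     Put Idx (Get Raw (Num 1)) (Num 1);; Vi :== Num 0)"

definition number_code :: com where
  "number_code =
    (prepare_code;; While_neg (Var Vi \<ominus> Var Vn) scan;; Vt :== Get Idx (Get Raw (Num 2)))"

lemma nth_concat_triples:
  assumes "\<And>x. length (f x) = 3" "j < length xs" "c < 3"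
  shows "concat (map f xs) ! (3 * j + c) = f (xs ! j) ! c"
  using assms(2)
proof (induction xs arbitrary: j)
  case (Cons x xs)
  then show ?case using assms(1,3) by (cases j) (auto simp: nth_append)
qed simp

definition scan_cost :: "nat \<Rightarrow> nat" where
  "scan_cost n = cost (Vq :== Num 3) + (cost (Vj :== Num 0) + (loop_cost (Var Vj \<ominus> Var Vn) (cost scan_body) n + cost (Vi :== Var Vi \<oplus> Num 1)))"

declare tree_of.simps [simp del]

locale pruning_run =
  fixes \<Sigma> :: "'l set" and code :: "'l \<Rightarrow> nat" and s0 t0 :: nat and es :: "('l \<times> nat \<times> nat) list"
  assumes tree: "sigma_tree \<Sigma> (tree_of (s0, t0, es))" and code_inj: "inj_on code \<Sigma>"
begin

abbreviation "n \<equiv> length es"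
abbreviation "T \<equiv> tree_of (s0, t0, es)"
abbreviation "G \<equiv> graph_of T"
abbreviation "L \<equiv> 3 * int n + 3"

definition input :: "(arr \<Rightarrow> int \<Rightarrow> int) \<Rightarrow> bool" where
  "input h \<longleftrightarrow> h Raw 0 = int n \<and> h Raw 1 = int s0 \<and> h Raw 2 = int t0 \<and>
     (\<forall>j < n. h Raw (3 + 3 * int j) = int (code (label T j)) \<and>
        (\<forall>b. h Raw (3 + 3 * int j + 1 + of_bool b) = int (arc_end G b j)))"

text \<open>Both ends of edge \<open>i\<close> are kept in one array, at the positions \<open>2 * i\<close> and \<open>2 * i + 1\<close>, so that
a direction bit can select the end.\<close>

definition tables ::
  "nat \<Rightarrow> (nat \<Rightarrow> nat) \<Rightarrow> (nat \<Rightarrow> nat) \<Rightarrow> (bool \<Rightarrow> nat \<Rightarrow> nat) \<Rightarrow> (nat \<Rightarrow> bool) \<Rightarrow>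
   (arr \<Rightarrow> int \<Rightarrow> int) \<Rightarrow> bool" where
  "tables k vt ge en dir h \<longleftrightarrow> numbering T k vt ge en dir \<and>
     (\<forall>i \<in> {2..k}. h Lab (int i) = int (code (label T (ge i))) \<and> h Dir (int i) = of_bool (dir i) \<and>
        (\<forall>b. h End (2 * int i + of_bool b) = int (en b i)))"

definition index :: "nat \<Rightarrow> (nat \<Rightarrow> nat) \<Rightarrow> (arr \<Rightarrow> int \<Rightarrow> int) \<Rightarrow> bool" where
  "index k vt h \<longleftrightarrow> (\<forall>i \<in> {1..k}. h Idx (int (vt i)) = int i) \<and>
     (\<forall>v. v \<notin> vt ` {1..k} \<longrightarrow> h Idx (int v) = 0)"

definition blank :: "(arr \<Rightarrow> int \<Rightarrow> int) \<Rightarrow> bool" where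
  "blank h \<longleftrightarrow> (\<forall>i. h Dead i = 0 \<and> h Mark i = 0 \<and> h Fit i = 0)"

definition crossing :: "nat \<Rightarrow> (nat \<Rightarrow> nat) \<Rightarrow> nat \<times> bool \<Rightarrow> bool" where
  "crossing k vt = (\<lambda>(j, b). arc_end G (\<not> b) j \<in> vt ` {1..k} \<and> arc_end G b j \<notin> vt ` {1..k})"

text \<open>The invariant of a scan that began with \<open>low\<close> numbered vertices and has dealt with the ends in \<open>X\<close>: unless something new has been
numbered, none of them leads out of the numbered part.\<close>

definition scanned :: "nat \<Rightarrow> (nat \<times> bool) set \<Rightarrow> (var \<Rightarrow> int) \<Rightarrow> (arr \<Rightarrow> int \<Rightarrow> int) \<Rightarrow> bool" where
  "scanned low X \<sigma> h \<longleftrightarrow> \<sigma> Vn = int n \<and> \<sigma> Vw = int n + 2 \<and> input h \<and> blank h \<and>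
     (\<exists>k vt ge en dir. \<sigma> Vk = int k \<and> tables k vt ge en dir h \<and> index k vt h \<and> low \<le> k \<and>
        (k = low \<longrightarrow> (\<forall>x \<in> X. \<not> crossing k vt x)))"

lemma G_arcs: "arcs G = {..<n}"
  by (simp add: tree_of.simps)

lemma wp_visit:
  assumes sc: "scanned low X \<sigma> h" and j: "j < n" and q: "\<sigma> Vq = 3 + 3 * int j" and b: "\<sigma> Vb = of_bool b"
    and Q: "\<And>\<sigma>' h'. scanned low (insert (j, b) X) \<sigma>' h' \<Longrightarrow>
      (\<And>x. x \<notin> {Vk, Vp} \<Longrightarrow> \<sigma>' x = \<sigma> x) \<Longrightarrow> Q (\<sigma>', h')"
  shows "wp L visit Q (\<sigma>, h)"
proof -
  from sc obtain k vt ge en dir where k: "\<sigma> Vk = int k" "tables k vt ge en dir h" "index k vt h" "low \<le> k"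
    "k = low \<Longrightarrow> \<forall>x \<in> X. \<not> crossing k vt x" and fx: "\<sigma> Vn = int n" "\<sigma> Vw = int n + 2" "input h" "blank h"
    unfolding scanned_def by blast
  define u where "u = arc_end G (\<not> b) j"
  define v where "v = arc_end G b j"
  have a1: "\<sigma> Vq + 2 - \<sigma> Vb = 3 + 3 * int j + 1 + of_bool (\<not> b)"
    "\<sigma> Vq + 1 + \<sigma> Vb = 3 + 3 * int j + 1 + of_bool b" using q b by (cases b; simp)+
  have raw: "h Raw (\<sigma> Vq + 2 - \<sigma> Vb) = int u" "h Raw (\<sigma> Vq + 1 + \<sigma> Vb) = int v"
    "h Raw (\<sigma> Vq) = int (code (label T j))"
  proof -
    have in_end: "h Raw (3 + 3 * int j + 1 + of_bool c) = int (arc_end G c j)" for c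
      using fx(3) j unfolding input_def by blast
    show "h Raw (\<sigma> Vq + 2 - \<sigma> Vb) = int u" "h Raw (\<sigma> Vq + 1 + \<sigma> Vb) = int v"
      unfolding a1 u_def v_def by (rule in_end)+
    show "h Raw (\<sigma> Vq) = int (code (label T j))" unfolding q using fx(3) j unfolding input_def by blast
  qed
  have val: "valid L Raw (\<sigma> Vq + 2 - \<sigma> Vb)" "valid L Raw (\<sigma> Vq + 1 + \<sigma> Vb)" "valid L Raw (\<sigma> Vq)"
    using j q b by (cases b; simp add: valid_def)+
  have idx: "h Idx (int x) = 0 \<longleftrightarrow> x \<notin> vt ` {1..k}" for x
    using k(3) unfolding index_def by force
  have skip: "scanned low (insert (j, b) X) (\<sigma>(Vp := z)) h" if "\<not> crossing k vt (j, b)" for z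
    unfolding scanned_def using k fx that
    by (intro conjI exI[of _ k] exI[of _ vt] exI[of _ ge] exI[of _ en] exI[of _ dir]) auto
  show ?thesis
  proof (cases "crossing k vt (j, b)")
    case False
    then have "h Idx (int u) = 0 \<or> h Idx (int v) \<noteq> 0" unfolding idx by (auto simp: crossing_def u_def v_def)
    then show ?thesis
      using val Q[OF skip[OF False]] unfolding visit_def
      by (auto simp: raw valid_def[of _ Idx])
  next
    case True
    then obtain p where p: "p \<in> {1..k}" "u = vt p" "v \<notin> vt ` {1..k}"
      by (auto simp: crossing_def u_def v_def)
    then have i: "h Idx (int u) = int p" "h Idx (int v) = 0" using k(3) idx by (auto simp: index_def)
    let ?vt = "vt(Suc k := v)" and ?ge = "ge(Suc k := j)" and ?dir = "dir(Suc k := b)"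
      and ?en = "\<lambda>c. (en c)(Suc k := if c = b then Suc k else p)"
    let ?k = "int k + 1"
    let ?h = "h(Idx := (h Idx)(int v := ?k), Lab := (h Lab)(?k := int (code (label T j))),
      Dir := (h Dir)(?k := of_bool b),
      End := (h End)(?k + ?k + of_bool b := ?k, ?k + ?k + 1 - of_bool b := int p))"
    let ?\<sigma> = "\<sigma>(Vp := int p, Vk := ?k)"
    have num: "numbering T (Suc k) ?vt ?ge ?en ?dir"
      using numbering_Suc[of T k vt ge en dir j p b] k(2) j p
      by (simp add: tables_def u_def v_def G_arcs)
    have e1: "?k + ?k + 1 - of_bool b = 2 * int (Suc k) + of_bool (\<not> b)"
      "?k + ?k + of_bool b = 2 * int (Suc k) + of_bool b" by (cases b; simp)+
    have old: "2 * int i + of_bool c \<noteq> 2 * int (Suc k) + of_bool d" if "i \<le> k" for i c d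
      using that by (cases c; cases d) auto
    have "tables (Suc k) ?vt ?ge ?en ?dir ?h"
      unfolding tables_def
    proof (intro conjI ballI allI num)
      fix i c assume i: "i \<in> {2..Suc k}"
      show "?h Lab (int i) = int (code (label T (?ge i)))" "?h Dir (int i) = of_bool (?dir i)"
        using k(2) i by (auto simp: tables_def)
      show "?h End (2 * int i + of_bool c) = int (?en c i)"
      proof (cases "i = Suc k")
        case True
        then show ?thesis unfolding e1 by (cases b; cases c) simp_all
      next
        case False
        then show ?thesis using k(2) i old[of i c] unfolding e1 by (auto simp: tables_def)
      qed
    qed
    moreover have "index (Suc k) ?vt ?h"
      unfolding index_def
    proof (intro conjI ballI allI impI)
      fix i assume i: "i \<in> {1..Suc k}"
      show "?h Idx (int (?vt i)) = int i"
      proof (cases "i = Suc k")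
        case False
        then have "i \<in> {1..k}" "vt i \<noteq> v" using i p(3) by auto
        then show ?thesis using k(3) False by (simp add: index_def)
      qed simp
    next
      fix x assume x: "x \<notin> ?vt ` {1..Suc k}"
      have "?vt ` {1..Suc k} = insert v (vt ` {1..k})"
      proof -
        have "?vt ` {1..k} = vt ` {1..k}" by (rule image_cong) auto
        then show ?thesis by (simp add: atLeastAtMostSuc_conv fun_upd_same del: fun_upd_apply)
      qed
      with x have "x \<noteq> v" "x \<notin> vt ` {1..k}" by auto
      then show "?h Idx (int x) = 0" using k(3) by (simp add: index_def)
    qed
    moreover have "input ?h" "blank ?h" using fx by (simp_all add: input_def blank_def)
    ultimately have sc': "scanned low (insert (j, b) X) ?\<sigma> ?h"
      unfolding scanned_def using fx k(4)
      by (intro conjI exI[of _ "Suc k"] exI[of _ ?vt] exI[of _ ?ge] exI[of _ ?en] exI[of _ ?dir]) auto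
    let ?K = "\<sigma> Vk + 1"
    have "Q (\<sigma>(Vp := int p, Vk := ?K), h(Idx := (h Idx)(int v := ?K), Lab := (h Lab)(?K := int (code (label T j))),
      Dir := (h Dir)(?K := \<sigma> Vb),
      End := (h End)(?K + ?K + \<sigma> Vb := ?K, ?K + ?K + 1 - \<sigma> Vb := int p)))"
      using Q[OF sc'] by (simp only: k(1) b) simp
    moreover have "0 \<le> ?K + ?K + 1 - \<sigma> Vb" "0 \<le> \<sigma> Vb" "0 \<le> \<sigma> Vk" using b k(1) by (cases b; simp)+
    moreover have "p \<noteq> 0" using p by auto
    ultimately show ?thesis
      using val i unfolding visit_def
      by (simp add: raw valid_def[of _ Idx] valid_def[of _ Lab] valid_def[of _ End] valid_def[of _ Dir])
  qed
qed

lemma scan_body: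
  assumes sc: "scanned low (X \<times> UNIV) \<sigma> h" and j: "j < n" and q: "\<sigma> Vq = 3 + 3 * int j" "\<sigma> Vj = int j"
  shows "wp L scan_body (\<lambda>(\<sigma>', h'). scanned low (insert j X \<times> UNIV) \<sigma>' h' \<and>
      \<sigma>' Vq = 3 + 3 * int (Suc j) \<and> \<sigma>' Vj = int (Suc j) \<and> \<sigma>' Vi = \<sigma> Vi) (\<sigma>, h)"
proof -
  have upd: "scanned low Y (\<sigma>'(x := z)) h' \<longleftrightarrow> scanned low Y \<sigma>' h'"
    if "x \<notin> {Vn, Vw, Vk}" for Y \<sigma>' x z h'
    using that unfolding scanned_def by auto
  have X: "insert (j, True) (insert (j, False) (X \<times> UNIV)) = insert j X \<times> (UNIV :: bool set)"
    by (auto simp: UNIV_bool)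
  show ?thesis
    unfolding scan_body_def wp.simps
    apply (intro conjI)
     apply simp
    apply simp
    apply (rule wp_visit[where j = j and b = False and low = low and X = "X \<times> UNIV"])
        apply (simp add: upd sc)
       apply (rule j)
      apply (simp add: q)
     apply simp
    subgoal for \<sigma>' h'
      apply simp
      apply (rule wp_visit[where j = j and b = True and low = low and X = "insert (j, False) (X \<times> UNIV)"])
          apply (simp add: upd)
         apply (rule j)
        apply (simp add: q)
       apply simp
      subgoal for \<sigma>'' h''
        unfolding X[symmetric] using q by (simp add: upd)
      done
    done
qed

lemma scan:
  assumes sc: "scanned low {} \<sigma> h" and i: "\<sigma> Vi = int i"
  shows "hoare L scan (\<sigma>, h)
     (scan_cost n)
     (\<lambda>(\<sigma>', h'). scanned low ({..<n} \<times> UNIV) \<sigma>' h' \<and> \<sigma>' Vi = int (Suc i))"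
proof -
  let ?I = "\<lambda>j (\<sigma>', h'). scanned low ({..<j} \<times> UNIV) \<sigma>' h' \<and>
    \<sigma>' Vq = 3 + 3 * int j \<and> \<sigma>' Vj = int j \<and> \<sigma>' Vi = int i"
  have upd: "scanned low Y (\<sigma>'(x := z)) h' \<longleftrightarrow> scanned low Y \<sigma>' h'"
    if "x \<notin> {Vn, Vw, Vk}" for Y \<sigma>' x z h'
    using that unfolding scanned_def by auto
  have loop: "hoare L (While_neg (Var Vj \<ominus> Var Vn) scan_body) s
      (loop_cost (Var Vj \<ominus> Var Vn) (cost scan_body) (n - 0)) (?I n)"
    if "?I 0 s" for s
  proof (rule hoare_while[where Inv = ?I])
    fix j s assume j: "j < n" and "?I j s"
    then obtain \<sigma>' h' where s: "s = (\<sigma>', h')" "scanned low ({..<j} \<times> UNIV) \<sigma>' h'"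
      "\<sigma>' Vq = 3 + 3 * int j" "\<sigma>' Vj = int j" "\<sigma>' Vi = int i" by (cases s) auto
    from hoare_wp[OF scan_body[OF s(2) j s(3,4)]]
    have "hoare L scan_body s (cost scan_body) (?I (Suc j))"
      unfolding s(1) by (rule hoare_weaken) (auto simp: s lessThan_Suc)
    then show "safe L (Var Vj \<ominus> Var Vn) s \<and> eval (Var Vj \<ominus> Var Vn) s < 0 \<and>
        hoare L scan_body s (cost scan_body) (?I (Suc j))"
      using s j by (auto simp: scanned_def)
  qed (use that in \<open>auto simp: scanned_def\<close>)
  show ?thesis
    unfolding scan_def scan_cost_def
    apply (rule hoare_seq[where Q = "\<lambda>(\<sigma>', h'). scanned low {} \<sigma>' h' \<and> \<sigma>' Vi = int i \<and> \<sigma>' Vq = 3"])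
     apply (rule hoare_wp) apply (simp add: sc upd i)
    apply (rule hoare_seq[where Q = "?I 0"])
     apply (rule hoare_wp) apply (auto simp: upd)[]
    apply (rule hoare_seq[where Q = "?I n"])
    using loop apply simp
    apply (rule hoare_wp) apply (auto simp: upd)[]
    done
qed

text \<open>A complete scan without success means that everything is numbered. Counting edges shows that this is the
case exactly when \<open>n + 1\<close> vertices have numbers.\<close>

lemma full_numbering:
  assumes "tables k vt ge en dir h"
  shows "k \<le> Suc n" "(\<And>x. x \<in> {..<n} \<times> UNIV \<Longrightarrow> \<not> crossing k vt x) \<Longrightarrow> k = Suc n"
    "k = Suc n \<Longrightarrow> vt ` {1..k} = verts G \<and> ge ` {2..k} = arcs G"
proof -
  interpret N: tree_numbering \<Sigma> T k vt ge en dir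
    using tree assms by unfold_locales (simp_all add: tables_def)
  show "k \<le> Suc n" using N.numbering_size by (simp add: G_arcs)
  have card: "card (ge ` {2..k}) = k - 1" using card_image[OF N.ge_inj] by simp
  show "k = Suc n" if "\<And>x. x \<in> {..<n} \<times> UNIV \<Longrightarrow> \<not> crossing k vt x"
  proof -
    have "ge ` {2..k} = arcs G"
      using that by (intro N.numbering_complete(2)) (auto simp: crossing_def G_arcs)
    moreover have "1 \<le> k" using N.num by (simp add: numbering_def)
    ultimately show ?thesis using card by (simp add: G_arcs)
  qed
  show "vt ` {1..k} = verts G \<and> ge ` {2..k} = arcs G" if "k = Suc n"
  proof -
    have eq: "ge ` {2..k} = arcs G"
      using N.arc card that by (intro card_subset_eq) (auto simp: G_arcs)
    have "arc_end G b e \<in> vt ` {1..k}" if "e \<in> arcs G" for e b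
    proof -
      from that obtain i where "i \<in> {2..k}" "e = ge i" using eq by blast
      then show ?thesis using N.ends[of i b, symmetric] N.en_range[of i b] by simp
    qed
    then show ?thesis using N.numbering_complete by blast
  qed
qed

lemma number:
  assumes h: "input h" "blank h" "\<And>i. h Idx i = 0"
  shows "hoare L number_code (\<lambda>_. 0, h)
    (cost prepare_code + (loop_cost (Var Vi \<ominus> Var Vn) (scan_cost n) n + cost (Vt :== Get Idx (Get Raw (Num 2)))))
    (\<lambda>(\<sigma>, h). \<exists>vt ge en dir t. tables (Suc n) vt ge en dir h \<and> blank h \<and> t \<in> {1..Suc n} \<and>
       vt t = end_vertex T \<and> \<sigma> Vn = int n \<and> \<sigma> Vw = int n + 2 \<and> \<sigma> Vt = int t)"
proof -
  let ?I = "\<lambda>i (\<sigma>, h). scanned 1 {} \<sigma> h \<and> \<sigma> Vi = int i \<and> (int i < \<sigma> Vk \<or> \<sigma> Vk = int (Suc n))"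
  have upd: "scanned low Y (\<sigma>'(x := z)) h' \<longleftrightarrow> scanned low Y \<sigma>' h'"
    if "x \<notin> {Vn, Vw, Vk}" for low Y \<sigma>' x z h'
    using that unfolding scanned_def by auto
  have init: "?I 0 (\<lambda>x. if x = Vn then int n else if x = Vw then int n + 2 else if x = Vk then 1 else 0,
      h(Idx := (h Idx)(int s0 := 1)))"
  proof -
    let ?h = "h(Idx := (h Idx)(int s0 := 1))" and ?vt = "\<lambda>_::nat. s0"
    have "numbering T 1 ?vt ge en dir" for ge en dir
      using numbering_1[of T ge en dir] by (simp add: tree_of.simps)
    then have "tables 1 ?vt ge en dir ?h" for ge en dir by (simp add: tables_def)
    moreover have "index 1 ?vt ?h" using h(3) by (auto simp: index_def)
    moreover have "input ?h" "blank ?h" using h by (simp_all add: input_def blank_def)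
    ultimately have "scanned 1 {} (\<lambda>x. if x = Vn then int n else if x = Vw then int n + 2 else if x = Vk then 1 else 0) ?h"
      unfolding scanned_def by (intro conjI exI[of _ "1::nat"] exI[of _ ?vt]) auto
    then show ?thesis by simp
  qed
  have prep: "wp L prepare_code (?I 0) (\<lambda>_. 0, h)"
  proof -
    have "(\<lambda>_. 0)(Vn := int n, Vw := int n + 2, Vk := 1, Vi := 0) =
        (\<lambda>x. if x = Vn then int n else if x = Vw then int n + 2 else if x = Vk then 1 else 0)"
      by (auto simp: fun_eq_iff)
    then show ?thesis
      using init h unfolding prepare_code_def by (simp add: valid_def input_def)
  qed
  have step: "hoare L scan (\<sigma>, h) (scan_cost n) (?I (Suc i))" if I: "?I i (\<sigma>, h)" and i: "i < n" for i \<sigma> h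
  proof -
    from I obtain k vt ge en dir where k: "\<sigma> Vk = int k" "tables k vt ge en dir h" "index k vt h"
      and fx: "\<sigma> Vn = int n" "\<sigma> Vw = int n + 2" "input h" "blank h" "\<sigma> Vi = int i" "i < k \<or> k = Suc n"
      unfolding scanned_def by auto
    have "scanned k {} \<sigma> h" unfolding scanned_def using k fx by blast
    from scan[OF this fx(5)] show ?thesis
    proof (rule hoare_weaken)
      fix s assume "case s of (\<sigma>', h') \<Rightarrow> scanned k ({..<n} \<times> UNIV) \<sigma>' h' \<and> \<sigma>' Vi = int (Suc i)"
      then obtain \<sigma>' h' where s: "s = (\<sigma>', h')" "scanned k ({..<n} \<times> UNIV) \<sigma>' h'" "\<sigma>' Vi = int (Suc i)"
        by (cases s) auto
      then obtain k' vt' ge' en' dir' where k': "\<sigma>' Vk = int k'" "tables k' vt' ge' en' dir' h'" "index k' vt' h'"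
        "k \<le> k'" "k' = k \<Longrightarrow> \<forall>x \<in> {..<n} \<times> UNIV. \<not> crossing k' vt' x"
        unfolding scanned_def by auto
      have "k' \<le> Suc n" "k' = k \<Longrightarrow> k' = Suc n" using full_numbering(1,2)[OF k'(2)] k'(5) by blast+
      then have "Suc i < k' \<or> k' = Suc n" using k'(4) fx(6) by linarith
      moreover have "1 \<le> k'" using k'(2) by (simp add: tables_def numbering_def)
      then have "scanned 1 {} \<sigma>' h'" using s(2) k' unfolding scanned_def by blast
      ultimately show "?I (Suc i) s" using s k'(1) by auto
    qed simp
  qed
  have loop: "hoare L (While_neg (Var Vi \<ominus> Var Vn) scan) s
      (loop_cost (Var Vi \<ominus> Var Vn) (scan_cost n) (n - 0)) (?I n)"
    if "?I 0 s" for s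
  proof (rule hoare_while[where Inv = ?I])
    fix i s assume i: "i < n" and "?I i s"
    then show "safe L (Var Vi \<ominus> Var Vn) s \<and> eval (Var Vi \<ominus> Var Vn) s < 0 \<and>
        hoare L scan s (scan_cost n) (?I (Suc i))"
      using step[of i "fst s" "snd s"] by (cases s) (auto simp: scanned_def)
  qed (use that in \<open>auto simp: scanned_def\<close>)
  let ?Q = "\<lambda>(\<sigma>, h). \<exists>vt ge en dir t. tables (Suc n) vt ge en dir h \<and> blank h \<and> t \<in> {1..Suc n} \<and>
       vt t = end_vertex T \<and> \<sigma> Vn = int n \<and> \<sigma> Vw = int n + 2 \<and> \<sigma> Vt = int t"
  have final: "wp L (Vt :== Get Idx (Get Raw (Num 2))) ?Q s" if "?I n s" for s
  proof -
    from that obtain \<sigma> h where s: "s = (\<sigma>, h)" "scanned 1 {} \<sigma> h" "int n < \<sigma> Vk \<or> \<sigma> Vk = int (Suc n)"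
      by (cases s) auto
    then obtain k vt ge en dir where k: "\<sigma> Vk = int k" "tables k vt ge en dir h" "index k vt h"
      and fx: "\<sigma> Vn = int n" "\<sigma> Vw = int n + 2" "input h" "blank h"
      unfolding scanned_def by auto
    have kn: "k = Suc n" using full_numbering(1)[OF k(2)] s(3) k(1) by auto
    have "t0 \<in> verts G" by (simp add: tree_of.simps)
    then obtain t where t: "t \<in> {1..Suc n}" "vt t = t0"
      using full_numbering(3)[OF k(2) kn] kn by (metis imageE)
    then have "h Idx (int t0) = int t" using k(3) kn by (auto simp: index_def)
    moreover have "h Raw 2 = int t0" using fx by (simp add: input_def)
    moreover have "vt t = end_vertex T" using t by (simp add: tree_of.simps)
    ultimately show ?thesis
      using s k(2) kn fx t by (auto simp: valid_def)
  qed
  show ?thesis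
    unfolding number_code_def
  proof (rule hoare_seq[OF hoare_wp[OF prep]])
    fix s assume "?I 0 s"
    from hoare_seq[OF loop[OF this] hoare_wp[OF final]]
    show "hoare L (While_neg (Var Vi \<ominus> Var Vn) scan;; Vt :== Get Idx (Get Raw (Num 2))) s
       (loop_cost (Var Vi \<ominus> Var Vn) (scan_cost n) n +
         cost (Vt :== Get Idx (Get Raw (Num 2)))) ?Q" by simp
  qed
qed

end

section \<open>Computing which subtrees fit where\<close>

lemma hoare_for:
  assumes "lo \<le> hi" "Inv lo s"
    and body: "\<And>j s. lo \<le> j \<Longrightarrow> j < hi \<Longrightarrow> Inv j s \<Longrightarrow> wp L c (Inv (Suc j)) s"
    and var: "\<And>j s. Inv j s \<Longrightarrow> fst s Vj = int j \<and> fst s Vw = int hi"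
  shows "hoare L (While_neg (Var Vj \<ominus> Var Vw) c) s
    (loop_cost (Var Vj \<ominus> Var Vw) (cost c) hi) (Inv hi)"
proof -
  have "hoare L (While_neg (Var Vj \<ominus> Var Vw) c) s
    (loop_cost (Var Vj \<ominus> Var Vw) (cost c) (hi - lo)) (Inv hi)"
  proof (rule hoare_while[where Inv = Inv])
    fix j s assume j: "lo \<le> j" "j < hi" "Inv j s"
    then show "safe L (Var Vj \<ominus> Var Vw) s \<and> eval (Var Vj \<ominus> Var Vw) s < 0 \<and> hoare L c s (cost c) (Inv (Suc j))"
      using var[OF j(3)] hoare_wp[OF body[OF j]] by auto
  next
    fix s assume "Inv hi s"
    from var[OF this] show "safe L (Var Vj \<ominus> Var Vw) s \<and> 0 \<le> eval (Var Vj \<ominus> Var Vw) s" by simp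
  qed (use assms in auto)
  then show ?thesis by (rule hoare_weaken) (auto intro: loop_cost_mono)
qed

text \<open>The product of \<open>Vg\<close> and \<open>Vw\<close> by repeated addition. It is needed for the rows of a two-dimensional table, and only once
or twice per edge, so that linear time is affordable.\<close>

definition times_step :: com where
  "times_step = (Vr :== Var Vr \<oplus> Var Vw;; Vg :== Var Vg \<ominus> Num 1)"

definition times_loop :: com where
  "times_loop = While_neg (Num 0 \<ominus> Var Vg) times_step"

definition times_loop_cost :: "nat \<Rightarrow> nat" where
  "times_loop_cost w = loop_cost (Num 0 \<ominus> Var Vg) (cost times_step) w"

lemma times_loop:
  assumes "i \<le> w"
  shows "hoare L times_loop (\<sigma>(Vr := 0, Vg := int i), h) (times_loop_cost w)
    (\<lambda>s. s = (\<sigma>(Vr := int i * \<sigma> Vw, Vg := 0), h))"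
proof -
  let ?I = "\<lambda>j s. s = (\<sigma>(Vr := int j * \<sigma> Vw, Vg := int i - int j), h)"
  have "hoare L times_loop (\<sigma>(Vr := 0, Vg := int i), h)
    (loop_cost (Num 0 \<ominus> Var Vg) (cost times_step) (i - 0)) (?I i)"
    unfolding times_loop_def
  proof (rule hoare_while[where Inv = ?I])
    fix j s assume j: "j < i" "?I j s"
    have "wp L times_step (?I (Suc j)) s"
      unfolding times_step_def using j by (auto simp: fun_eq_iff algebra_simps)
    from hoare_wp[OF this] show "safe L (Num 0 \<ominus> Var Vg) s \<and> eval (Num 0 \<ominus> Var Vg) s < 0 \<and>
        hoare L times_step s
          (cost times_step) (?I (Suc j))"
      using j by (intro conjI) simp_all
  qed auto
  then show ?thesis
  proof (rule hoare_weaken)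
    show "loop_cost (Num 0 \<ominus> Var Vg) (cost times_step) (i - 0) \<le> times_loop_cost w"
      unfolding times_loop_cost_def using assms by (intro loop_cost_mono) simp
  qed simp
qed

text \<open>In the table an entry \<open>0\<close> of \<open>Fit\<close> stands for possible, so that the initial contents of the memory
mean that everything fits everywhere. First the row of the end vertex is restricted to the end vertex itself.\<close>

definition t_row_body :: com where
  "t_row_body = (If_zero (Var Vj \<ominus> Var Vt) Skip (Put Fit (Var Vr \<oplus> Var Vj) (Num 1));; Vj :== Var Vj \<oplus> Num 1)"

definition t_row_code :: com where
  "t_row_code = ((Vr :== Num 0;; Vg :== Var Vt);; times_loop;; Vj :== Num 1;;
     While_neg (Var Vj \<ominus> Var Vw) t_row_body;; Vi :== Var Vw \<ominus> Num 1)"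

text \<open>Edge \<open>i\<close> marks every vertex \<open>z\<close> with a partner for edge \<open>i\<close>. The mark is the number \<open>i\<close> itself, so that
marks need not be erased between the rounds.\<close>

definition mark_body :: com where
  "mark_body =
    (If_zero (Get Lab (Var Vj) \<ominus> Get Lab (Var Vi))
       (If_zero (Get Fit (Var Vr \<oplus> Get End (Var Vj \<oplus> Var Vj \<oplus> Var Vb)))
          (Put Mark (Get End (Var Vj \<oplus> Var Vj \<oplus> Num 1 \<ominus> Var Vb)) (Var Vi)) Skip) Skip;;
     Vj :== Var Vj \<oplus> Num 1)"

text \<open>The parent of \<open>i\<close> does not fit at unmarked vertices.\<close>

definition prune_row_body :: com where
  "prune_row_body =
    (If_zero (Get Mark (Var Vj) \<ominus> Var Vi) Skip (Put Fit (Var Vr \<oplus> Var Vj) (Num 1));;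
     Vj :== Var Vj \<oplus> Num 1)"

definition child_prepare :: com where
  "child_prepare = (Vb :== Get Dir (Var Vi);; Vr :== Num 0;; Vg :== Var Vi)"

definition parent_prepare :: com where
  "parent_prepare = (Vp :== Get End (Var Vi \<oplus> Var Vi \<oplus> Num 1 \<ominus> Var Vb);; Vr :== Num 0;; Vg :== Var Vp)"

definition fit_body :: com where
  "fit_body =
    (child_prepare;; times_loop;;
     Vj :== Num 2;; While_neg (Var Vj \<ominus> Var Vw) mark_body;;
     parent_prepare;; times_loop;;
     Vj :== Num 1;; While_neg (Var Vj \<ominus> Var Vw) prune_row_body;;
     Vi :== Var Vi \<ominus> Num 1)"

definition fit_code :: com where
  "fit_code = (t_row_code;; While_neg (Num 1 \<ominus> Var Vi) fit_body)"

definition fit_body_cost :: "nat \<Rightarrow> nat" where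
  "fit_body_cost n = cost child_prepare + (times_loop_cost (Suc (Suc n)) +
    (cost (Vj :== Num 2) + (loop_cost (Var Vj \<ominus> Var Vw) (cost mark_body) (Suc (Suc n)) +
    (cost parent_prepare +
    (times_loop_cost (Suc (Suc n)) + (cost (Vj :== Num 1) +
    (loop_cost (Var Vj \<ominus> Var Vw) (cost prune_row_body) (Suc (Suc n)) +
    cost (Vi :== Var Vi \<ominus> Num 1))))))))"

definition t_row_cost :: "nat \<Rightarrow> nat" where
  "t_row_cost n = cost (Vr :== Num 0;; Vg :== Var Vt) + (times_loop_cost (Suc (Suc n)) + (cost (Vj :== Num 1) +
      (loop_cost (Var Vj \<ominus> Var Vw) (cost t_row_body) (Suc (Suc n)) +
        cost (Vi :== Var Vw \<ominus> Num 1))))"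

locale numbered_run = pruning_run \<Sigma> code s0 t0 es
  for \<Sigma> :: "'l set" and code s0 t0 es +
  fixes vt ge en dir t
  assumes num: "numbering (tree_of (s0, t0, es)) (Suc (length es)) vt ge en dir"
    and t: "t \<in> {1..Suc (length es)}" "vt t = t0"
begin

abbreviation "m \<equiv> Suc n"

sublocale tn: tree_numbering \<Sigma> T m vt ge en dir
  using tree num by unfold_locales

sublocale nt: numbered_tree m "\<lambda>i. label T (ge i)" en dir t
  using tn.child tn.parent t by unfold_locales

text \<open>Row-major order; a row has \<open>n + 2\<close> cells, one more than the largest number of a vertex.\<close>

definition fit_at :: "nat \<Rightarrow> nat \<Rightarrow> int" where
  "fit_at i z = int i * (int n + 2) + int z"

lemma fit_at_inj: "z \<le> m \<Longrightarrow> z' \<le> m \<Longrightarrow> fit_at i z = fit_at i' z' \<longleftrightarrow> i = i' \<and> z = z'"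
proof
  assume z: "z \<le> m" "z' \<le> m" and eq: "fit_at i z = fit_at i' z'"
  have "int (i * (n + 2) + z) = int (i' * (n + 2) + z')" using eq by (simp add: fit_at_def algebra_simps)
  then have eq: "z + i * (n + 2) = z' + i' * (n + 2)" by (simp only: of_nat_eq_iff add.commute)
  have div: "(y + k * w) div w = k" if "y < w" for y k w :: nat using that by simp
  have "i = i'" using arg_cong[OF eq, of "\<lambda>x. x div (n + 2)"] div[of z "n + 2" i] div[of z' "n + 2" i'] z
    by (simp only: Suc_le_lessD le_imp_less_Suc add_2_eq_Suc')
  then show "i = i' \<and> z = z'" using eq by simp
qed simp

definition ready :: "(var \<Rightarrow> int) \<Rightarrow> (arr \<Rightarrow> int \<Rightarrow> int) \<Rightarrow> bool" where
  "ready \<sigma> h \<longleftrightarrow> \<sigma> Vw = int n + 2 \<and> \<sigma> Vt = int t \<and> tables m vt ge en dir h"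

lemma ready_simps [simp]:
  "x \<notin> {Vw, Vt} \<Longrightarrow> ready (\<sigma>(x := z)) h \<longleftrightarrow> ready \<sigma> h"
  "a \<notin> {Lab, End, Dir} \<Longrightarrow> ready \<sigma> (h(a := f)) \<longleftrightarrow> ready \<sigma> h"
  by (auto simp: ready_def tables_def)

lemma read_end:
  assumes "tables m vt ge en dir h" "i \<in> {2..m}"
  shows "h End (int i + int i + of_bool b) = int (en b i)"
    "h End (int i + int i + 1 - of_bool b) = int (en (\<not> b) i)"
proof -
  have "int i + int i + 1 - of_bool b = 2 * int i + of_bool (\<not> b)"
    "int i + int i + of_bool b = 2 * int i + of_bool b" by (cases b; simp)+
  then show "h End (int i + int i + of_bool b) = int (en b i)"
    "h End (int i + int i + 1 - of_bool b) = int (en (\<not> b) i)"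
    using assms unfolding tables_def by metis+
qed

lemma read_label:
  assumes "tables m vt ge en dir h" "i \<in> {2..m}" "j \<in> {2..m}"
  shows "h Lab (int i) = h Lab (int j) \<longleftrightarrow> label T (ge i) = label T (ge j)"
proof -
  have "label T (ge x) \<in> \<Sigma>" if "x \<in> {2..m}" for x
    using tree tn.arc[OF that] unfolding sigma_tree_def by blast
  then show ?thesis using assms inj_onD[OF code_inj] unfolding tables_def by force
qed

definition fit_table :: "(nat \<Rightarrow> nat \<Rightarrow> bool) \<Rightarrow> (arr \<Rightarrow> int \<Rightarrow> int) \<Rightarrow> bool" where
  "fit_table F h \<longleftrightarrow> (\<forall>i \<in> {1..m}. \<forall>z \<in> {1..m}. h Fit (fit_at i z) = 0 \<longleftrightarrow> F i z)"

text \<open>Since the edges are treated in decreasing order, old marks are larger than \<open>i\<close>.\<close>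

definition mark_table :: "nat \<Rightarrow> (nat \<Rightarrow> bool) \<Rightarrow> (arr \<Rightarrow> int \<Rightarrow> int) \<Rightarrow> bool" where
  "mark_table i M h \<longleftrightarrow> (\<forall>z \<in> {1..m}. (h Mark (int z) = 0 \<or> int i \<le> h Mark (int z)) \<and>
     (h Mark (int z) = int i \<longleftrightarrow> M z))"

lemma table_simps [simp]:
  "a \<noteq> Fit \<Longrightarrow> fit_table F (h(a := f)) \<longleftrightarrow> fit_table F h"
  "a \<noteq> Mark \<Longrightarrow> mark_table i M (h(a := f)) \<longleftrightarrow> mark_table i M h"
  by (auto simp: fit_table_def mark_table_def)

lemma fit_table_put:
  assumes "fit_table F h" "z \<in> {1..m}"
    and "\<And>k y. k \<in> {1..m} \<Longrightarrow> y \<in> {1..m} \<Longrightarrow> F' k y \<longleftrightarrow> F k y \<and> \<not> (k = i \<and> y = z)"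
  shows "fit_table F' (h(Fit := (h Fit)(fit_at i z := 1)))"
  using assms fit_at_inj unfolding fit_table_def by auto

lemma fit_table_cong:
  assumes "fit_table F h" "\<And>k y. k \<in> {1..m} \<Longrightarrow> y \<in> {1..m} \<Longrightarrow> F' k y \<longleftrightarrow> F k y"
  shows "fit_table F' h"
  using assms unfolding fit_table_def by auto

lemma mark_table_put:
  assumes "mark_table i M h" "z \<in> {1..m}" "\<And>y. M' y \<longleftrightarrow> M y \<or> y = z"
  shows "mark_table i M' (h(Mark := (h Mark)(int z := int i)))"
  using assms unfolding mark_table_def by auto

lemma mark_table_cong:
  assumes "mark_table i M h" "\<And>y. M' y \<longleftrightarrow> M y"
  shows "mark_table i M' h"
  using assms unfolding mark_table_def by auto

text \<open>The contents of the table after the edges above \<open>i\<close> have been treated.\<close>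

definition fits_from :: "nat \<Rightarrow> nat \<Rightarrow> nat \<Rightarrow> bool" where
  "fits_from i k z \<longleftrightarrow> (k = t \<longrightarrow> z = t) \<and>
     (\<forall>j \<in> {2..m}. i < j \<longrightarrow> nt.par j = k \<longrightarrow> (\<exists>z'. nt.link j z z' \<and> nt.fits j z'))"

lemma fits_from_top: "fits_from m k z \<longleftrightarrow> (k = t \<longrightarrow> z = t)"
  by (auto simp: fits_from_def)

text \<open>The row of \<open>k\<close> is final as soon as the edges above \<open>k\<close> have been treated, because the children of \<open>k\<close> have larger numbers.\<close>

lemma fits_from_self:
  assumes "i \<le> k" "z \<in> {1..m}" shows "fits_from i k z \<longleftrightarrow> nt.fits k z"
proof -
  have "i < j" if "j \<in> {2..m}" "nt.par j = k" for j using nt.par_less[OF that(1)] that(2) assms(1) by auto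
  then show ?thesis using assms(2) unfolding fits_from_def nt.fits.simps[of k] by blast
qed

lemma fits_from_step:
  assumes "i \<in> {2..m}"
  shows "fits_from (i - 1) k z \<longleftrightarrow> fits_from i k z \<and>
    (k = nt.par i \<longrightarrow> (\<exists>z'. nt.link i z z' \<and> nt.fits i z'))"
proof -
  have "i - 1 < j \<longleftrightarrow> i < j \<or> j = i" for j using assms by auto
  then show ?thesis using assms unfolding fits_from_def by blast
qed

lemma t_row:
  assumes r: "ready \<sigma> h" and b: "blank h"
  shows "hoare L t_row_code (\<sigma>, h) (t_row_cost n)
    (\<lambda>(\<sigma>', h'). ready \<sigma>' h' \<and> \<sigma>' Vi = int m \<and> fit_table (fits_from m) h' \<and>
       mark_table (Suc m) (\<lambda>_. False) h' \<and> h' Dead = h Dead)"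
proof -
  let ?I = "\<lambda>j (\<sigma>', h'). ready \<sigma>' h' \<and> \<sigma>' Vj = int j \<and> \<sigma>' Vr = int t * (int n + 2) \<and>
    fit_table (\<lambda>k z. k = t \<and> z < j \<longrightarrow> z = t) h' \<and> mark_table (Suc m) (\<lambda>_. False) h' \<and> h' Dead = h Dead"
  have w: "\<sigma> Vw = int n + 2" "\<sigma> Vt = int t" using r by (auto simp: ready_def)
  have start: "?I 1 (\<sigma>(Vr := int t * \<sigma> Vw, Vg := 0, Vj := 1), h)"
    using r b w by (auto simp: fit_table_def mark_table_def blank_def)
  have body: "wp L t_row_body (?I (Suc j)) s" if j: "1 \<le> j" "j < Suc m" and I: "?I j s" for j s
  proof -
    obtain \<sigma>' h' where s: "s = (\<sigma>', h')" by (cases s)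
    have I: "ready \<sigma>' h'" "\<sigma>' Vj = int j" "\<sigma>' Vr = int t * (int n + 2)"
      "fit_table (\<lambda>k z. k = t \<and> z < j \<longrightarrow> z = t) h'" "mark_table (Suc m) (\<lambda>_. False) h'" "h' Dead = h Dead"
      using I s by auto
    have vt: "\<sigma>' Vt = int t" using I by (simp add: ready_def)
    show ?thesis
    proof (cases "j = t")
      case True
      then have "fit_table (\<lambda>k z. k = t \<and> z < Suc j \<longrightarrow> z = t) h'"
        by (intro fit_table_cong[OF I(4)]) auto
      then show ?thesis using I s vt True unfolding t_row_body_def by simp
    next
      case False
      have "fit_table (\<lambda>k z. k = t \<and> z < Suc j \<longrightarrow> z = t) (h'(Fit := (h' Fit)(fit_at t j := 1)))"
        using False j by (intro fit_table_put[OF I(4)]) auto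
      then show ?thesis using I s vt False unfolding t_row_body_def
        by (simp add: valid_def fit_at_def)
    qed
  qed
  show ?thesis
    unfolding t_row_code_def t_row_cost_def
  proof (rule hoare_seq[OF hoare_wp[of L "Vr :== Num 0;; Vg :== Var Vt" "\<lambda>s. s = (\<sigma>(Vr := 0, Vg := int t), h)"]],
      goal_cases)
    case (2 s1)
    show ?case unfolding 2
    proof (rule hoare_seq[OF times_loop], goal_cases)
      case (2 s2)
      show ?case unfolding 2
      proof (rule hoare_seq[OF hoare_wp[of L _ "?I 1"]], goal_cases)
        case (2 s3)
        show ?case
        proof (rule hoare_seq[OF hoare_for[where Inv = ?I and lo = 1 and hi = "Suc m"]])
          show "?I 1 s3" by (rule 2)
          show "wp L t_row_body (?I (Suc j)) s" if "1 \<le> j" "j < Suc m" "?I j s" for j s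
            by (rule body[OF that])
          show "fst s Vj = int j \<and> fst s Vw = int (Suc m)" if "?I j s" for j s
            using that by (cases s) (simp add: ready_def)
        next
          fix s4 assume "?I (Suc m) s4"
          then have "ready (fst s4) (snd s4)" "fit_table (fits_from m) (snd s4)"
            "mark_table (Suc m) (\<lambda>_. False) (snd s4)" "snd s4 Dead = h Dead"
            by (auto intro: fit_table_cong simp: fits_from_top)
          then show "hoare L (Vi :== Var Vw \<ominus> Num 1) s4 (cost (Vi :== Var Vw \<ominus> Num 1))
            (\<lambda>(\<sigma>', h'). ready \<sigma>' h' \<and> \<sigma>' Vi = int m \<and> fit_table (fits_from m) h' \<and>
               mark_table (Suc m) (\<lambda>_. False) h' \<and> h' Dead = h Dead)"
            by (intro hoare_wp) (cases s4, simp, simp add: ready_def)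
        qed simp
      qed (use start in simp)
    qed (use t in simp)
  qed (use w in simp)
qed

lemma mark_row:
  assumes i: "i \<in> {2..m}" and r: "ready \<sigma> h" "\<sigma> Vi = int i" "\<sigma> Vb = of_bool (dir i)"
    "\<sigma> Vr = int i * (int n + 2)" "\<sigma> Vj = 2"
    and h: "fit_table (fits_from i) h" "mark_table i (\<lambda>_. False) h"
  shows "hoare L (While_neg (Var Vj \<ominus> Var Vw) mark_body) (\<sigma>, h)
    (loop_cost (Var Vj \<ominus> Var Vw) (cost mark_body) (Suc m))
    (\<lambda>(\<sigma>', h'). ready \<sigma>' h' \<and> \<sigma>' Vi = int i \<and> \<sigma>' Vb = of_bool (dir i) \<and>
       fit_table (fits_from i) h' \<and> mark_table i (\<lambda>z. \<exists>z'. nt.link i z z' \<and> nt.fits i z') h' \<and> h' Dead = h Dead)"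
proof -
  let ?M = "\<lambda>j z. \<exists>f \<in> {2..<j}. label T (ge f) = label T (ge i) \<and> en (\<not> dir i) f = z \<and> nt.fits i (en (dir i) f)"
  let ?I = "\<lambda>j (\<sigma>', h'). ready \<sigma>' h' \<and> \<sigma>' Vi = int i \<and> \<sigma>' Vb = of_bool (dir i) \<and>
    \<sigma>' Vr = int i * (int n + 2) \<and> \<sigma>' Vj = int j \<and> fit_table (fits_from i) h' \<and> mark_table i (?M j) h' \<and>
    h' Dead = h Dead"
  have body: "wp L mark_body (?I (Suc j)) s" if j: "2 \<le> j" "j < Suc m" and I: "?I j s" for j s
  proof -
    obtain \<sigma>' h' where s: "s = (\<sigma>', h')" by (cases s)
    have I: "ready \<sigma>' h'" "\<sigma>' Vi = int i" "\<sigma>' Vb = of_bool (dir i)"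
      "\<sigma>' Vr = int i * (int n + 2)" "\<sigma>' Vj = int j" "fit_table (fits_from i) h'" "mark_table i (?M j) h'"
      "h' Dead = h Dead"
      using I s by auto
    have jm: "j \<in> {2..m}" using j by auto
    have tab: "tables m vt ge en dir h'" using I(1) by (simp add: ready_def)
    define x where "x = en (dir i) j"
    define y where "y = en (\<not> dir i) j"
    have xy: "x \<in> {1..m}" "y \<in> {1..m}" unfolding x_def y_def using tn.en_range[OF jm] jm by fastforce+
    have rd: "h' End (\<sigma>' Vj + \<sigma>' Vj + \<sigma>' Vb) = int x" "h' End (\<sigma>' Vj + \<sigma>' Vj + 1 - \<sigma>' Vb) = int y"
      using read_end[OF tab jm, of "dir i"] unfolding I x_def y_def by simp_all
    have fit: "h' Fit (\<sigma>' Vr + int x) = 0 \<longleftrightarrow> nt.fits i x"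
      using I(6) xy(1) i fits_from_self[of i i x] unfolding fit_table_def fit_at_def I by auto
    have lab: "h' Lab (\<sigma>' Vj) - h' Lab (\<sigma>' Vi) = 0 \<longleftrightarrow> label T (ge j) = label T (ge i)"
      using read_label[OF tab jm i] unfolding I by simp
    have val: "0 \<le> \<sigma>' Vj" "0 \<le> \<sigma>' Vi" "0 \<le> \<sigma>' Vb" "0 \<le> \<sigma>' Vr" "\<sigma>' Vb \<le> 1" using I j by auto
    have Mj: "?M (Suc j) z \<longleftrightarrow> ?M j z \<or> label T (ge j) = label T (ge i) \<and> y = z \<and> nt.fits i x" for z
      using j unfolding x_def y_def by (auto simp: less_Suc_eq)
    show ?thesis
    proof (cases "label T (ge j) = label T (ge i) \<and> nt.fits i x")
      case True
      have "mark_table i (?M (Suc j)) (h'(Mark := (h' Mark)(int y := int i)))"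
        using mark_table_put[OF I(7) xy(2), of "?M (Suc j)"] Mj True by blast
      then show ?thesis
        using True lab fit rd val I s j unfolding mark_body_def by (simp add: valid_def)
    next
      case False
      then have "mark_table i (?M (Suc j)) h'" using Mj by (intro mark_table_cong[OF I(7)]) blast
      then show ?thesis
        using False lab fit rd val I s j unfolding mark_body_def by (auto simp: valid_def)
    qed
  qed
  have "hoare L (While_neg (Var Vj \<ominus> Var Vw) mark_body) (\<sigma>, h)
    (loop_cost (Var Vj \<ominus> Var Vw) (cost mark_body) (Suc m)) (?I (Suc m))"
  proof (rule hoare_for[where Inv = ?I and lo = 2 and hi = "Suc m"])
    show "?I 2 (\<sigma>, h)" using r h by simp
    show "wp L mark_body (?I (Suc j)) s" if "2 \<le> j" "j < Suc m" "?I j s" for j s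
      by (rule body[OF that])
    show "fst s Vj = int j \<and> fst s Vw = int (Suc m)" if "?I j s" for j s
      using that by (cases s) (simp add: ready_def)
    show "2 \<le> Suc m" using i by simp
  qed
  moreover have "?M (Suc m) z \<longleftrightarrow> (\<exists>z'. nt.link i z z' \<and> nt.fits i z')" for z
    unfolding nt.link_def using atLeastLessThanSuc_atLeastAtMost[of 2 m] by simp blast
  ultimately show ?thesis
    by (elim hoare_weaken) (auto intro: mark_table_cong)
qed

lemma prune_row:
  assumes i: "i \<in> {2..m}" and r: "ready \<sigma> h" "\<sigma> Vi = int i"
    "\<sigma> Vr = int (nt.par i) * (int n + 2)" "\<sigma> Vj = 1"
    and h: "fit_table (fits_from i) h" "mark_table i (\<lambda>z. \<exists>z'. nt.link i z z' \<and> nt.fits i z') h"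
  shows "hoare L (While_neg (Var Vj \<ominus> Var Vw) prune_row_body) (\<sigma>, h)
    (loop_cost (Var Vj \<ominus> Var Vw) (cost prune_row_body) (Suc m))
    (\<lambda>(\<sigma>', h'). ready \<sigma>' h' \<and> \<sigma>' Vi = int i \<and>
       fit_table (fits_from (i - 1)) h' \<and> mark_table (i - 1) (\<lambda>_. False) h' \<and> h' Dead = h Dead)"
proof -
  let ?M = "\<lambda>z. \<exists>z'. nt.link i z z' \<and> nt.fits i z'"
  let ?F = "\<lambda>j k z. fits_from i k z \<and> (k = nt.par i \<and> z < j \<longrightarrow> ?M z)"
  let ?I = "\<lambda>j (\<sigma>', h'). ready \<sigma>' h' \<and> \<sigma>' Vi = int i \<and>
    \<sigma>' Vr = int (nt.par i) * (int n + 2) \<and> \<sigma>' Vj = int j \<and> fit_table (?F j) h' \<and> mark_table i ?M h' \<and>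
    h' Dead = h Dead"
  have body: "wp L prune_row_body (?I (Suc j)) s" if j: "1 \<le> j" "j < Suc m" and I: "?I j s" for j s
  proof -
    obtain \<sigma>' h' where s: "s = (\<sigma>', h')" by (cases s)
    have I: "ready \<sigma>' h'" "\<sigma>' Vi = int i" "\<sigma>' Vr = int (nt.par i) * (int n + 2)" "\<sigma>' Vj = int j"
      "fit_table (?F j) h'" "mark_table i ?M h'" "h' Dead = h Dead"
      using I s by auto
    have jm: "j \<in> {1..m}" using j by auto
    have mark: "h' Mark (\<sigma>' Vj) - \<sigma>' Vi = 0 \<longleftrightarrow> ?M j"
      using I(6) jm unfolding mark_table_def I by auto
    have val: "valid L Mark (\<sigma>' Vj)" "valid L Fit (\<sigma>' Vr + \<sigma>' Vj)" using I by (auto simp: valid_def)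
    show ?thesis
    proof (cases "?M j")
      case True
      then have "fit_table (?F (Suc j)) h'"
        by (intro fit_table_cong[OF I(5)]) (auto simp: less_Suc_eq)
      then show ?thesis using True mark val I s unfolding prune_row_body_def by simp
    next
      case False
      have "fit_table (?F (Suc j)) (h'(Fit := (h' Fit)(fit_at (nt.par i) j := 1)))"
        using False by (intro fit_table_put[OF I(5) jm]) (auto simp: less_Suc_eq)
      then have "fit_table (?F (Suc j)) (h'(Fit := (h' Fit)(\<sigma>' Vr + \<sigma>' Vj := 1)))"
        unfolding fit_at_def I .
      moreover have "h' Mark (\<sigma>' Vj) - \<sigma>' Vi \<noteq> 0" using False mark by blast
      ultimately show ?thesis using val I(1,2,4,6,7) s unfolding prune_row_body_def
        by (simp add: I(3)[symmetric])
    qed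
  qed
  have "hoare L (While_neg (Var Vj \<ominus> Var Vw) prune_row_body) (\<sigma>, h)
    (loop_cost (Var Vj \<ominus> Var Vw) (cost prune_row_body) (Suc m)) (?I (Suc m))"
  proof (rule hoare_for[where Inv = ?I and lo = 1 and hi = "Suc m"])
    have "fit_table (?F 1) h" by (rule fit_table_cong[OF h(1)]) auto
    then show "?I 1 (\<sigma>, h)" using r h by simp
    show "wp L prune_row_body (?I (Suc j)) s" if "1 \<le> j" "j < Suc m" "?I j s" for j s
      by (rule body[OF that])
    show "fst s Vj = int j \<and> fst s Vw = int (Suc m)" if "?I j s" for j s
      using that by (cases s) (simp add: ready_def)
  qed simp
  then show ?thesis
  proof (rule hoare_weaken)
    fix s assume "?I (Suc m) s"
    then obtain \<sigma>' h' where I: "s = (\<sigma>', h')" "ready \<sigma>' h'" "\<sigma>' Vi = int i"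
      "fit_table (?F (Suc m)) h'" "mark_table i ?M h'" "h' Dead = h Dead" by (cases s) auto
    have "fit_table (fits_from (i - 1)) h'"
      by (rule fit_table_cong[OF I(4)]) (use fits_from_step[OF i] in auto)
    moreover have "mark_table (i - 1) (\<lambda>_. False) h'"
      using I(5) i unfolding mark_table_def by force
    ultimately show "case s of (\<sigma>', h') \<Rightarrow> ready \<sigma>' h' \<and> \<sigma>' Vi = int i \<and>
       fit_table (fits_from (i - 1)) h' \<and> mark_table (i - 1) (\<lambda>_. False) h' \<and> h' Dead = h Dead"
      using I by simp
  qed simp
qed

lemma fit_body:
  assumes i: "i \<in> {2..m}" and r: "ready \<sigma> h" "\<sigma> Vi = int i"
    and h: "fit_table (fits_from i) h" "mark_table i (\<lambda>_. False) h"
  shows "hoare L fit_body (\<sigma>, h) (fit_body_cost n)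
    (\<lambda>(\<sigma>', h'). ready \<sigma>' h' \<and> \<sigma>' Vi = int i - 1 \<and>
       fit_table (fits_from (i - 1)) h' \<and> mark_table (i - 1) (\<lambda>_. False) h' \<and> h' Dead = h Dead)"
proof -
  have w: "\<sigma> Vw = int n + 2" and tab: "tables m vt ge en dir h" using r by (auto simp: ready_def)
  have d: "h Dir (int i) = of_bool (dir i)" using tab i by (simp add: tables_def)
  let ?\<sigma> = "\<sigma>(Vb := of_bool (dir i))"
  have 1: "wp L child_prepare
      (\<lambda>s. s = (?\<sigma>(Vr := 0, Vg := int i), h)) (\<sigma>, h)"
    using r d by (simp add: child_prepare_def valid_def)
  have 2: "hoare L times_loop (?\<sigma>(Vr := 0, Vg := int i), h) (times_loop_cost (Suc m))
      (\<lambda>s. s = (?\<sigma>(Vr := int i * (int n + 2), Vg := 0), h))"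
    using times_loop[of i "Suc m" L ?\<sigma> h] i w by simp
  have 3: "wp L (Vj :== Num 2) (\<lambda>s. s = (?\<sigma>(Vr := int i * (int n + 2), Vg := 0, Vj := 2), h))
      (?\<sigma>(Vr := int i * (int n + 2), Vg := 0), h)" by simp
  note 4 = mark_row[OF i, of "?\<sigma>(Vr := int i * (int n + 2), Vg := 0, Vj := 2)" h]
  show ?thesis
    unfolding fit_body_def fit_body_cost_def
  proof (rule hoare_seq[OF hoare_wp[OF 1]], elim ssubst, rule hoare_seq[OF 2], elim ssubst,
      rule hoare_seq[OF hoare_wp[OF 3]], elim ssubst, rule hoare_seq[OF 4])
    fix s
    assume "case s of (\<sigma>', h') \<Rightarrow> ready \<sigma>' h' \<and> \<sigma>' Vi = int i \<and> \<sigma>' Vb = of_bool (dir i) \<and>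
       fit_table (fits_from i) h' \<and> mark_table i (\<lambda>z. \<exists>z'. nt.link i z z' \<and> nt.fits i z') h' \<and> h' Dead = h Dead"
    then obtain \<sigma>' h' where s: "s = (\<sigma>', h')" and I: "ready \<sigma>' h'" "\<sigma>' Vi = int i" "\<sigma>' Vb = of_bool (dir i)"
       "fit_table (fits_from i) h'" "mark_table i (\<lambda>z. \<exists>z'. nt.link i z z' \<and> nt.fits i z') h'"
       "h' Dead = h Dead" by (cases s) auto
    have w': "\<sigma>' Vw = int n + 2" and tab': "tables m vt ge en dir h'" using I by (auto simp: ready_def)
    have p: "h' End (\<sigma>' Vi + \<sigma>' Vi + 1 - \<sigma>' Vb) = int (nt.par i)"
      using read_end(2)[OF tab' i, of "dir i"] unfolding I nt.par_def by simp
    have pm: "nt.par i \<le> Suc m" using nt.par_less[OF i] i by auto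
    let ?\<sigma>' = "\<sigma>'(Vp := int (nt.par i))"
    have 5: "wp L parent_prepare
        (\<lambda>s. s = (?\<sigma>'(Vr := 0, Vg := int (nt.par i)), h')) s"
      using I p s by (simp add: parent_prepare_def valid_def)
    have 6: "hoare L times_loop (?\<sigma>'(Vr := 0, Vg := int (nt.par i)), h') (times_loop_cost (Suc m))
        (\<lambda>s. s = (?\<sigma>'(Vr := int (nt.par i) * (int n + 2), Vg := 0), h'))"
      using times_loop[OF pm, of L ?\<sigma>' h'] w' by simp
    have 7: "wp L (Vj :== Num 1) (\<lambda>s. s = (?\<sigma>'(Vr := int (nt.par i) * (int n + 2), Vg := 0, Vj := 1), h'))
      (?\<sigma>'(Vr := int (nt.par i) * (int n + 2), Vg := 0), h')" by simp
    note 8 = prune_row[OF i, of "?\<sigma>'(Vr := int (nt.par i) * (int n + 2), Vg := 0, Vj := 1)" h']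
    show "hoare L
      (parent_prepare;; times_loop;;
       Vj :== Num 1;; While_neg (Var Vj \<ominus> Var Vw) prune_row_body;; Vi :== Var Vi \<ominus> Num 1) s
      (cost parent_prepare +
      (times_loop_cost (Suc m) + (cost (Vj :== Num 1) +
      (loop_cost (Var Vj \<ominus> Var Vw) (cost prune_row_body) (Suc m) +
        cost (Vi :== Var Vi \<ominus> Num 1)))))
      (\<lambda>(\<sigma>', h'). ready \<sigma>' h' \<and> \<sigma>' Vi = int i - 1 \<and>
       fit_table (fits_from (i - 1)) h' \<and> mark_table (i - 1) (\<lambda>_. False) h' \<and> h' Dead = h Dead)"
    proof (rule hoare_seq[OF hoare_wp[OF 5]], elim ssubst, rule hoare_seq[OF 6], elim ssubst,
        rule hoare_seq[OF hoare_wp[OF 7]], elim ssubst, rule hoare_seq[OF 8])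
      fix s assume "case s of (\<sigma>', h'') \<Rightarrow> ready \<sigma>' h'' \<and> \<sigma>' Vi = int i \<and>
       fit_table (fits_from (i - 1)) h'' \<and> mark_table (i - 1) (\<lambda>_. False) h'' \<and> h'' Dead = h' Dead"
      then show "hoare L (Vi :== Var Vi \<ominus> Num 1) s (cost (Vi :== Var Vi \<ominus> Num 1))
        (\<lambda>(\<sigma>', h'). ready \<sigma>' h' \<and> \<sigma>' Vi = int i - 1 \<and>
         fit_table (fits_from (i - 1)) h' \<and> mark_table (i - 1) (\<lambda>_. False) h' \<and> h' Dead = h Dead)"
        using I by (intro hoare_wp) (cases s, simp)
    qed (use I in simp_all)
  qed (use r h in simp_all)
qed

lemma fit_code:
  assumes r: "ready \<sigma> h" and b: "blank h"
  shows "hoare L fit_code (\<sigma>, h)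
    (t_row_cost n + (loop_cost (Num 1 \<ominus> Var Vi) (fit_body_cost n) n))
    (\<lambda>(\<sigma>', h'). ready \<sigma>' h' \<and> fit_table nt.fits h' \<and> h' Dead = h Dead)"
  unfolding fit_code_def
proof (rule hoare_seq[OF t_row[OF r b]])
  fix s assume s: "case s of (\<sigma>', h') \<Rightarrow> ready \<sigma>' h' \<and> \<sigma>' Vi = int m \<and> fit_table (fits_from m) h' \<and>
       mark_table (Suc m) (\<lambda>_. False) h' \<and> h' Dead = h Dead"
  let ?I = "\<lambda>a (\<sigma>', h'). ready \<sigma>' h' \<and> \<sigma>' Vi = int (m - a) \<and> fit_table (fits_from (m - a)) h' \<and>
       mark_table (m - a) (\<lambda>_. False) h' \<and> h' Dead = h Dead"
  have "hoare L (While_neg (Num 1 \<ominus> Var Vi) fit_body) s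
    (loop_cost (Num 1 \<ominus> Var Vi) (fit_body_cost n) (n - 0)) (?I n)"
  proof (rule hoare_while[where Inv = ?I])
    have "mark_table m (\<lambda>_. False) h'" if "mark_table (Suc m) (\<lambda>_. False) h'" for h'
      using that unfolding mark_table_def by force
    then show "?I 0 s" using s by (cases s) auto
    fix a s assume a: "a < n" and I: "?I a s"
    let ?i = "m - a"
    have i: "?i \<in> {2..m}" using a by auto
    obtain \<sigma>' h' where s: "s = (\<sigma>', h')" by (cases s)
    have "int ?i - 1 = int (m - Suc a)" "?i - 1 = m - Suc a" using a by auto
    then have "hoare L fit_body s (fit_body_cost n) (?I (Suc a))"
      using fit_body[OF i, of \<sigma>' h'] I unfolding s by auto
    then show "safe L (Num 1 \<ominus> Var Vi) s \<and> eval (Num 1 \<ominus> Var Vi) s < 0 \<and>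
        hoare L fit_body s (fit_body_cost n) (?I (Suc a))"
      using I a s by auto
  qed auto
  then show "hoare L (While_neg (Num 1 \<ominus> Var Vi) fit_body) s
    (loop_cost (Num 1 \<ominus> Var Vi) (fit_body_cost n) n)
    (\<lambda>(\<sigma>', h'). ready \<sigma>' h' \<and> fit_table nt.fits h' \<and> h' Dead = h Dead)"
  proof (rule hoare_weaken)
    fix s assume "?I n s"
    then show "case s of (\<sigma>', h') \<Rightarrow> ready \<sigma>' h' \<and> fit_table nt.fits h' \<and> h' Dead = h Dead"
      using fit_table_cong[of "fits_from 1" _ nt.fits] fits_from_self[of 1] by (cases s) auto
  qed simp
qed

end

section \<open>Folding and output\<close>

text \<open>Edge \<open>j\<close> is compared with edge \<open>i\<close>. If it is a partner of edge \<open>i\<close> at the same parent and its other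
end \<open>x \<noteq> i\<close> is not dead and a place where \<open>i\<close> fits, then \<open>i\<close> dies.\<close>

definition fold_body :: com where
  "fold_body =
    (If_zero (Get Lab (Var Vj) \<ominus> Get Lab (Var Vi))
      (If_zero (Get End (Var Vj \<oplus> Var Vj \<oplus> Num 1 \<ominus> Var Vb) \<ominus> Var Vp)
        (Vg :== Get End (Var Vj \<oplus> Var Vj \<oplus> Var Vb);;
         If_zero (Var Vg \<ominus> Var Vi) Skip
          (If_zero (Get Dead (Var Vg))
            (If_zero (Get Fit (Var Vr \<oplus> Var Vg)) (Vd :== Num 1) Skip) Skip)) Skip) Skip;;
     Vj :== Var Vj \<oplus> Num 1)"

text \<open>The output overwrites the input area, which is not read any more. Nothing is overtaken, since the
edges are copied from the arrays \<open>Lab\<close> and \<open>End\<close>.\<close>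

definition emit_code :: com where
  "emit_code =
    (Put Dead (Var Vi) (Var Vd);;
     If_zero (Var Vd)
      (Put Raw (Var Vq) (Get Lab (Var Vi));;
       Put Raw (Var Vq \<oplus> Num 1) (Get End (Var Vi \<oplus> Var Vi));;
       Put Raw (Var Vq \<oplus> Num 2) (Get End (Var Vi \<oplus> Var Vi \<oplus> Num 1));;
       Vq :== Var Vq \<oplus> Num 3;; Vk :== Var Vk \<oplus> Num 1) Skip;;
     Vi :== Var Vi \<oplus> Num 1)"

definition kill_prepare :: com where
  "kill_prepare =
    (Vb :== Get Dir (Var Vi);; Vp :== Get End (Var Vi \<oplus> Var Vi \<oplus> Num 1 \<ominus> Var Vb);;
     Vd :== Get Dead (Var Vp);; Vr :== Num 0;; Vg :== Var Vi)"

definition kill_body :: com where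
  "kill_body =
    (kill_prepare;; times_loop;; Vj :== Num 2;; While_neg (Var Vj \<ominus> Var Vw) fold_body;; emit_code)"

definition kill_body_cost :: "nat \<Rightarrow> nat" where
  "kill_body_cost n = cost kill_prepare + (times_loop_cost (Suc (Suc n)) + (cost (Vj :== Num 2) +
    ((loop_cost (Var Vj \<ominus> Var Vw) (cost fold_body) (Suc (Suc n))) +
     cost emit_code)))"

definition header_code :: com where
  "header_code = (Put Raw (Num 0) (Var Vk);; Put Raw (Num 1) (Num 1);; Put Raw (Num 2) (Var Vt))"

definition fold_code :: com where
  "fold_code = ((Vk :== Num 0;; Vq :== Num 3;; Vi :== Num 2);;
     While_neg (Var Vi \<ominus> Var Vw) kill_body;; header_code)"

definition fold_code_cost :: "nat \<Rightarrow> nat" where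
  "fold_code_cost n = cost (Vk :== Num 0;; Vq :== Num 3;; Vi :== Num 2) +
     ((loop_cost (Var Vi \<ominus> Var Vw) (kill_body_cost n) n) +
      cost header_code)"

context numbered_run
begin

definition foldable :: "(nat \<Rightarrow> bool) \<Rightarrow> nat \<Rightarrow> bool" where
  "foldable al w \<longleftrightarrow> (\<exists>x. nt.link w (nt.par w) x \<and> x \<noteq> w \<and> nt.fits w x \<and> al x)"

text \<open>The defining condition of \<open>folded_tree\<close> for the vertices below \<open>w\<close>, all others counting as alive.\<close>

definition folded_upto :: "nat \<Rightarrow> (nat \<Rightarrow> bool) \<Rightarrow> bool" where
  "folded_upto w al \<longleftrightarrow> al 1 \<and> (\<forall>x. w \<le> x \<longrightarrow> al x) \<and>
     (\<forall>x \<in> {2..<w}. al x \<longleftrightarrow> al (nt.par x) \<and>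
       (\<nexists>y. nt.link x (nt.par x) y \<and> y \<noteq> x \<and> nt.fits x y \<and> (y < x \<longrightarrow> al y)))"

text \<open>Deciding \<open>w\<close> does not affect the earlier decisions, which refer to smaller numbers only; and vertices above
\<open>w\<close> are alive at this moment, so the test may use the current state.\<close>

lemma folded_upto_Suc:
  assumes f: "folded_upto w al" and w: "w \<in> {2..m}" and a: "a \<longleftrightarrow> al (nt.par w) \<and> \<not> foldable al w"
  shows "folded_upto (Suc w) (al(w := a))"
  unfolding folded_upto_def
proof (intro conjI allI impI ballI)
  show "(al(w := a)) 1" "\<And>x. Suc w \<le> x \<Longrightarrow> (al(w := a)) x" using f w by (auto simp: folded_upto_def)
  fix x assume x: "x \<in> {2..<Suc w}"
  then have xm: "x \<in> {2..m}" using w by auto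
  have p: "nt.par x < x" using nt.par_less[OF xm] by simp
  show "(al(w := a)) x \<longleftrightarrow> (al(w := a)) (nt.par x) \<and>
       (\<nexists>y. nt.link x (nt.par x) y \<and> y \<noteq> x \<and> nt.fits x y \<and> (y < x \<longrightarrow> (al(w := a)) y))"
  proof (cases "x = w")
    case True
    have "al y" if "\<not> y < w" for y using f that by (simp add: folded_upto_def)
    then have "foldable al w \<longleftrightarrow>
        (\<exists>y. nt.link w (nt.par w) y \<and> y \<noteq> w \<and> nt.fits w y \<and> (y < w \<longrightarrow> (al(w := a)) y))"
      unfolding foldable_def by auto
    then show ?thesis using True a p by auto
  next
    case False
    then have "x \<in> {2..<w}" using x by auto
    then have "al x \<longleftrightarrow> al (nt.par x) \<and>
       (\<nexists>y. nt.link x (nt.par x) y \<and> y \<noteq> x \<and> nt.fits x y \<and> (y < x \<longrightarrow> al y))"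
      using f unfolding folded_upto_def by blast
    moreover have "(y < x \<longrightarrow> (al(w := a)) y) \<longleftrightarrow> (y < x \<longrightarrow> al y)" for y using \<open>x \<in> {2..<w}\<close> by auto
    ultimately show ?thesis using False p \<open>x \<in> {2..<w}\<close> by auto
  qed
qed

definition emitted :: "nat list \<Rightarrow> (arr \<Rightarrow> int \<Rightarrow> int) \<Rightarrow> bool" where
  "emitted xs h \<longleftrightarrow> (\<forall>c < length xs. h Raw (3 + 3 * int c) = int (code (label T (ge (xs ! c)))) \<and>
     h Raw (4 + 3 * int c) = int (en False (xs ! c)) \<and> h Raw (5 + 3 * int c) = int (en True (xs ! c)))"

definition undead :: "(arr \<Rightarrow> int \<Rightarrow> int) \<Rightarrow> nat \<Rightarrow> bool" where
  "undead h x \<longleftrightarrow> h Dead (int x) = 0"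

definition survivors :: "nat \<Rightarrow> (arr \<Rightarrow> int \<Rightarrow> int) \<Rightarrow> nat list" where
  "survivors w h = filter (undead h) [2..<w]"

definition folding_state :: "nat \<Rightarrow> (var \<Rightarrow> int) \<Rightarrow> (arr \<Rightarrow> int \<Rightarrow> int) \<Rightarrow> bool" where
  "folding_state w \<sigma> h \<longleftrightarrow> ready \<sigma> h \<and> fit_table nt.fits h \<and> folded_upto w (undead h) \<and>
     emitted (survivors w h) h \<and> \<sigma> Vk = int (length (survivors w h)) \<and>
     \<sigma> Vq = 3 + 3 * int (length (survivors w h))"

lemma folding_state_simps [simp]:
  "x \<notin> {Vw, Vt, Vk, Vq} \<Longrightarrow> folding_state w (\<sigma>(x := z)) h \<longleftrightarrow> folding_state w \<sigma> h"
  by (auto simp: folding_state_def)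

lemma fold_row:
  assumes i: "i \<in> {2..m}" and st: "folding_state w \<sigma> h" and r: "\<sigma> Vi = int i" "\<sigma> Vb = of_bool (dir i)"
    "\<sigma> Vr = int i * (int n + 2)" "\<sigma> Vj = 2" "\<sigma> Vp = int (nt.par i)"
    and d: "\<sigma> Vd = 0 \<longleftrightarrow> undead h (nt.par i)"
  shows "hoare L (While_neg (Var Vj \<ominus> Var Vw) fold_body) (\<sigma>, h)
    (loop_cost (Var Vj \<ominus> Var Vw) (cost fold_body) (Suc m))
    (\<lambda>(\<sigma>', h'). h' = h \<and> folding_state w \<sigma>' h \<and> \<sigma>' Vi = int i \<and>
       (\<sigma>' Vd = 0 \<longleftrightarrow> undead h (nt.par i) \<and> \<not> foldable (undead h) i))"
proof -
  let ?C = "\<lambda>f. label T (ge f) = label T (ge i) \<and> en (\<not> dir i) f = nt.par i \<and> en (dir i) f \<noteq> i \<and>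
    undead h (en (dir i) f) \<and> nt.fits i (en (dir i) f)"
  let ?I = "\<lambda>j (\<sigma>', h'). h' = h \<and> folding_state w \<sigma>' h \<and> \<sigma>' Vi = int i \<and> \<sigma>' Vb = of_bool (dir i) \<and>
    \<sigma>' Vr = int i * (int n + 2) \<and> \<sigma>' Vj = int j \<and> \<sigma>' Vp = int (nt.par i) \<and>
    (\<sigma>' Vd = 0 \<longleftrightarrow> undead h (nt.par i) \<and> (\<forall>f \<in> {2..<j}. \<not> ?C f))"
  have body: "wp L fold_body (?I (Suc j)) s" if j: "2 \<le> j" "j < Suc m" and I: "?I j s" for j s
  proof -
    obtain \<sigma>' h' where s: "s = (\<sigma>', h')" by (cases s)
    have I: "h' = h" "folding_state w \<sigma>' h" "\<sigma>' Vi = int i" "\<sigma>' Vb = of_bool (dir i)"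
      "\<sigma>' Vr = int i * (int n + 2)" "\<sigma>' Vj = int j" "\<sigma>' Vp = int (nt.par i)"
      "\<sigma>' Vd = 0 \<longleftrightarrow> undead h (nt.par i) \<and> (\<forall>f \<in> {2..<j}. \<not> ?C f)"
      using I s by auto
    have jm: "j \<in> {2..m}" using j by auto
    have tab: "tables m vt ge en dir h" "fit_table nt.fits h"
      using I(2) by (simp_all add: folding_state_def ready_def)
    define x where "x = en (dir i) j"
    define y where "y = en (\<not> dir i) j"
    have x: "x \<in> {1..m}" unfolding x_def using tn.en_range[OF jm] jm by fastforce
    have rd: "h End (2 * \<sigma>' Vj + \<sigma>' Vb) = int x" "h End (2 * \<sigma>' Vj + 1 - \<sigma>' Vb) = int y"
      using read_end[OF tab(1) jm, of "dir i"] unfolding I x_def y_def by simp_all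
    have fit: "h Fit (\<sigma>' Vr + int x) = 0 \<longleftrightarrow> nt.fits i x"
      using tab(2) x i unfolding fit_table_def fit_at_def I by auto
    have lab: "h Lab (\<sigma>' Vj) - h Lab (\<sigma>' Vi) = 0 \<longleftrightarrow> label T (ge j) = label T (ge i)"
      using read_label[OF tab(1) jm i] unfolding I by simp
    have par: "int y - \<sigma>' Vp = 0 \<longleftrightarrow> y = nt.par i" "int x - \<sigma>' Vi = 0 \<longleftrightarrow> x = i" using I by auto
    have dead: "h Dead (int x) = 0 \<longleftrightarrow> undead h x" by (simp add: undead_def)
    have val: "valid L Lab (\<sigma>' Vj)" "valid L Lab (\<sigma>' Vi)" "valid L End (2 * \<sigma>' Vj + \<sigma>' Vb)"
      "valid L End (2 * \<sigma>' Vj + 1 - \<sigma>' Vb)" "valid L Dead (int x)" "valid L Fit (\<sigma>' Vr + int x)"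
      using I j by (auto simp: valid_def)
    have C: "?C j \<longleftrightarrow> label T (ge j) = label T (ge i) \<and> y = nt.par i \<and> x \<noteq> i \<and> undead h x \<and> nt.fits i x"
      by (simp add: x_def y_def)
    have Suc: "(\<forall>f \<in> {2..<Suc j}. \<not> ?C f) \<longleftrightarrow> (\<forall>f \<in> {2..<j}. \<not> ?C f) \<and> \<not> ?C j"
      using j by (auto simp: less_Suc_eq)
    have same: "?I (Suc j) (\<sigma>'(Vj := \<sigma>' Vj + 1), h)" if "\<not> ?C j"
      using I that unfolding Suc by simp
    have same': "?I (Suc j) (\<sigma>'(Vg := int x, Vj := \<sigma>' Vj + 1), h)" if "\<not> ?C j"
      using I that unfolding Suc by simp
    have killed: "?I (Suc j) (\<sigma>'(Vg := int x, Vd := 1, Vj := \<sigma>' Vj + 1), h)" if "?C j"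
      using I that unfolding Suc by simp
    let ?Q = "?I (Suc j)"
    have "wp L fold_body Q (\<sigma>', h)" if
      "\<not> ?C j \<Longrightarrow> Q (\<sigma>'(Vj := \<sigma>' Vj + 1), h)" "\<not> ?C j \<Longrightarrow> Q (\<sigma>'(Vg := int x, Vj := \<sigma>' Vj + 1), h)"
      "?C j \<Longrightarrow> Q (\<sigma>'(Vg := int x, Vd := 1, Vj := \<sigma>' Vj + 1), h)" for Q
      using that unfolding C fold_body_def
      by (auto simp add: rd val lab fit par dead simp del: diff_eq_diff_eq eq_iff_diff_eq_0 right_minus_eq)
    from this[of ?Q, OF same same' killed] show ?thesis unfolding s I(1) .
  qed
  have "hoare L (While_neg (Var Vj \<ominus> Var Vw) fold_body) (\<sigma>, h)
    (loop_cost (Var Vj \<ominus> Var Vw) (cost fold_body) (Suc m)) (?I (Suc m))"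
  proof (rule hoare_for[where Inv = ?I and lo = 2 and hi = "Suc m"])
    show "?I 2 (\<sigma>, h)" using r st d by simp
    show "wp L fold_body (?I (Suc j)) s" if "2 \<le> j" "j < Suc m" "?I j s" for j s
      by (rule body[OF that])
    show "fst s Vj = int j \<and> fst s Vw = int (Suc m)" if "?I j s" for j s
      using that by (cases s) (simp add: folding_state_def ready_def)
    show "2 \<le> Suc m" using i by simp
  qed
  moreover have "(\<forall>f \<in> {2..<Suc m}. \<not> ?C f) \<longleftrightarrow> \<not> foldable (undead h) i"
    unfolding foldable_def nt.link_def using atLeastLessThanSuc_atLeastAtMost[of 2 m]
    by simp blast
  ultimately show ?thesis
    by (elim hoare_weaken) (auto)
qed

lemma emit:
  assumes i: "i \<in> {2..m}" and st: "folding_state i \<sigma> h" and r: "\<sigma> Vi = int i"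
    and d: "\<sigma> Vd = 0 \<longleftrightarrow> undead h (nt.par i) \<and> \<not> foldable (undead h) i"
  shows "wp L emit_code (\<lambda>(\<sigma>', h'). folding_state (Suc i) \<sigma>' h' \<and> \<sigma>' Vi = int (Suc i)) (\<sigma>, h)"
proof -
  let ?h = "h(Dead := (h Dead)(int i := \<sigma> Vd))"
  let ?l = "length (survivors i h)"
  have tab: "tables m vt ge en dir h" using st by (simp add: folding_state_def ready_def)
  have und: "undead ?h = (undead h)(i := (\<sigma> Vd = 0))" by (auto simp: undead_def fun_eq_iff)
  have fold: "folded_upto (Suc i) (undead ?h)"
    unfolding und using st by (intro folded_upto_Suc i d) (simp add: folding_state_def)
  have "filter (undead ?h) [2..<i] = filter (undead h) [2..<i]"
    by (rule filter_cong) (auto simp: und)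
  then have surv: "survivors (Suc i) ?h = survivors i h @ (if \<sigma> Vd = 0 then [i] else [])"
    using i unfolding survivors_def by (simp add: und)
  have len: "?l < n"
  proof -
    have "?l \<le> length [2..<i]" unfolding survivors_def by (rule length_filter_le)
    then show ?thesis using i by auto
  qed
  have q: "\<sigma> Vq = 3 + 3 * int ?l" "\<sigma> Vk = int ?l" "emitted (survivors i h) h" "ready \<sigma> h" "fit_table nt.fits h"
    using st by (simp_all add: folding_state_def)
  show ?thesis
  proof (cases "\<sigma> Vd = 0")
    case False
    then have "folding_state (Suc i) \<sigma> ?h"
      using q fold surv unfolding folding_state_def by (simp add: emitted_def)
    then show ?thesis using False i r unfolding emit_code_def by (simp add: valid_def)
  next
    case True
    let ?g = "?h(Raw := (h Raw)(3 + 3 * int ?l := h Lab (int i), 4 + 3 * int ?l := h End (int i + int i),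
      5 + 3 * int ?l := h End (int i + int i + 1)))"
    have und': "undead ?g = undead ?h" by (simp add: undead_def fun_eq_iff)
    have "survivors (Suc i) ?g = survivors (Suc i) ?h"
      by (simp only: survivors_def[of "Suc i"] und')
    then have surv': "survivors (Suc i) ?g = survivors i h @ [i]" using surv True by simp
    have new: "h Lab (int i) = int (code (label T (ge i)))" "h End (int i + int i) = int (en False i)"
      "h End (int i + int i + 1) = int (en True i)"
      using tab i read_end(1)[OF tab i, of False] read_end(1)[OF tab i, of True]
      by (auto simp: tables_def)
    have off: "3 + 3 * int c \<noteq> 4 + 3 * int e" "3 + 3 * int c \<noteq> 5 + 3 * int e" "4 + 3 * int c \<noteq> 5 + 3 * int e"
      for c e by presburger+
    have "emitted (survivors i h @ [i]) ?g"
      unfolding emitted_def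
    proof (intro allI impI)
      fix c assume c: "c < length (survivors i h @ [i])"
      show "?g Raw (3 + 3 * int c) = int (code (label T (ge ((survivors i h @ [i]) ! c)))) \<and>
        ?g Raw (4 + 3 * int c) = int (en False ((survivors i h @ [i]) ! c)) \<and>
        ?g Raw (5 + 3 * int c) = int (en True ((survivors i h @ [i]) ! c))"
      proof (cases "c = ?l")
        case True
        then show ?thesis using new off by simp
      next
        case False
        then have "c < ?l" using c by simp
        then show ?thesis using q(3) off[of c ?l] off[of ?l c] False
          by (simp add: emitted_def nth_append)
      qed
    qed
    then have "folding_state (Suc i) (\<sigma>(Vq := 3 + 3 * int (Suc ?l), Vk := int (Suc ?l), Vi := int (Suc i))) ?g"
      using q fold unfolding folding_state_def surv' und' by simp
    then show ?thesis
      using True i r q(1,2) len unfolding emit_code_def by (simp add: valid_def algebra_simps)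
  qed
qed

lemma kill_body:
  assumes i: "i \<in> {2..m}" and st: "folding_state i \<sigma> h" and r: "\<sigma> Vi = int i"
  shows "hoare L kill_body (\<sigma>, h) (kill_body_cost n)
    (\<lambda>(\<sigma>', h'). folding_state (Suc i) \<sigma>' h' \<and> \<sigma>' Vi = int (Suc i))"
proof -
  have w: "\<sigma> Vw = int n + 2" and tab: "tables m vt ge en dir h"
    using st by (auto simp: folding_state_def ready_def)
  have d: "h Dir (\<sigma> Vi) = of_bool (dir i)" using tab i r by (simp add: tables_def)
  have p: "h End (\<sigma> Vi + \<sigma> Vi + 1 - of_bool (dir i)) = int (nt.par i)"
    using read_end(2)[OF tab i, of "dir i"] unfolding r nt.par_def by simp
  have val: "valid L Dir (\<sigma> Vi)" "valid L End (\<sigma> Vi + \<sigma> Vi + 1 - of_bool (dir i))" "valid L Dead (int (nt.par i))"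
    using i r by (auto simp: valid_def)
  let ?\<sigma> = "\<sigma>(Vb := of_bool (dir i), Vp := int (nt.par i), Vd := h Dead (int (nt.par i)))"
  have 1: "wp L kill_prepare (\<lambda>s. s = (?\<sigma>(Vr := 0, Vg := int i), h)) (\<sigma>, h)"
    unfolding kill_prepare_def using d p val by (simp add: r)
  have 2: "hoare L times_loop (?\<sigma>(Vr := 0, Vg := int i), h) (times_loop_cost (Suc m))
      (\<lambda>s. s = (?\<sigma>(Vr := int i * (int n + 2), Vg := 0), h))"
    using times_loop[of i "Suc m" L ?\<sigma> h] i w by simp
  have 3: "wp L (Vj :== Num 2) (\<lambda>s. s = (?\<sigma>(Vr := int i * (int n + 2), Vg := 0, Vj := 2), h))
      (?\<sigma>(Vr := int i * (int n + 2), Vg := 0), h)" by simp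
  note 4 = fold_row[OF i, of i "?\<sigma>(Vr := int i * (int n + 2), Vg := 0, Vj := 2)" h]
  show ?thesis
    unfolding kill_body_def kill_body_cost_def
  proof (rule hoare_seq[OF hoare_wp[OF 1]], elim ssubst, rule hoare_seq[OF 2], elim ssubst,
      rule hoare_seq[OF hoare_wp[OF 3]], elim ssubst, rule hoare_seq[OF 4])
    fix s
    assume "case s of (\<sigma>', h') \<Rightarrow> h' = h \<and> folding_state i \<sigma>' h \<and> \<sigma>' Vi = int i \<and>
       (\<sigma>' Vd = 0 \<longleftrightarrow> undead h (nt.par i) \<and> \<not> foldable (undead h) i)"
    then show "hoare L emit_code s (cost emit_code)
        (\<lambda>(\<sigma>', h'). folding_state (Suc i) \<sigma>' h' \<and> \<sigma>' Vi = int (Suc i))"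
      using emit[OF i] by (intro hoare_wp) (cases s, simp)
  qed (use st r in \<open>simp_all add: undead_def\<close>)
qed

lemma fold_code:
  assumes r: "ready \<sigma> h" "fit_table nt.fits h" "h Dead = (\<lambda>_. 0)"
  shows "hoare L fold_code (\<sigma>, h) (fold_code_cost n)
    (\<lambda>(\<sigma>', h'). folded_upto (Suc m) (undead h') \<and> emitted (survivors (Suc m) h') h' \<and>
       h' Raw 0 = int (length (survivors (Suc m) h')) \<and> h' Raw 1 = 1 \<and> h' Raw 2 = int t)"
  unfolding fold_code_def fold_code_cost_def
proof (rule hoare_seq)
  let ?I = "\<lambda>i (\<sigma>', h'). folding_state i \<sigma>' h' \<and> \<sigma>' Vi = int i"
  show "hoare L (Vk :== Num 0;; Vq :== Num 3;; Vi :== Num 2) (\<sigma>, h)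
      (cost (Vk :== Num 0;; Vq :== Num 3;; Vi :== Num 2)) (?I 2)"
    using r by (intro hoare_wp)
      (simp add: folding_state_def emitted_def survivors_def folded_upto_def undead_def)
  fix s assume I: "?I 2 s"
  show "hoare L (While_neg (Var Vi \<ominus> Var Vw) kill_body;; header_code) s
     ((loop_cost (Var Vi \<ominus> Var Vw) (kill_body_cost n) n) +
      cost header_code)
    (\<lambda>(\<sigma>', h'). folded_upto (Suc m) (undead h') \<and> emitted (survivors (Suc m) h') h' \<and>
       h' Raw 0 = int (length (survivors (Suc m) h')) \<and> h' Raw 1 = 1 \<and> h' Raw 2 = int t)"
  proof (rule hoare_seq)
    have "hoare L (While_neg (Var Vi \<ominus> Var Vw) kill_body) s
       (loop_cost (Var Vi \<ominus> Var Vw) (kill_body_cost n) (Suc m - 2))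
       (?I (Suc m))"
    proof (rule hoare_while[where Inv = ?I])
      show "?I 2 s" by (rule I)
      fix i s assume i: "2 \<le> i" "i < Suc m" "?I i s"
      then obtain \<sigma>' h' where s: "s = (\<sigma>', h')" "folding_state i \<sigma>' h'" "\<sigma>' Vi = int i" by (cases s) auto
      have "hoare L kill_body s (kill_body_cost n) (?I (Suc i))"
        unfolding s(1) using i by (intro kill_body s) auto
      then show "safe L (Var Vi \<ominus> Var Vw) s \<and> eval (Var Vi \<ominus> Var Vw) s < 0 \<and>
          hoare L kill_body s (kill_body_cost n) (?I (Suc i))"
        using s i by (simp add: folding_state_def ready_def)
    next
      fix s assume "?I (Suc m) s"
      then show "safe L (Var Vi \<ominus> Var Vw) s \<and> 0 \<le> eval (Var Vi \<ominus> Var Vw) s"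
        by (cases s) (simp add: folding_state_def ready_def)
    qed simp
    then show "hoare L (While_neg (Var Vi \<ominus> Var Vw) kill_body) s
       (loop_cost (Var Vi \<ominus> Var Vw) (kill_body_cost n) n) (?I (Suc m))"
      by simp
    fix s assume "?I (Suc m) s"
    then obtain \<sigma>' h' where s: "s = (\<sigma>', h')" "folding_state (Suc m) \<sigma>' h'" by (cases s) auto
    let ?h = "h'(Raw := (h' Raw)(0 := \<sigma>' Vk, 1 := 1, 2 := \<sigma>' Vt))"
    have u: "undead ?h = undead h'" by (simp add: undead_def fun_eq_iff)
    then have su: "survivors w ?h = survivors w h'" for w by (simp add: survivors_def)
    have "emitted xs ?h \<longleftrightarrow> emitted xs h'" for xs by (simp add: emitted_def)
    then show "hoare L header_code s (cost header_code)
      (\<lambda>(\<sigma>', h'). folded_upto (Suc m) (undead h') \<and> emitted (survivors (Suc m) h') h' \<and>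
       h' Raw 0 = int (length (survivors (Suc m) h')) \<and> h' Raw 1 = 1 \<and> h' Raw 2 = int t)"
      using s u su unfolding header_code_def
      by (intro hoare_wp) (simp add: valid_def folding_state_def ready_def)
  qed
qed

theorem folded_result:
  assumes f: "folded_upto (Suc m) (undead h)" and e: "emitted (survivors (Suc m) h) h"
    and hd: "h Raw 0 = int (length (survivors (Suc m) h))" "h Raw 1 = 1" "h Raw 2 = int t"
  shows "\<exists>R'. tree_size R' \<le> n \<and> (\<forall>i < length (cells code R'). h Raw (int i) = cells code R' ! i) \<and>
    is_pruning \<Sigma> (tree_of R') T"
proof -
  have complete: "vt ` {1..m} = verts G \<and> ge ` {2..m} = arcs G"
  proof -
    \<comment> \<open>A table that describes the given numbering, so that \<open>full_numbering\<close> applies.\<close>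
    define h' where "h' a i = (if a = Lab then int (code (label T (ge (nat i))))
      else if a = Dir then of_bool (dir (nat i)) else int (en (odd i) (nat (i div 2))))" for a i
    have "tables m vt ge en dir h'"
      unfolding tables_def
    proof (intro conjI ballI allI)
      show "numbering T m vt ge en dir" by (rule num)
      fix i b
      have "(2 * int i + of_bool b) div 2 = int i" "odd (2 * int i + of_bool b) = b" by (cases b; simp)+
      then show "h' End (2 * int i + of_bool b) = int (en b i)" by (simp add: h'_def)
    qed (simp_all add: h'_def)
    then show ?thesis using full_numbering(3) by blast
  qed
  have tree: "folded_tree m (\<lambda>i. label T (ge i)) en dir t (undead h)"
  proof unfold_locales
    show "undead h 1" using f by (simp add: folded_upto_def)
    fix w assume "w \<in> {2..m}"
    then show "undead h w \<longleftrightarrow> undead h (nt.par w) \<and>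
      (\<nexists>x. nt.link w (nt.par w) x \<and> x \<noteq> w \<and> nt.fits w x \<and> (x < w \<longrightarrow> undead h x))"
      using f unfolding folded_upto_def by simp
  qed
  have end_vt: "vt t = end_vertex T" by (simp add: t tree_of.simps)
  interpret F: folding \<Sigma> T m vt ge en dir t "undead h"
    by (intro folding.intro folding_axioms.intro tn.tree_numbering_axioms complete[THEN conjunct1]
        complete[THEN conjunct2] t(1) end_vt tree)
  have kept: "F.kept = survivors (Suc m) h" by (simp add: F.kept_def survivors_def)
  have store: "F.folded_store = (1, t, map (\<lambda>i. (label T (ge i), en False i, en True i)) F.kept)"
    by (rule F.folded_store_def)
  have size: "tree_size F.folded_store = length F.kept" unfolding tree_size_def store by simp
  have "length F.kept \<le> length [2..<Suc m]" unfolding F.kept_def by (rule length_filter_le)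
  then have "length F.kept \<le> n" by (simp only: length_upt)
  then have le: "tree_size F.folded_store \<le> n" unfolding size .
  have "h Raw (int i) = cells code F.folded_store ! i" if i: "i < length (cells code F.folded_store)" for i
  proof (cases "i < 3")
    case True
    then consider "i = 0" | "i = 1" | "i = 2" by linarith
    then show ?thesis using hd unfolding store kept by cases simp_all
  next
    case False
    define c where "c = (i - 3) div 3"
    define d where "d = (i - 3) mod 3"
    have i3: "i = 3 + (3 * c + d)" "d < 3" using False by (auto simp: c_def d_def)
    have c: "c < length F.kept" using i i3 size by (simp add: length_cells)
    let ?f = "\<lambda>(a, u, v). [int (code a), int u, int v]"
    let ?es = "map (\<lambda>i. (label T (ge i), en False i, en True i)) F.kept"
    have "cells code F.folded_store = [int (length ?es), 1, int t] @ concat (map ?f ?es)" unfolding store by simp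
    then have "cells code F.folded_store ! i = concat (map ?f ?es) ! (3 * c + d)"
      using i3(1) by (simp add: nth_append)
    also have "\<dots> = ?f (?es ! c) ! d" by (rule nth_concat_triples) (use c i3 in auto)
    finally have cell: "cells code F.folded_store ! i =
      [int (code (label T (ge (F.kept ! c)))), int (en False (F.kept ! c)), int (en True (F.kept ! c))] ! d"
      using c by simp
    have em: "h Raw (3 + 3 * int c) = int (code (label T (ge (F.kept ! c))))"
      "h Raw (4 + 3 * int c) = int (en False (F.kept ! c))" "h Raw (5 + 3 * int c) = int (en True (F.kept ! c))"
      using e c unfolding emitted_def kept by blast+
    consider "d = 0" | "d = 1" | "d = 2" using i3 by linarith
    then show ?thesis
    proof cases
      case 1
      then have "int i = 3 + 3 * int c" using i3 by simp
      then show ?thesis using em(1) unfolding cell 1 by simp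
    next
      case 2
      then have "int i = 4 + 3 * int c" using i3 by simp
      then show ?thesis using em(2) unfolding cell 2 by simp
    next
      case 3
      then have "int i = 5 + 3 * int c" using i3 by simp
      then show ?thesis using em(3) unfolding cell 3 by simp
    qed
  qed
  with le F.is_pruning_P show ?thesis by blast
qed

end

definition prune_code :: com where
  "prune_code = (number_code;; fit_code;; fold_code)"

definition prune_cost :: "nat \<Rightarrow> nat" where
  "prune_cost n = (cost prepare_code + ((loop_cost (Var Vi \<ominus> Var Vn) (scan_cost n) n) + cost (Vt :== Get Idx (Get Raw (Num 2))))) +
     ((t_row_cost n + (loop_cost (Num 1 \<ominus> Var Vi) (fit_body_cost n) n)) +
      fold_code_cost n)"

context pruning_run
begin

lemma initial_input: "input (snd (initial_store code (s0, t0, es)))"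
proof -
  let ?f = "\<lambda>(a, u, v). [int (code a), int u, int v]"
  let ?c = "cells code (s0, t0, es)"
  have c: "?c = [int n, int s0, int t0] @ concat (map ?f es)" by simp
  have len: "length ?c = 3 * n + 3" by (simp only: length_cells) (simp add: tree_size_def)
  have raw: "snd (initial_store code (s0, t0, es)) Raw (int i) = ?c ! i" if "i < 3 * n + 3" for i
    using that len by (simp add: initial_store_def initial_state_def del: cells.simps)
  have edge: "snd (initial_store code (s0, t0, es)) Raw (int (3 + (3 * j + d))) = ?f (es ! j) ! d"
    if "j < n" "d < 3" for j d
  proof -
    have "snd (initial_store code (s0, t0, es)) Raw (int (3 + (3 * j + d))) = ?c ! (3 + (3 * j + d))"
      by (rule raw) (use that in simp)
    also have "\<dots> = concat (map ?f es) ! (3 * j + d)" unfolding c by (simp add: nth_append)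
    also have "\<dots> = ?f (es ! j) ! d" by (rule nth_concat_triples) (use that in auto)
    finally show ?thesis .
  qed
  show ?thesis
    unfolding input_def
  proof (intro conjI allI impI)
    show "snd (initial_store code (s0, t0, es)) Raw 0 = int n"
      "snd (initial_store code (s0, t0, es)) Raw 1 = int s0"
      "snd (initial_store code (s0, t0, es)) Raw 2 = int t0"
      using raw[of 0] raw[of 1] raw[of 2] by simp_all
    fix j b assume j: "j < n"
    obtain a u v where a: "es ! j = (a, u, v)" by (cases "es ! j")
    show "snd (initial_store code (s0, t0, es)) Raw (3 + 3 * int j) = int (code (label T j))"
      using edge[OF j, of 0] a by (simp add: tree_of.simps)
    show "snd (initial_store code (s0, t0, es)) Raw (3 + 3 * int j + 1 + of_bool b) = int (arc_end G b j)"
      using edge[OF j, of 1] edge[OF j, of 2] a by (cases b) (simp_all add: arc_end_def tree_of.simps algebra_simps)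
  qed
qed

theorem prune_code_correct:
  "\<exists>k st R'. k \<le> prune_cost n \<and> run L prune_code (initial_store code (s0, t0, es)) k st \<and>
     tree_size R' \<le> n \<and> (\<forall>i < length (cells code R'). snd st Raw (int i) = cells code R' ! i) \<and>
     is_pruning \<Sigma> (tree_of R') T"
proof -
  let ?Q = "\<lambda>(\<sigma>, h). \<exists>R'. tree_size R' \<le> n \<and>
    (\<forall>i < length (cells code R'). h Raw (int i) = cells code R' ! i) \<and> is_pruning \<Sigma> (tree_of R') T"
  have init: "initial_store code (s0, t0, es) = (\<lambda>_. 0, snd (initial_store code (s0, t0, es)))"
    "blank (snd (initial_store code (s0, t0, es)))" "snd (initial_store code (s0, t0, es)) Idx i = 0" for i
    by (simp_all add: initial_store_def blank_def)
  have "hoare L prune_code (initial_store code (s0, t0, es)) (prune_cost n) ?Q"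
    unfolding prune_code_def prune_cost_def
  proof (subst init(1), rule hoare_seq[OF number[OF initial_input init(2,3)]])
    fix s assume "case s of (\<sigma>, h) \<Rightarrow> \<exists>vt ge en dir t. tables (Suc n) vt ge en dir h \<and> blank h \<and> t \<in> {1..Suc n} \<and>
       vt t = end_vertex T \<and> \<sigma> Vn = int n \<and> \<sigma> Vw = int n + 2 \<and> \<sigma> Vt = int t"
    then obtain \<sigma> h vt ge en dir t where s: "s = (\<sigma>, h)" and h: "tables (Suc n) vt ge en dir h" "blank h"
      "t \<in> {1..Suc n}" "vt t = end_vertex T" "\<sigma> Vw = int n + 2" "\<sigma> Vt = int t" by (cases s) blast
    interpret numbered_run \<Sigma> code s0 t0 es vt ge en dir t
      using h by unfold_locales (simp_all add: tables_def tree_of.simps)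
    have r: "ready \<sigma> h" using h by (simp add: ready_def)
    have dead: "h Dead = (\<lambda>_. 0)" using h(2) by (auto simp: blank_def)
    show "hoare L (fit_code;; fold_code) s
       ((t_row_cost n + (loop_cost (Num 1 \<ominus> Var Vi) (fit_body_cost n) n)) +
        fold_code_cost n) ?Q"
      unfolding s
    proof (rule hoare_seq[OF fit_code[OF r h(2)]])
      fix s assume I: "case s of (\<sigma>', h') \<Rightarrow> ready \<sigma>' h' \<and> fit_table nt.fits h' \<and> h' Dead = h Dead"
      obtain \<sigma>' h' where s: "s = (\<sigma>', h')" by (cases s)
      have "hoare L fold_code (\<sigma>', h') (fold_code_cost n)
        (\<lambda>(\<sigma>', h'). folded_upto (Suc m) (undead h') \<and> emitted (survivors (Suc m) h') h' \<and>
          h' Raw 0 = int (length (survivors (Suc m) h')) \<and> h' Raw 1 = 1 \<and> h' Raw 2 = int t)"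
        using I dead s by (intro fold_code) auto
      then show "hoare L fold_code s (fold_code_cost n) ?Q"
        unfolding s by (rule hoare_weaken) (use folded_result in auto)
    qed
  qed
  then show ?thesis unfolding hoare_def by (auto simp del: tree_of.simps cells.simps split: prod.splits) blast
qed

end

section \<open>Quadratic time\<close>

text \<open>With \<open>Suc n\<close> instead of \<open>n\<close> the bounds hold for the tree without edges, too.\<close>

definition linear :: "(nat \<Rightarrow> nat) \<Rightarrow> bool" where
  "linear f \<longleftrightarrow> (\<exists>a. \<forall>n. f n \<le> a * Suc n)"

definition quadratic :: "(nat \<Rightarrow> nat) \<Rightarrow> bool" where
  "quadratic f \<longleftrightarrow> (\<exists>a. \<forall>n. f n \<le> a * Suc n ^ 2)"

lemma linear_const: "linear (\<lambda>_. c)"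
  unfolding linear_def by (intro exI[of _ c]) simp

lemma linear_add: "linear f \<Longrightarrow> linear g \<Longrightarrow> linear (\<lambda>n. f n + g n)"
proof -
  assume "linear f" "linear g"
  then obtain a b where "\<And>n. f n \<le> a * Suc n" "\<And>n. g n \<le> b * Suc n" unfolding linear_def by blast
  then have "f n + g n \<le> (a + b) * Suc n" for n unfolding distrib_right by (rule add_mono)
  then show ?thesis unfolding linear_def by blast
qed

lemma linear_loop: "linear (\<lambda>n. loop_cost e c (Suc (Suc n)))"
  unfolding linear_def loop_cost_def
  by (intro exI[of _ "2 * (exp_cost e + 2 + c) + (exp_cost e + 2)"]) (simp add: algebra_simps)

lemma linear_loop': "linear (\<lambda>n. loop_cost e c n)"
  unfolding linear_def loop_cost_def
  by (intro exI[of _ "(exp_cost e + 2 + c) + (exp_cost e + 2)"]) (simp add: algebra_simps)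

lemma quadratic_linear: "linear f \<Longrightarrow> quadratic f"
proof -
  assume "linear f"
  then obtain a where a: "\<And>n. f n \<le> a * Suc n" unfolding linear_def by blast
  have "f n \<le> a * Suc n ^ 2" for n
    using a[of n] by (rule order_trans) (simp add: power2_eq_square)
  then show ?thesis unfolding quadratic_def by blast
qed

lemma quadratic_add: "quadratic f \<Longrightarrow> quadratic g \<Longrightarrow> quadratic (\<lambda>n. f n + g n)"
proof -
  assume "quadratic f" "quadratic g"
  then obtain a b where "\<And>n. f n \<le> a * Suc n ^ 2" "\<And>n. g n \<le> b * Suc n ^ 2" unfolding quadratic_def by blast
  then have "f n + g n \<le> (a + b) * Suc n ^ 2" for n unfolding distrib_right by (rule add_mono)
  then show ?thesis unfolding quadratic_def by blast
qed

lemma quadratic_times: "linear f \<Longrightarrow> quadratic (\<lambda>n. n * f n)"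
proof -
  assume "linear f"
  then obtain a where a: "\<And>n. f n \<le> a * Suc n" unfolding linear_def by blast
  have "n * f n \<le> a * Suc n ^ 2" for n
  proof -
    have "n * f n \<le> Suc n * (a * Suc n)" using a by (intro mult_le_mono) auto
    then show ?thesis by (simp only: power2_eq_square ac_simps)
  qed
  then show ?thesis unfolding quadratic_def by blast
qed

lemma quadratic_loop: "linear f \<Longrightarrow> quadratic (\<lambda>n. loop_cost e (f n) n)"
  unfolding loop_cost_def
  by (intro quadratic_add quadratic_times linear_add linear_const quadratic_linear[OF linear_const])

lemma linear_loops: "linear scan_cost" "linear t_row_cost" "linear fit_body_cost" "linear kill_body_cost"
proof -
  show "linear scan_cost"
    unfolding scan_cost_def[abs_def] by (intro linear_add linear_const linear_loop')
  have t: "linear (\<lambda>n. times_loop_cost (Suc (Suc n)))"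
    unfolding times_loop_cost_def by (intro linear_loop)
  show "linear t_row_cost" "linear fit_body_cost" "linear kill_body_cost"
    unfolding t_row_cost_def[abs_def] fit_body_cost_def[abs_def] kill_body_cost_def[abs_def]
    by (intro linear_add linear_const linear_loop t)+
qed

lemma quadratic_prune_cost: "quadratic prune_cost"
  unfolding prune_cost_def[abs_def] fold_code_cost_def
  by (intro quadratic_add quadratic_loop linear_loops quadratic_linear[OF linear_const]
      quadratic_linear[OF linear_loops(2)])

theorem theorem5p4:
  fixes \<Sigma> :: "'l set" and code :: "'l \<Rightarrow> nat"
  assumes "finite \<Sigma>" and "inj_on code \<Sigma>"
  shows "\<exists>P :: instr list.
    (\<exists>p :: nat poly. \<forall>R. sigma_tree \<Sigma> (tree_of R) \<longrightarrow>
       computes_pruning_within log_cost \<Sigma> code P R (poly p (input_bits code R))) \<and>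
    (\<exists>f :: nat \<Rightarrow> nat. (\<lambda>n. real (f n)) \<in> O(\<lambda>n. real n ^ 2) \<and>
       (\<forall>R. sigma_tree \<Sigma> (tree_of R) \<longrightarrow>
          computes_pruning_within unit_cost \<Sigma> code P R (f (tree_size R))))"
proof -
  obtain a where a: "\<And>n. prune_cost n \<le> a * Suc n ^ 2" using quadratic_prune_cost unfolding quadratic_def by blast
  \<comment> \<open>The polynomial \<open>a * (x + 1)\<^sup>2\<close>.\<close>
  let ?K = "[:a, 2 * a, a:]"
  have K: "poly ?K n = a * Suc n ^ 2" for n by (simp add: power2_eq_square algebra_simps)
  have run: "\<exists>n st R'. n \<le> poly ?K (tree_size R) \<and>
        run (3 * int (tree_size R) + 3) prune_code (initial_store code R) n st \<and>
        tree_size R' \<le> tree_size R \<and> (\<forall>i < length (cells code R'). snd st Raw (int i) = cells code R' ! i) \<and>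
        is_pruning \<Sigma> (tree_of R') (tree_of R)" if "sigma_tree \<Sigma> (tree_of R)" for R
  proof -
    obtain s0 t0 es where R: "R = (s0, t0, es)" by (cases R rule: prod_cases3)
    interpret pruning_run \<Sigma> code s0 t0 es
      using that assms(2) unfolding R by unfold_locales
    have size: "tree_size R = length es" by (simp add: R tree_size_def)
    show ?thesis using prune_code_correct a[of "length es"] unfolding size K unfolding R
      by (meson order_trans)
  qed
  note within = program_within[where K = ?K and c = prune_code and \<Sigma> = \<Sigma> and code = code, OF run]
  have "(\<lambda>n. real (5 + poly ?K n)) \<in> O(\<lambda>n. real n ^ 2)"
  proof (rule bigoI[where c = "real (5 + 4 * a)"], rule eventually_mono[OF eventually_ge_at_top[of 1]])
    fix n :: nat assume n: "1 \<le> n"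
    then have "Suc n ^ 2 \<le> (2 * n) ^ 2" by (intro power_mono) auto
    then have "a * Suc n ^ 2 \<le> a * (2 * n) ^ 2" by (rule mult_le_mono2)
    then have "a * Suc n ^ 2 \<le> 4 * a * n ^ 2" by (simp only: power_mult_distrib) simp
    moreover have "5 \<le> 5 * n ^ 2" using n by simp
    ultimately have "5 + poly ?K n \<le> (5 + 4 * a) * n ^ 2" unfolding K distrib_right by linarith
    then have "real (5 + poly ?K n) \<le> real ((5 + 4 * a) * n ^ 2)" by (simp only: of_nat_le_iff)
    then show "norm (real (5 + poly ?K n)) \<le> real (5 + 4 * a) * norm (real n ^ 2)"
      by (simp only: of_nat_mult of_nat_power real_norm_def abs_of_nat power_abs)
  qed
  then show ?thesis using within by (intro exI[of _ "program prune_code"] conjI exI[of _ "\<lambda>n. 5 + poly ?K n"]) auto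
qed

end
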